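(* Let $\rho_1,\dots,\rho_K\in\mathcal{D}(\mathcal{H}_A)$ and $\sigma_{AB}\in\mathcal{D}(\mathcal{H}_A\otimes\mathcal{H}_B)$ be unknown states, let $c_1,\dots,c_K\in\mathbb{R}$, $c:=\sum_{j}|c_j|$, and $H:=\sum_{j=1}^Kc_j\rho_j$. For $t\in\mathbb{R}$ and $\delta>0$ there is a protocol using $n=O(c^2t^2/\delta)$ samples from the states $\{\rho_1,\dots,\rho_K\}$ that transforms $\sigma_{AB}$ into $\tilde\sigma_{AB}$ with $$\tfrac12\big\|(e^{-iHt}\otimes\mathbb{1}_B)\sigma_{AB}(e^{iHt}\otimes\mathbb{1}_B)-\tilde\sigma_{AB}\big\|_1\le O(\delta).$$ Moreover, the expected number of copies of $\rho_j$ consumed is $O(|c_j|\,c\,t^2/\delta)$.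
   Context: $\mathcal{D}(\mathcal{H})$ denotes the set of density operators on $\mathcal{H}$; $\|A\|_1=\operatorname{Tr}\sqrt{AA^\dagger}$. The protocol is fixed independently of the unknown states (it may depend on the known $c_j$, $t$, $\delta$).
   Formalization: The sample count is bounded by ⌈C c²t²/δ⌉ and the expected copies of ρ_j by C(|c_j|c t²/δ + |c_j|/c), since without rounding up to one sample the bound fails when c²t² ≪ δ ≪ c|t|; the Hilbert spaces are taken finite-dimensional. *)

theory Defs
  imports Complex_Main "Jordan_Normal_Form.Matrix"
begin

definition mtrace :: "complex mat \<Rightarrow> complex" where
  "mtrace A = (\<Sum>i<dim_row A. A $$ (i, i))"

definition adj :: "complex mat \<Rightarrow> complex mat" where
  "adj A = mat (dim_col A) (dim_row A) (\<lambda>(i, j). cnj (A $$ (j, i)))"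

definition psd :: "complex mat \<Rightarrow> bool" where
  "psd A \<longleftrightarrow> A \<in> carrier_mat (dim_row A) (dim_row A) \<and>
     (\<forall>v \<in> carrier_vec (dim_row A).
        let z = (\<Sum>i<dim_row A. \<Sum>j<dim_row A. cnj (v $ i) * A $$ (i, j) * v $ j)
        in Im z = 0 \<and> Re z \<ge> 0)"

definition density :: "nat \<Rightarrow> complex mat \<Rightarrow> bool" where
  "density d \<rho> \<longleftrightarrow> \<rho> \<in> carrier_mat d d \<and> psd \<rho> \<and> mtrace \<rho> = 1"

definition msqrt :: "complex mat \<Rightarrow> complex mat" where
  "msqrt P = (THE Q. psd Q \<and> Q * Q = P)"

definition trace_norm :: "complex mat \<Rightarrow> real" where
  "trace_norm A = Re (mtrace (msqrt (A * adj A)))"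

definition kron :: "complex mat \<Rightarrow> complex mat \<Rightarrow> complex mat" where
  "kron A B = mat (dim_row A * dim_row B) (dim_col A * dim_col B)
     (\<lambda>(i, j). A $$ (i div dim_row B, j div dim_col B) * B $$ (i mod dim_row B, j mod dim_col B))"

fun kron_list :: "complex mat list \<Rightarrow> complex mat" where
  "kron_list [] = 1\<^sub>m 1"
| "kron_list (A # As) = kron A (kron_list As)"

definition mexp :: "complex mat \<Rightarrow> complex mat" where
  "mexp A = mat (dim_row A) (dim_row A)
     (\<lambda>(i, j). \<Sum>k. (A ^\<^sub>m k) $$ (i, j) / of_nat (fact k))"

(* quantum channel C^din -> C^dout given in Kraus form *)
definition is_channel :: "nat \<Rightarrow> nat \<Rightarrow> complex mat list \<Rightarrow> bool" where
  "is_channel din dout Ks \<longleftrightarrow> (\<forall>K \<in> set Ks. K \<in> carrier_mat dout din) \<and>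
     foldr (\<lambda>K M. adj K * K + M) Ks (0\<^sub>m din din) = 1\<^sub>m din"

definition apply_channel :: "nat \<Rightarrow> complex mat list \<Rightarrow> complex mat \<Rightarrow> complex mat" where
  "apply_channel dout Ks X = foldr (\<lambda>K M. K * X * adj K + M) Ks (0\<^sub>m dout dout)"

definition ham :: "nat \<Rightarrow> nat \<Rightarrow> (nat \<Rightarrow> real) \<Rightarrow> (nat \<Rightarrow> complex mat) \<Rightarrow> complex mat" where
  "ham dA K c \<rho> = mat dA dA (\<lambda>(i, k). \<Sum>j<K. complex_of_real (c j) * \<rho> j $$ (i, k))"

(* A protocol: with probability p js (js in the finite set S of sample sequences),
   consume one copy of rho_j for each entry j of js and apply the channel Phi js
   to sigma_AB (x) rho_{js!0} (x) ... (x) rho_{js!(m-1)}, producing a state on A(x)B. *)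
definition protocol_output ::
  "nat \<Rightarrow> nat \<Rightarrow> nat list set \<Rightarrow> (nat list \<Rightarrow> real) \<Rightarrow> (nat list \<Rightarrow> complex mat list)
    \<Rightarrow> (nat \<Rightarrow> complex mat) \<Rightarrow> complex mat \<Rightarrow> complex mat" where
  "protocol_output dA dB S p \<Phi> \<rho> \<sigma> = mat (dA * dB) (dA * dB) (\<lambda>(i, k).
     \<Sum>js\<in>S. complex_of_real (p js) *
        apply_channel (dA * dB) (\<Phi> js) (kron \<sigma> (kron_list (map \<rho> js))) $$ (i, k))"

definition valid_protocol ::
  "nat \<Rightarrow> nat \<Rightarrow> nat \<Rightarrow> nat list set \<Rightarrow> (nat list \<Rightarrow> real) \<Rightarrow> (nat list \<Rightarrow> complex mat list) \<Rightarrow> bool" where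
  "valid_protocol dA dB K S p \<Phi> \<longleftrightarrow> finite S \<and> (\<forall>js \<in> S. p js \<ge> 0) \<and> (\<Sum>js\<in>S. p js) = 1 \<and>
     (\<forall>js \<in> S. set js \<subseteq> {..<K} \<and> is_channel (dA * dB * dA ^ length js) (dA * dB) (\<Phi> js))"

end

theory Submission
  imports Defs "Jordan_Normal_Form.Spectral_Radius"
begin

text \<open>Write \<open>y = c |t|\<close> and \<open>x = y / n\<close>. In each of \<open>n\<close> rounds an index \<open>j\<close> is drawn with probability
  \<open>|c\<^sub>j| / c\<close> and the system \<open>A\<close> interacts with a fresh copy of \<open>\<rho>\<^sub>j\<close> through \<open>exp (\<mp> \<i> x SWAP)\<close>, the sign
  being that of \<open>c\<^sub>j t\<close>, after which the copy is discarded. On average one round maps \<open>X\<close> to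
  \<open>cos\<^sup>2 x X + sin\<^sup>2 x T - \<i> (sin x cos x / x) [A, X]\<close> with \<open>A = t H / n\<close> and \<open>T\<close> a state, which agrees with
  \<open>exp (- \<i> A) X exp (\<i> A)\<close> up to \<open>8 x\<^sup>2\<close> in trace norm. Both maps are trace-norm contractions, so the errors
  add up to \<open>8 n x\<^sup>2 = 8 y\<^sup>2 / n\<close>, and \<open>n \<ge> 4 y\<^sup>2 / \<delta>\<close> suffices. For \<open>\<delta> \<ge> 1\<close> nothing has to be done.\<close>

section \<open>Adjoints and the spectral theorem\<close>

text \<open>Sampling with probability \<open>|c j| / ctot\<close> forgets the signs; the direction
  of each rotation restores them, so the averaged commutator is the one with \<open>t H / n\<close>,
  up to a scalar factor. That factor, sin x cos x / x, differs from 1 by at most x and multiplies a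
  commutator of size 2 x, so a round errs only to second order. The constant is 8 = 1 + 1 + 2 + 1 +
  2 + 1, one summand per term of the expansion. Trace distance is half the trace norm, so the target
  is 8 y^2 / n \<le> 2 \<delta>, which is where 4 y^2 / \<delta> comes from. The estimate of a round
  wants x \<le> 1, and this follows from the choice of n only when \<delta> < 1; for \<delta> \<ge>
  1 any two states are already close enough. A further obstacle is that \<open>trace_norm\<close>
  rests on a definite description of a square root. All estimates are therefore carried out on
  explicit differences of positive matrices, and a trace norm is taken only at the very end.
  Rounding n up to an integer costs at most one extra round, which explains the summand
  \<open>|c j| / ctot\<close> in the expected number of copies.\<close>

declare index_mult_mat(1) [simp del]

lemma mult_carrier_square [simp]:
  "A \<in> carrier_mat n n \<Longrightarrow> B \<in> carrier_mat n n \<Longrightarrow> A * B \<in> carrier_mat n n"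
  by (rule mult_carrier_mat)

lemma index_mult_mat_sum:
  assumes "A \<in> carrier_mat n m" "B \<in> carrier_mat m k" "i < n" "j < k"
  shows "(A * B) $$ (i, j) = (\<Sum>l<m. A $$ (i, l) * B $$ (l, j))"
  using assms by (auto simp: index_mult_mat(1) scalar_prod_def lessThan_atLeast0 intro!: sum.cong)

lemma adj_carrier [simp]: "A \<in> carrier_mat n m \<Longrightarrow> adj A \<in> carrier_mat m n"
  by (auto simp: adj_def)

lemma dim_adj [simp]: "dim_row (adj A) = dim_col A" "dim_col (adj A) = dim_row A"
  by (simp_all add: adj_def)

lemma adj_index: "A \<in> carrier_mat n m \<Longrightarrow> i < m \<Longrightarrow> j < n \<Longrightarrow> adj A $$ (i, j) = cnj (A $$ (j, i))"
  by (auto simp: adj_def)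

lemma adj_adj [simp]: "adj (adj A) = A"
  by (rule eq_matI) (auto simp: adj_def)

lemma adj_one [simp]: "adj (1\<^sub>m n) = 1\<^sub>m n"
  by (rule eq_matI) (auto simp: adj_def)

lemma adj_mult:
  assumes "A \<in> carrier_mat n m" "B \<in> carrier_mat m k"
  shows "adj (A * B) = adj B * adj A"
proof (rule eq_matI)
  fix i j assume "i < dim_row (adj B * adj A)" "j < dim_col (adj B * adj A)"
  then have ij: "i < k" "j < n" using assms by (auto simp: adj_def)
  have "adj (A * B) $$ (i, j) = cnj ((A * B) $$ (j, i))"
    using assms ij by (intro adj_index) auto
  also have "\<dots> = (\<Sum>l<m. cnj (A $$ (j, l)) * cnj (B $$ (l, i)))"
    using assms ij by (simp add: index_mult_mat_sum[OF assms] cnj_sum)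
  also have "\<dots> = (adj B * adj A) $$ (i, j)"
    using assms ij
    by (simp add: index_mult_mat_sum[of "adj B" k m "adj A" n] adj_index[of A n m] adj_index[of B m k] mult.commute)
  finally show "adj (A * B) $$ (i, j) = (adj B * adj A) $$ (i, j)" .
qed (use assms in \<open>auto simp: adj_def\<close>)

section \<open>Diagonal and unitary matrices\<close>

definition mdiag :: "nat \<Rightarrow> (nat \<Rightarrow> complex) \<Rightarrow> complex mat" where
  "mdiag n f = mat n n (\<lambda>(i, j). if i = j then f i else 0)"

lemma mdiag_carrier [simp]: "mdiag n f \<in> carrier_mat n n"
  by (simp add: mdiag_def)

lemma dim_mdiag [simp]: "dim_row (mdiag n f) = n" "dim_col (mdiag n f) = n"
  by (simp_all add: mdiag_def)

lemma adj_mdiag: "adj (mdiag n f) = mdiag n (\<lambda>i. cnj (f i))"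
  by (intro eq_matI) (auto simp: adj_def mdiag_def)

lemma mult_mdiag_index:
  assumes "A \<in> carrier_mat m n" "i < m" "j < n"
  shows "(A * mdiag n f) $$ (i, j) = A $$ (i, j) * f j"
proof -
  have "(A * mdiag n f) $$ (i, j) = (\<Sum>l<n. A $$ (i, l) * (if l = j then f l else 0))"
    using assms by (subst index_mult_mat_sum[of _ m n _ n]) (auto simp: mdiag_def)
  also have "\<dots> = (\<Sum>l<n. if l = j then A $$ (i, l) * f l else 0)"
    by (rule sum.cong) auto
  finally show ?thesis using assms by simp
qed

lemma mdiag_mult_index:
  assumes "A \<in> carrier_mat n m" "i < n" "j < m"
  shows "(mdiag n f * A) $$ (i, j) = f i * A $$ (i, j)"
proof -
  have "(mdiag n f * A) $$ (i, j) = (\<Sum>l<n. (if i = l then f i else 0) * A $$ (l, j))"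
    using assms by (subst index_mult_mat_sum[of _ n n _ m]) (auto simp: mdiag_def)
  also have "\<dots> = (\<Sum>l<n. if i = l then f i * A $$ (l, j) else 0)"
    by (rule sum.cong) auto
  finally show ?thesis using assms by simp
qed

lemma mdiag_mult: "mdiag n f * mdiag n g = mdiag n (\<lambda>i. f i * g i)"
proof (rule eq_matI)
  fix i j assume "i < dim_row (mdiag n (\<lambda>i. f i * g i))" "j < dim_col (mdiag n (\<lambda>i. f i * g i))"
  then show "(mdiag n f * mdiag n g) $$ (i, j) = mdiag n (\<lambda>i. f i * g i) $$ (i, j)"
    by (simp add: mult_mdiag_index[OF mdiag_carrier]) (simp add: mdiag_def)
qed auto

lemma unitary_conj_index:
  assumes "V \<in> carrier_mat n m" "i < n" "j < n"
  shows "(V * mdiag m f * adj V) $$ (i, j) = (\<Sum>l<m. V $$ (i, l) * f l * cnj (V $$ (j, l)))"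
  using assms
  by (subst index_mult_mat_sum[of _ n m _ n]) (auto simp: mult_mdiag_index[of _ n m] adj_index[of V n m])

definition unitary :: "nat \<Rightarrow> complex mat \<Rightarrow> bool" where
  "unitary n V \<longleftrightarrow> V \<in> carrier_mat n n \<and> adj V * V = 1\<^sub>m n \<and> V * adj V = 1\<^sub>m n"

lemma unitaryI:
  assumes "V \<in> carrier_mat n n" "adj V * V = 1\<^sub>m n"
  shows "unitary n V"
  using assms mat_mult_left_right_inverse[of "adj V" n V] by (auto simp: unitary_def)

lemma unitary_mult:
  assumes "unitary n V" "unitary n W"
  shows "unitary n (V * W)"
proof (rule unitaryI)
  have c: "V \<in> carrier_mat n n" "W \<in> carrier_mat n n" using assms by (auto simp: unitary_def)
  have "adj (V * W) * (V * W) = adj W * (adj V * (V * W))"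
    using c by (simp add: adj_mult[of _ n n _ n] assoc_mult_mat[of _ n n _ n _ n])
  also have "adj V * (V * W) = (adj V * V) * W"
    using c by (simp add: assoc_mult_mat[of _ n n _ n _ n])
  finally show "adj (V * W) * (V * W) = 1\<^sub>m n" using assms c by (simp add: unitary_def)
qed (use assms in \<open>auto simp: unitary_def\<close>)

text \<open>Complete v to a basis, apply Gram-Schmidt, which leaves the first vector unchanged, and
  normalise. The scalar a is the norm of v. This supplies the change of basis for one deflation step
  of the spectral theorem.\<close>

lemma vector_extends_to_unitary:
  fixes v :: "complex vec"
  assumes v: "v \<in> carrier_vec n" and v0: "v \<noteq> 0\<^sub>v n"
  shows "\<exists>W a. unitary n W \<and> a \<noteq> 0 \<and> (\<forall>i<n. v $ i = a * W $$ (i, 0))"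
proof -
  have n: "n \<noteq> 0" using v v0 by auto
  interpret cof_vec_space n "TYPE(complex)" .
  define b where "b = basis_completion v"
  define ws where "ws = gram_schmidt n b"
  from basis_completion[OF v v0, folded b_def]
  have dist_b: "distinct b" and indep: "\<not> lin_dep (set b)" and b: "set b \<subseteq> carrier_vec n"
    and hdb: "hd b = v" and len_b: "length b = n" by auto
  from hdb len_b n obtain vs where bv: "b = v # vs" by (cases b, auto)
  from gram_schmidt_result[OF b dist_b indep refl, folded ws_def]
  have ws: "set ws \<subseteq> carrier_vec n" "corthogonal ws" "length ws = n" by (auto simp: len_b)
  from gram_schmidt_hd[OF v, of vs, folded bv] have hdws: "hd ws = v" unfolding ws_def .
  have ws0: "ws ! 0 = v" using hdws ws n by (cases ws) auto
  define r where "r j = (\<Sum>k<n. (cmod (ws ! j $ k))\<^sup>2)" for j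
  have wsc: "ws ! j \<in> carrier_vec n" if "j < n" for j using ws that by auto
  have ip: "ws ! j \<bullet>c ws ! i = (\<Sum>k<n. ws ! j $ k * cnj (ws ! i $ k))" if "i < n" "j < n" for i j
    using wsc[of i] wsc[of j] that by (auto simp: scalar_prod_def lessThan_atLeast0 intro!: sum.cong)
  have ipr: "ws ! j \<bullet>c ws ! j = of_real (r j)" if "j < n" for j
    using that by (simp only: ip r_def of_real_sum complex_norm_square)
  have r: "r j > 0" if "j < n" for j
  proof -
    have "ws ! j \<bullet>c ws ! j \<noteq> 0" using corthogonalD[OF ws(2), of j j] that ws by auto
    then have "r j \<noteq> 0" using ipr[OF that] by auto
    moreover have "r j \<ge> 0" by (auto simp: r_def intro: sum_nonneg)
    ultimately show ?thesis by simp
  qed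
  \<comment> \<open>The vectors of \<open>ws\<close> are orthogonal but of arbitrary length;
    \<open>r j\<close> is the squared length of the j-th one, and the columns of W are the
    normalised vectors.\<close>
  define W where "W = mat n n (\<lambda>(i, j). ws ! j $ i / of_real (sqrt (r j)))"
  have Wc: "W \<in> carrier_mat n n" by (simp add: W_def)
  have "adj W * W = 1\<^sub>m n"
  proof (rule eq_matI)
    fix i j assume "i < dim_row (1\<^sub>m n :: complex mat)" "j < dim_col (1\<^sub>m n :: complex mat)"
    then have ij: "i < n" "j < n" by auto
    have "(adj W * W) $$ (i, j) = (\<Sum>k<n. ws ! j $ k * cnj (ws ! i $ k) / (of_real (sqrt (r j)) * of_real (sqrt (r i))))"
      using ij Wc by (subst index_mult_mat_sum[of _ n n _ n])
        (auto simp: adj_index[OF Wc], auto simp: W_def mult.commute intro!: sum.cong)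
    also have "\<dots> = (ws ! j \<bullet>c ws ! i) / (of_real (sqrt (r j)) * of_real (sqrt (r i)))"
      using ij by (simp add: ip sum_divide_distrib)
    also have "\<dots> = 1\<^sub>m n $$ (i, j)"
    proof (cases "i = j")
      case True
      have "complex_of_real (r j) / (of_real (sqrt (r j)) * of_real (sqrt (r j))) = of_real (r j / (sqrt (r j) * sqrt (r j)))"
        by (simp only: of_real_divide of_real_mult)
      also have "\<dots> = 1" using r[OF ij(2)] by simp
      finally show ?thesis using True ij ipr[OF ij(2)] by simp
    next
      case False
      then show ?thesis using corthogonalD[OF ws(2), of j i] ij ws by auto
    qed
    finally show "(adj W * W) $$ (i, j) = 1\<^sub>m n $$ (i, j)" .
  qed (use Wc in auto)
  then have "unitary n W" using Wc by (rule unitaryI[rotated])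
  moreover have "sqrt (r 0) \<noteq> 0" using r[of 0] n by auto
  moreover have "\<forall>i<n. v $ i = of_real (sqrt (r 0)) * W $$ (i, 0)"
    using calculation(2) n by (auto simp: W_def ws0)
  ultimately show ?thesis by (intro exI[of _ W] exI[of _ "of_real (sqrt (r 0))"]) auto
qed

text \<open>Deflation: in an orthonormal basis that starts with an eigenvector, the first column of
  A vanishes off the diagonal, hence by symmetry so does the first row. The remaining block is
  Hermitian of size m and is diagonalised by induction.\<close>

lemma hermitian_spectral:
  assumes "A \<in> carrier_mat n n" "adj A = A"
  shows "\<exists>V (l :: nat \<Rightarrow> real). unitary n V \<and> A = V * mdiag n (\<lambda>i. of_real (l i)) * adj V"
  using assms
proof (induction n arbitrary: A)
  case 0
  show ?case
    by (intro exI[of _ "1\<^sub>m 0"] exI[of _ "\<lambda>_. 0"] conjI eq_matI)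
      (use 0 in \<open>auto simp: unitary_def adj_def mdiag_def\<close>)
next
  case (Suc m)
  let ?n = "Suc m"
  obtain e where e: "eigenvalue A e" using spectrum_non_empty[of A ?n] Suc.prems by (auto simp: spectrum_def)
  then obtain v where v: "v \<in> carrier_vec ?n" "v \<noteq> 0\<^sub>v ?n" "A *\<^sub>v v = e \<cdot>\<^sub>v v"
    using Suc.prems by (auto simp: eigenvalue_def eigenvector_def)
  obtain W a where W: "unitary ?n W" and a: "a \<noteq> 0" and vW: "\<And>i. i < ?n \<Longrightarrow> v $ i = a * W $$ (i, 0)"
    using vector_extends_to_unitary[OF v(1,2)] by auto
  have Wc: "W \<in> carrier_mat ?n ?n" using W by (simp add: unitary_def)
  note Ac = Suc.prems(1)
  define A' where "A' = adj W * A * W"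
  have A'c: "A' \<in> carrier_mat ?n ?n" using Ac Wc by (auto simp: A'_def)
  have A'h: "adj A' = A'" using Ac Wc Suc.prems(2)
    by (simp add: A'_def adj_mult[of _ ?n ?n _ ?n] assoc_mult_mat[of _ ?n ?n _ ?n _ ?n])
  \<comment> \<open>Column 0 of W is v divided by the nonzero scalar a, so it is an eigenvector as
    well.\<close>
  have AW0: "(A * W) $$ (k, 0) = e * W $$ (k, 0)" if "k < ?n" for k
  proof -
    have "(A *\<^sub>v v) $ k = (\<Sum>l<?n. A $$ (k, l) * v $ l)"
      using that Ac v(1) by (auto simp: scalar_prod_def lessThan_atLeast0 intro!: sum.cong)
    also have "\<dots> = a * (\<Sum>l<?n. A $$ (k, l) * W $$ (l, 0))"
      unfolding sum_distrib_left by (intro sum.cong refl) (auto simp: vW)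
    also have "(\<Sum>l<?n. A $$ (k, l) * W $$ (l, 0)) = (A * W) $$ (k, 0)"
      using that by (simp add: index_mult_mat_sum[OF Ac Wc] del: sum.lessThan_Suc)
    finally have "a * (A * W) $$ (k, 0) = e * (a * W $$ (k, 0))" using v that vW[OF that] by (auto simp: algebra_simps)
    then show ?thesis using a by auto
  qed
  have col0: "A' $$ (i, 0) = (if i = 0 then e else 0)" if "i < ?n" for i
  proof -
    have "A' $$ (i, 0) = (adj W * (A * W)) $$ (i, 0)"
      using Ac Wc by (simp add: A'_def assoc_mult_mat[of _ ?n ?n _ ?n _ ?n])
    also have "\<dots> = (\<Sum>k<?n. adj W $$ (i, k) * (A * W) $$ (k, 0))"
      using Ac Wc that by (intro index_mult_mat_sum[of _ ?n ?n _ ?n]) auto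
    also have "\<dots> = e * (\<Sum>k<?n. adj W $$ (i, k) * W $$ (k, 0))"
      unfolding sum_distrib_left by (intro sum.cong refl) (auto simp: AW0)
    also have "(\<Sum>k<?n. adj W $$ (i, k) * W $$ (k, 0)) = (adj W * W) $$ (i, 0)"
      using Wc that by (intro index_mult_mat_sum[of _ ?n ?n _ ?n, symmetric]) auto
    finally show ?thesis using W that by (auto simp: unitary_def)
  qed
  have hA': "A' $$ (i, j) = cnj (A' $$ (j, i))" if "i < ?n" "j < ?n" for i j
    using adj_index[OF A'c that] A'h by simp
  \<comment> \<open>Hermiticity transports the shape of column 0 to row 0 and makes the corner entry
    e real.\<close>
  have row0: "A' $$ (0, j) = (if j = 0 then e else 0)" if "j < ?n" for j
    using hA'[of 0 j] hA'[of 0 0] col0[of j] col0[of 0] that by auto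
  have e: "e = of_real (Re e)" using hA'[of 0 0] col0[of 0] by (auto simp: complex_eq_iff)
  define A3 where "A3 = mat m m (\<lambda>(i, j). A' $$ (Suc i, Suc j))"
  have "adj A3 = A3"
    by (rule eq_matI) (auto simp: A3_def adj_def hA'[symmetric])
  then obtain V3 l3 where V3: "unitary m V3" and A3: "A3 = V3 * mdiag m (\<lambda>i. of_real (l3 i :: real)) * adj V3"
    using Suc.IH[of A3] by (auto simp: A3_def)
  have V3c: "V3 \<in> carrier_mat m m" using V3 by (simp add: unitary_def)
  \<comment> \<open>The block sum of the 1 by 1 identity and V3, written out by case distinction on
    the indices.\<close>
  define V' where "V' = mat ?n ?n (\<lambda>(i, j). case i of 0 \<Rightarrow> (case j of 0 \<Rightarrow> 1 | Suc j' \<Rightarrow> 0)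
     | Suc i' \<Rightarrow> (case j of 0 \<Rightarrow> 0 | Suc j' \<Rightarrow> V3 $$ (i', j')))"
  define l where "l = case_nat (Re e) l3"
  have V'c: "V' \<in> carrier_mat ?n ?n" by (simp add: V'_def)
  have V'i: "V' $$ (0, 0) = 1" "\<And>j. j < m \<Longrightarrow> V' $$ (0, Suc j) = 0" "\<And>j. j < m \<Longrightarrow> V' $$ (Suc j, 0) = 0"
    "\<And>i j. i < m \<Longrightarrow> j < m \<Longrightarrow> V' $$ (Suc i, Suc j) = V3 $$ (i, j)"
    by (auto simp: V'_def)
  have "adj V' * V' = 1\<^sub>m ?n"
  proof (rule eq_matI)
    fix i j assume "i < dim_row (1\<^sub>m ?n :: complex mat)" "j < dim_col (1\<^sub>m ?n :: complex mat)"
    then have ij: "i < ?n" "j < ?n" by auto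
    have V3i: "(\<Sum>k<m. cnj (V3 $$ (k, i')) * V3 $$ (k, j')) = (if i' = j' then 1 else 0)" if "i' < m" "j' < m" for i' j'
    proof -
      have "(adj V3 * V3) $$ (i', j') = (\<Sum>k<m. adj V3 $$ (i', k) * V3 $$ (k, j'))"
        using V3c that by (intro index_mult_mat_sum[of _ m m _ m]) auto
      then show ?thesis using V3 V3c that by (simp add: unitary_def adj_index[of V3 m m])
    qed
    have "(adj V' * V') $$ (i, j) = (\<Sum>k<?n. cnj (V' $$ (k, i)) * V' $$ (k, j))"
      using V'c ij by (subst index_mult_mat_sum[of _ ?n ?n _ ?n]) (auto simp: adj_index[of V' ?n ?n])
    also have "\<dots> = 1\<^sub>m ?n $$ (i, j)"
      using ij unfolding sum.lessThan_Suc_shift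
      by (cases i; cases j) (auto simp: V'i V3i)
    finally show "(adj V' * V') $$ (i, j) = 1\<^sub>m ?n $$ (i, j)" .
  qed (use V'c in auto)
  then have V'u: "unitary ?n V'" using V'c by (rule unitaryI[rotated])
  have A'e: "A' = V' * mdiag ?n (\<lambda>i. of_real (l i)) * adj V'"
  proof (rule eq_matI)
    fix i j assume "i < dim_row (V' * mdiag ?n (\<lambda>i. of_real (l i)) * adj V')"
      "j < dim_col (V' * mdiag ?n (\<lambda>i. of_real (l i)) * adj V')"
    then have ij: "i < ?n" "j < ?n" using V'c by (auto simp: adj_def)
    have A3i: "A' $$ (Suc i', Suc j') = (\<Sum>k<m. V3 $$ (i', k) * of_real (l3 k) * cnj (V3 $$ (j', k)))"
      if "i' < m" "j' < m" for i' j'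
    proof -
      have "A' $$ (Suc i', Suc j') = A3 $$ (i', j')" using that by (simp add: A3_def)
      then show ?thesis using that unfolding A3 by (simp add: unitary_conj_index[OF V3c])
    qed
    have "(V' * mdiag ?n (\<lambda>i. of_real (l i)) * adj V') $$ (i, j) =
        (\<Sum>k<?n. V' $$ (i, k) * of_real (l k) * cnj (V' $$ (j, k)))"
      using ij by (rule unitary_conj_index[OF V'c])
    also have "\<dots> = A' $$ (i, j)"
      using ij e unfolding sum.lessThan_Suc_shift
      by (cases i; cases j) (auto simp: V'i A3i row0 col0 l_def)
    finally show "A' $$ (i, j) = (V' * mdiag ?n (\<lambda>i. of_real (l i)) * adj V') $$ (i, j)" ..
  qed (use A'c V'c in auto)
  have "A = W * A' * adj W"
  proof -
    have "W * A' * adj W = (W * adj W) * A * (W * adj W)"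
      using Wc Ac by (simp add: A'_def assoc_mult_mat[of _ ?n ?n _ ?n _ ?n])
    then show ?thesis using W Ac by (simp add: unitary_def)
  qed
  also have "\<dots> = (W * V') * mdiag ?n (\<lambda>i. of_real (l i)) * adj (W * V')"
    using Wc V'c by (simp add: A'e adj_mult[of _ ?n ?n _ ?n] assoc_mult_mat[of _ ?n ?n _ ?n _ ?n])
  finally show ?case using unitary_mult[OF W V'u] by blast
qed

section \<open>Positive semidefinite matrices and the trace norm\<close>

lemma unitary_carrier: "unitary n V \<Longrightarrow> V \<in> carrier_mat n n"
  by (simp add: unitary_def)

lemma unitary_cancel [simp]:
  assumes "unitary n V" "X \<in> carrier_mat n n"
  shows "adj V * (V * X) = X" "V * (adj V * X) = X"
  using assms assoc_mult_mat[of "adj V" n n V n X n] assoc_mult_mat[of V n n "adj V" n X n]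
  by (auto simp: unitary_def)

lemma mtrace_carrier: "A \<in> carrier_mat n n \<Longrightarrow> mtrace A = (\<Sum>i<n. A $$ (i, i))"
  by (auto simp: mtrace_def)

lemma mtrace_mult_comm:
  assumes "A \<in> carrier_mat n m" "B \<in> carrier_mat m n"
  shows "mtrace (A * B) = mtrace (B * A)"
proof -
  have "mtrace (A * B) = (\<Sum>i<n. \<Sum>l<m. A $$ (i, l) * B $$ (l, i))"
    using assms by (subst mtrace_carrier[of _ n]) (auto simp: index_mult_mat_sum[OF assms])
  also have "\<dots> = (\<Sum>l<m. \<Sum>i<n. B $$ (l, i) * A $$ (i, l))"
    by (subst sum.swap) (simp add: mult.commute)
  also have "\<dots> = mtrace (B * A)"
    using assms by (subst mtrace_carrier[of _ m]) (auto simp: index_mult_mat_sum[OF assms(2,1)])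
  finally show ?thesis .
qed

lemma mtrace_add: "A \<in> carrier_mat n n \<Longrightarrow> B \<in> carrier_mat n n \<Longrightarrow> mtrace (A + B) = mtrace A + mtrace B"
  by (auto simp: mtrace_def sum.distrib)

lemma mtrace_smult: "A \<in> carrier_mat n n \<Longrightarrow> mtrace (c \<cdot>\<^sub>m A) = c * mtrace A"
  by (auto simp: mtrace_def sum_distrib_left)

lemma mtrace_unitary_conj:
  assumes "unitary n V" "A \<in> carrier_mat n n"
  shows "mtrace (adj V * A * V) = mtrace A" "mtrace (V * A * adj V) = mtrace A"
  using assms unitary_carrier[OF assms(1)] mtrace_mult_comm[of "adj V * A" n n V]
    mtrace_mult_comm[of "V * A" n n "adj V"] assoc_mult_mat[of V n n "adj V" n A n]
  by (auto simp: assoc_mult_mat[of _ n n _ n _ n])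

lemma conj_index:
  assumes "B \<in> carrier_mat m n" "A \<in> carrier_mat n n" "i < m" "j < m"
  shows "(B * A * adj B) $$ (i, j) = (\<Sum>k<n. \<Sum>l<n. B $$ (i, k) * A $$ (k, l) * cnj (B $$ (j, l)))"
proof -
  have "(B * A * adj B) $$ (i, j) = (\<Sum>l<n. \<Sum>k<n. B $$ (i, k) * A $$ (k, l) * cnj (B $$ (j, l)))"
    using assms by (subst index_mult_mat_sum[of _ m n _ m])
      (auto simp: index_mult_mat_sum[OF assms(1,2)] adj_index[OF assms(1)] sum_distrib_right)
  then show ?thesis by (subst sum.swap) simp
qed

section \<open>Calculus of positive semidefinite matrices\<close>

lemma psdI:
  assumes A: "A \<in> carrier_mat n n"
    and q: "\<And>v. v \<in> carrier_vec n \<Longrightarrow> \<exists>r\<ge>0. (\<Sum>i<n. \<Sum>j<n. cnj (v $ i) * A $$ (i, j) * v $ j) = of_real r"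
  shows "psd A"
proof -
  have d: "dim_row A = n" using A by simp
  have "Im (\<Sum>i<n. \<Sum>j<n. cnj (v $ i) * A $$ (i, j) * v $ j) = 0 \<and> Re (\<Sum>i<n. \<Sum>j<n. cnj (v $ i) * A $$ (i, j) * v $ j) \<ge> 0"
    if "v \<in> carrier_vec n" for v
    using q[OF that] by (metis Im_complex_of_real Re_complex_of_real)
  then show ?thesis using A unfolding psd_def Let_def d by blast
qed

text \<open>The test vector is a plain function on indices, so rows of matrices and combinations of
  unit vectors can be inserted without carrier conditions.\<close>

lemma psdD:
  assumes "psd A" and A: "A \<in> carrier_mat n n"
  shows "\<exists>r\<ge>0. (\<Sum>i<n. \<Sum>j<n. cnj (v i) * A $$ (i, j) * v j) = of_real r"
proof -
  have d: "dim_row A = n" using A by simp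
  define z where "z = (\<Sum>i<n. \<Sum>j<n. cnj (v i) * A $$ (i, j) * v j)"
  have "z = (\<Sum>i<n. \<Sum>j<n. cnj (vec n v $ i) * A $$ (i, j) * vec n v $ j)"
    unfolding z_def by (intro sum.cong) auto
  then have "Im z = 0 \<and> Re z \<ge> 0"
    using assms(1) vec_carrier[of n v] unfolding psd_def Let_def d by blast
  then have "Re z \<ge> 0 \<and> z = of_real (Re z)" by (simp add: complex_eq_iff)
  then show ?thesis unfolding z_def by blast
qed

text \<open>The i-th diagonal entry of \<open>B * A * adj B\<close> is the quadratic form of A at
  the conjugate of the i-th row of B.\<close>

lemma psd_conj_diag:
  assumes "psd A" "A \<in> carrier_mat n n" "B \<in> carrier_mat m n" "i < m"
  shows "\<exists>r\<ge>0. (B * A * adj B) $$ (i, i) = of_real r"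
  using psdD[OF assms(1,2), of "\<lambda>k. cnj (B $$ (i, k))"] conj_index[OF assms(3,2,4,4)] by simp

lemma psd_diag:
  assumes "psd A" "A \<in> carrier_mat n n" "i < n"
  shows "\<exists>r\<ge>0. A $$ (i, i) = of_real r"
  using psd_conj_diag[OF assms(1,2), of "1\<^sub>m n" n i] assms by simp

text \<open>\<open>psd\<close> only asks that the quadratic form be real and nonnegative. Over the
  complex numbers a real form forces symmetry, by testing on \<open>e i + a * e j\<close> for
  suitable a.\<close>

lemma psd_hermitian:
  assumes A: "psd A" "A \<in> carrier_mat n n"
  shows "adj A = A"
proof (rule eq_matI)
  fix i j assume "i < dim_row A" "j < dim_col A"
  then have ij: "i < n" "j < n" using A by auto
  have "cnj (A $$ (j, i)) = A $$ (i, j)"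
  proof (cases "i = j")
    case True
    then show ?thesis using psd_diag[OF A ij(1)] by auto
  next
    case False
    have *: "\<exists>r. A $$ (i, i) + cnj a * A $$ (j, i) + (A $$ (i, j) * a + cnj a * A $$ (j, j) * a) = of_real r" for a
    proof -
      have "(\<Sum>k<n. \<Sum>l<n. cnj ((if k = i then 1 else 0) + (if k = j then a else 0)) * A $$ (k, l) *
          ((if l = i then 1 else 0) + (if l = j then a else 0)))
        = (\<Sum>k<n. \<Sum>l<n. (if l = i then (if k = i then A $$ (k, l) else 0) else 0)
           + (if l = i then (if k = j then cnj a * A $$ (k, l) else 0) else 0)
           + ((if l = j then (if k = i then A $$ (k, l) * a else 0) else 0)
           + (if l = j then (if k = j then cnj a * A $$ (k, l) * a else 0) else 0)))"
        using False by (intro sum.cong refl) (auto simp: algebra_simps)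
      also have "\<dots> = A $$ (i, i) + cnj a * A $$ (j, i) + (A $$ (i, j) * a + cnj a * A $$ (j, j) * a)"
        using ij by (simp add: sum.distrib)
      finally show ?thesis
        using psdD[OF A, of "\<lambda>k. (if k = i then 1 else 0) + (if k = j then a else 0)"] by auto
    qed
    obtain ri rj where "A $$ (i, i) = of_real ri" "A $$ (j, j) = of_real rj"
      using psd_diag[OF A ij(1)] psd_diag[OF A ij(2)] by auto
    \<comment> \<open>The choice a = 1 shows that the imaginary parts of the two off-diagonal
      entries are opposite, and a = \<i> that their real parts agree.\<close>
    moreover obtain r1 r2 where
      "A $$ (i, i) + A $$ (j, i) + (A $$ (i, j) + A $$ (j, j)) = of_real r1"
      "A $$ (i, i) - \<i> * A $$ (j, i) + (A $$ (i, j) * \<i> + A $$ (j, j)) = of_real r2"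
      using *[of 1] *[of \<i>] by (auto simp: algebra_simps)
    ultimately show ?thesis by (auto simp: complex_eq_iff)
  qed
  then show "adj A $$ (i, j) = A $$ (i, j)" using A ij by (simp add: adj_index[of A n n])
qed (use A in \<open>auto simp: adj_def\<close>)

lemma psd_gram:
  assumes "B \<in> carrier_mat n m"
  shows "psd (B * adj B)"
proof (rule psdI[of _ n])
  show "B * adj B \<in> carrier_mat n n" using assms by (auto intro: mult_carrier_mat)
  fix v :: "complex vec"
  let ?w = "\<lambda>l. \<Sum>i<n. cnj (v $ i) * B $$ (i, l)"
  have "(\<Sum>i<n. \<Sum>j<n. cnj (v $ i) * (B * adj B) $$ (i, j) * v $ j)
     = (\<Sum>i<n. \<Sum>j<n. \<Sum>l<m. cnj (v $ i) * B $$ (i, l) * cnj (cnj (v $ j) * B $$ (j, l)))"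
    using assms by (intro sum.cong refl)
      (auto simp: index_mult_mat_sum[of B n m _ n] adj_index[of B n m] sum_distrib_left sum_distrib_right mult_ac)
  also have "\<dots> = (\<Sum>i<n. \<Sum>l<m. \<Sum>j<n. cnj (v $ i) * B $$ (i, l) * cnj (cnj (v $ j) * B $$ (j, l)))"
    by (intro sum.cong refl sum.swap)
  also have "\<dots> = (\<Sum>l<m. \<Sum>i<n. \<Sum>j<n. cnj (v $ i) * B $$ (i, l) * cnj (cnj (v $ j) * B $$ (j, l)))"
    by (rule sum.swap)
  also have "\<dots> = (\<Sum>l<m. ?w l * cnj (?w l))"
    by (simp add: cnj_sum sum_product)
  also have "\<dots> = of_real (\<Sum>l<m. (cmod (?w l))\<^sup>2)"
    by (simp only: of_real_sum complex_norm_square)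
  finally show "\<exists>r\<ge>0. (\<Sum>i<n. \<Sum>j<n. cnj (v $ i) * (B * adj B) $$ (i, j) * v $ j) = of_real r"
    by (intro exI[of _ "\<Sum>l<m. (cmod (?w l))\<^sup>2"]) (auto intro: sum_nonneg)
qed

text \<open>The eigenvalues are the diagonal entries of \<open>adj V * A * V\<close>, which are
  nonnegative.\<close>

lemma psd_spectral:
  assumes "psd A" "A \<in> carrier_mat n n"
  obtains V l where "unitary n V" "A = V * mdiag n (\<lambda>i. of_real (l i)) * adj V" "\<And>i. i < n \<Longrightarrow> l i \<ge> 0"
proof -
  obtain V and l :: "nat \<Rightarrow> real" where V: "unitary n V" and A: "A = V * mdiag n (\<lambda>i. of_real (l i)) * adj V"
    using hermitian_spectral[OF assms(2) psd_hermitian[OF assms]] by auto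
  have Vc: "V \<in> carrier_mat n n" using V by (rule unitary_carrier)
  have "l i \<ge> 0" if "i < n" for i
  proof -
    have "adj V * A * adj (adj V) = mdiag n (\<lambda>i. of_real (l i))"
      using V Vc by (simp add: A assoc_mult_mat[of _ n n _ n _ n]) (simp add: unitary_def)
    then show ?thesis
      using psd_conj_diag[OF assms, of "adj V" n i] Vc that by (auto simp: mdiag_def)
  qed
  with V A that show ?thesis by blast
qed

lemma unitary_mdiag_eq_gram:
  assumes "unitary n V" "\<And>i. i < n \<Longrightarrow> l i \<ge> (0::real)"
  shows "V * mdiag n (\<lambda>i. of_real (l i)) * adj V =
    (V * mdiag n (\<lambda>i. of_real (sqrt (l i)))) * adj (V * mdiag n (\<lambda>i. of_real (sqrt (l i))))"
proof -
  have Vc: "V \<in> carrier_mat n n" using assms by (simp add: unitary_carrier)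
  have "mdiag n (\<lambda>i. of_real (l i)) = mdiag n (\<lambda>i. of_real (sqrt (l i))) * mdiag n (\<lambda>i. of_real (sqrt (l i)))"
    using assms(2) unfolding mdiag_mult by (intro eq_matI) (auto simp: mdiag_def simp flip: of_real_mult)
  then show ?thesis using Vc
    by (simp add: adj_mult[of _ n n _ n] adj_mdiag assoc_mult_mat[of _ n n _ n _ n])
qed

text \<open>B is V times the roots of the eigenvalues. Such a Gram factor is more convenient than
  the positive root: it passes directly through congruences and Kronecker products.\<close>

lemma psd_factor:
  assumes "psd A" "A \<in> carrier_mat n n"
  obtains B where "B \<in> carrier_mat n n" "A = B * adj B"
proof -
  obtain V l where V: "unitary n V" "A = V * mdiag n (\<lambda>i. of_real (l i)) * adj V" "\<And>i. i < n \<Longrightarrow> l i \<ge> 0"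
    using psd_spectral[OF assms] by blast
  then show ?thesis
    using that[of "V * mdiag n (\<lambda>i. of_real (sqrt (l i)))"] unitary_mdiag_eq_gram[OF V(1,3)] by (simp add: unitary_carrier)
qed

text \<open>With A = C adj C the congruence is the Gram matrix of \<open>B * C\<close>. B may be
  rectangular, as Kraus operators are.\<close>

lemma psd_conj:
  assumes "psd A" "A \<in> carrier_mat n n" "B \<in> carrier_mat m n"
  shows "psd (B * A * adj B)"
proof -
  obtain C where C: "C \<in> carrier_mat n n" "A = C * adj C" using psd_factor[OF assms(1,2)] .
  have c: "B * C \<in> carrier_mat m n" "adj C * adj B \<in> carrier_mat n m" using C assms(3) by auto
  have "B * A * adj B = B * (C * (adj C * adj B))"
    using C assms(3) c by (simp add: assoc_mult_mat[of B m n _ n _ m] assoc_mult_mat[of C n n _ n _ m])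
  also have "\<dots> = (B * C) * adj (B * C)"
    using C assms(3) c by (simp add: adj_mult[of B m n C n] assoc_mult_mat[of B m n C n _ m])
  finally have "B * A * adj B = (B * C) * adj (B * C)" .
  then show ?thesis using psd_gram[of "B * C" m n] C assms(3) by auto
qed

lemma psd_add:
  assumes "psd A" "A \<in> carrier_mat n n" "psd B" "B \<in> carrier_mat n n"
  shows "psd (A + B)"
proof (rule psdI[of _ n])
  fix v :: "complex vec"
  obtain r s where rs: "r \<ge> 0" "s \<ge> 0"
    "(\<Sum>i<n. \<Sum>j<n. cnj (v $ i) * A $$ (i, j) * v $ j) = of_real r"
    "(\<Sum>i<n. \<Sum>j<n. cnj (v $ i) * B $$ (i, j) * v $ j) = of_real s"
    using psdD[OF assms(1,2), of "($) v"] psdD[OF assms(3,4), of "($) v"] by auto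
  have "(\<Sum>i<n. \<Sum>j<n. cnj (v $ i) * (A + B) $$ (i, j) * v $ j) =
    (\<Sum>i<n. \<Sum>j<n. cnj (v $ i) * A $$ (i, j) * v $ j + cnj (v $ i) * B $$ (i, j) * v $ j)"
    using assms by (intro sum.cong refl) (auto simp: algebra_simps)
  then show "\<exists>r\<ge>0. (\<Sum>i<n. \<Sum>j<n. cnj (v $ i) * (A + B) $$ (i, j) * v $ j) = of_real r"
    using rs by (intro exI[of _ "r + s"]) (simp add: sum.distrib)
qed (use assms in auto)

lemma psd_smult:
  assumes "psd A" "A \<in> carrier_mat n n" "r \<ge> 0"
  shows "psd (of_real r \<cdot>\<^sub>m A)"
proof (rule psdI[of _ n])
  fix v :: "complex vec"
  obtain s where s: "s \<ge> 0" "(\<Sum>i<n. \<Sum>j<n. cnj (v $ i) * A $$ (i, j) * v $ j) = of_real s"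
    using psdD[OF assms(1,2), of "($) v"] by auto
  have "(\<Sum>i<n. \<Sum>j<n. cnj (v $ i) * (of_real r \<cdot>\<^sub>m A) $$ (i, j) * v $ j) =
    of_real r * (\<Sum>i<n. \<Sum>j<n. cnj (v $ i) * A $$ (i, j) * v $ j)"
    using assms unfolding sum_distrib_left by (intro sum.cong refl) auto
  then show "\<exists>r'\<ge>0. (\<Sum>i<n. \<Sum>j<n. cnj (v $ i) * (of_real r \<cdot>\<^sub>m A) $$ (i, j) * v $ j) = of_real r'"
    using s assms(3) by (intro exI[of _ "r * s"]) simp
qed (use assms in auto)

lemma psd_zero: "psd (0\<^sub>m n n)"
  by (rule psdI[of _ n]) (auto intro!: exI[of _ 0])

text \<open>Compare the two eigenbases through M = adj V W. Equality of the squares says that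
  \<open>(a i)^2\<close> and \<open>(b j)^2\<close> agree wherever M has a nonzero entry;
  nonnegativity removes the squares, and this is Q = P read in the two bases. The uniqueness is what
  gives the definite description in \<open>msqrt\<close> a value.\<close>

lemma psd_sqrt_unique:
  assumes P: "psd P" "P \<in> carrier_mat n n" and Q: "psd Q" "Q \<in> carrier_mat n n" and eq: "Q * Q = P * P"
  shows "Q = P"
proof -
  obtain V a where V: "unitary n V" "Q = V * mdiag n (\<lambda>i. of_real (a i)) * adj V" "\<And>i. i < n \<Longrightarrow> a i \<ge> 0"
    using psd_spectral[OF Q] by blast
  obtain W b where W: "unitary n W" "P = W * mdiag n (\<lambda>i. of_real (b i)) * adj W" "\<And>i. i < n \<Longrightarrow> b i \<ge> 0"
    using psd_spectral[OF P] by blast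
  have Vc: "V \<in> carrier_mat n n" and Wc: "W \<in> carrier_mat n n" using V W by (auto simp: unitary_carrier)
  note as = assoc_mult_mat[of _ n n _ n _ n]
  define M where "M = adj V * W"
  have M: "M \<in> carrier_mat n n" using Vc Wc by (simp add: M_def)
  let ?a = "mdiag n (\<lambda>i. of_real (a i))" and ?b = "mdiag n (\<lambda>i. of_real (b i))"
  have 1: "adj V * Q * W = ?a * M" "adj V * P * W = M * ?b"
    "adj V * (Q * Q) * W = ?a * ?a * M" "adj V * (P * P) * W = M * (?b * ?b)"
    using Vc Wc V(1) W(1) by (simp_all add: V(2) W(2) M_def as) (simp_all add: unitary_def)
  have "?a * M = M * ?b"
  proof (rule eq_matI)
    fix i j assume "i < dim_row (M * ?b)" "j < dim_col (M * ?b)"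
    then have ij: "i < n" "j < n" using M by auto
    have "(?a * ?a * M) $$ (i, j) = (M * (?b * ?b)) $$ (i, j)" using 1 eq by simp
    then have "of_real ((a i)\<^sup>2 - (b j)\<^sup>2) * M $$ (i, j) = 0"
      using ij by (simp add: mdiag_mult mult_mdiag_index[OF M] mdiag_mult_index[OF M] power2_eq_square algebra_simps)
    then have "(a i)\<^sup>2 = (b j)\<^sup>2 \<or> M $$ (i, j) = 0" by (auto simp flip: of_real_power)
    \<comment> \<open>The only use of positivity: nonnegative numbers with equal squares are
      equal.\<close>
    then have "a i = b j \<or> M $$ (i, j) = 0" using V(3) W(3) ij by (auto simp: power2_eq_iff_nonneg)
    then show "(?a * M) $$ (i, j) = (M * ?b) $$ (i, j)"
      using ij by (auto simp: mult_mdiag_index[OF M] mdiag_mult_index[OF M])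
  qed (use M in auto)
  then have "V * (adj V * Q * W) * adj W = V * (adj V * P * W) * adj W" using 1 by simp
  then show "Q = P" using Vc Wc V(1) W(1) P Q by (simp add: as) (simp add: unitary_def)
qed

text \<open>In the eigenbasis of R the trace becomes the sum of \<open>|f i|^2\<close> times the
  diagonal of adj V S V, which is nonnegative. It is the bound tr (R S adj R) \<le> r^2 tr S for a
  normal R of operator norm at most r, stated without operator norms.\<close>

lemma mtrace_conj_mdiag_le:
  assumes V: "unitary n V" and S: "psd S" "S \<in> carrier_mat n n" and f: "\<And>i. i < n \<Longrightarrow> cmod (f i) \<le> r"
  defines "R \<equiv> V * mdiag n f * adj V"
  shows "Re (mtrace (R * S * adj R)) \<le> r\<^sup>2 * Re (mtrace S)"
proof -
  have Vc: "V \<in> carrier_mat n n" using V by (rule unitary_carrier)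
  note as = assoc_mult_mat[of _ n n _ n _ n] and am = adj_mult[of _ n n _ n]
  define T where "T = adj V * S * V"
  have T: "T \<in> carrier_mat n n" using Vc S by (simp add: T_def)
  have "R * S * adj R = V * (mdiag n f * T * mdiag n (\<lambda>i. cnj (f i))) * adj V"
    using Vc S by (simp add: R_def T_def as am adj_mdiag)
  then have "mtrace (R * S * adj R) = mtrace (mdiag n f * T * mdiag n (\<lambda>i. cnj (f i)))"
    using V T by (simp add: mtrace_unitary_conj)
  also have "\<dots> = (\<Sum>i<n. f i * T $$ (i, i) * cnj (f i))"
    using T by (subst mtrace_carrier[of _ n]) (auto simp: mult_mdiag_index[of _ n n] mdiag_mult_index[of _ n n])
  finally have "Re (mtrace (R * S * adj R)) = (\<Sum>i<n. Re (f i * T $$ (i, i) * cnj (f i)))" by simp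
  also have "\<dots> \<le> (\<Sum>i<n. r\<^sup>2 * Re (T $$ (i, i)))"
  proof (rule sum_mono)
    fix i assume "i \<in> {..<n}"
    then have i: "i < n" by simp
    obtain s where s: "s \<ge> 0" "T $$ (i, i) = of_real s"
      using psd_conj_diag[OF S, of "adj V" n i] Vc i by (auto simp: T_def)
    have "f i * T $$ (i, i) * cnj (f i) = of_real ((cmod (f i))\<^sup>2 * s)"
      unfolding s of_real_mult complex_norm_square by (simp add: mult_ac)
    moreover have "(cmod (f i))\<^sup>2 \<le> r\<^sup>2" using f[OF i] by (intro power_mono) auto
    ultimately show "Re (f i * T $$ (i, i) * cnj (f i)) \<le> r\<^sup>2 * Re (T $$ (i, i))"
      using s by (metis Re_complex_of_real mult_right_mono)
  qed
  also have "\<dots> = r\<^sup>2 * Re (mtrace T)" using T by (simp add: mtrace_carrier sum_distrib_left)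
  also have "mtrace T = mtrace S" using V S by (simp add: T_def mtrace_unitary_conj)
  finally show ?thesis .
qed

text \<open>A substitute for the trace norm of a Hermitian matrix: an upper bound is witnessed by any
  decomposition into a difference of positive parts, which makes contractivity under positive
  trace-preserving maps immediate.\<close>

definition trace_bound :: "nat \<Rightarrow> complex mat \<Rightarrow> real \<Rightarrow> bool" where
  "trace_bound n D r \<longleftrightarrow> (\<exists>P Q. P \<in> carrier_mat n n \<and> Q \<in> carrier_mat n n \<and> psd P \<and> psd Q \<and>
     D = P - Q \<and> Re (mtrace P) + Re (mtrace Q) \<le> r)"

lemma trace_boundI:
  "P \<in> carrier_mat n n \<Longrightarrow> Q \<in> carrier_mat n n \<Longrightarrow> psd P \<Longrightarrow> psd Q \<Longrightarrow> D = P - Q \<Longrightarrow>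
   Re (mtrace P) + Re (mtrace Q) \<le> r \<Longrightarrow> trace_bound n D r"
  by (auto simp: trace_bound_def)

lemma trace_bound_mono: "trace_bound n D r \<Longrightarrow> r \<le> s \<Longrightarrow> trace_bound n D s"
  by (force simp: trace_bound_def)

lemma trace_bound_carrier: "trace_bound n D r \<Longrightarrow> D \<in> carrier_mat n n"
  by (auto simp: trace_bound_def)

lemma trace_bound_psd:
  assumes "psd P" "P \<in> carrier_mat n n"
  shows "trace_bound n P (Re (mtrace P))"
  by (rule trace_boundI[of P n "0\<^sub>m n n"]) (use assms in \<open>auto simp: psd_zero mtrace_def\<close>)

lemma trace_bound_add:
  assumes "trace_bound n D r" "trace_bound n E s"
  shows "trace_bound n (D + E) (r + s)"
proof -
  obtain P Q where 1: "P \<in> carrier_mat n n" "Q \<in> carrier_mat n n" "psd P" "psd Q"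
     "D = P - Q" "Re (mtrace P) + Re (mtrace Q) \<le> r" using assms by (auto simp: trace_bound_def)
  obtain P' Q' where 2: "P' \<in> carrier_mat n n" "Q' \<in> carrier_mat n n" "psd P'" "psd Q'"
     "E = P' - Q'" "Re (mtrace P') + Re (mtrace Q') \<le> s" using assms by (auto simp: trace_bound_def)
  show ?thesis
    by (rule trace_boundI[of "P + P'" n "Q + Q'"])
      (use 1 2 in \<open>auto simp: mtrace_add[of _ n] intro: psd_add intro!: eq_matI\<close>)
qed

lemma trace_bound_smult_nonneg:
  assumes "trace_bound n D r" "a \<ge> 0"
  shows "trace_bound n (of_real a \<cdot>\<^sub>m D) (a * r)"
proof -
  obtain P Q where 1: "P \<in> carrier_mat n n" "Q \<in> carrier_mat n n" "psd P" "psd Q"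
     "D = P - Q" "Re (mtrace P) + Re (mtrace Q) \<le> r" using assms by (auto simp: trace_bound_def)
  have "a * Re (mtrace P) + a * Re (mtrace Q) \<le> a * r"
    using 1(6) assms(2) by (metis distrib_left mult_left_mono)
  then show ?thesis
    by (intro trace_boundI[of "of_real a \<cdot>\<^sub>m P" n "of_real a \<cdot>\<^sub>m Q"])
      (use 1 assms(2) in \<open>auto simp: mtrace_smult[of _ n] algebra_simps intro: psd_smult intro!: eq_matI\<close>)
qed

lemma trace_bound_uminus:
  assumes "trace_bound n D r"
  shows "trace_bound n (- D) r"
proof -
  obtain P Q where 1: "P \<in> carrier_mat n n" "Q \<in> carrier_mat n n" "psd P" "psd Q"
     "D = P - Q" "Re (mtrace P) + Re (mtrace Q) \<le> r" using assms by (auto simp: trace_bound_def)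
  show ?thesis
    by (rule trace_boundI[of Q n P]) (use 1 in \<open>auto intro!: eq_matI\<close>)
qed

lemma trace_bound_smult:
  assumes "trace_bound n D r"
  shows "trace_bound n (of_real a \<cdot>\<^sub>m D) (\<bar>a\<bar> * r)"
proof (cases "a \<ge> 0")
  case False
  have "of_real a \<cdot>\<^sub>m D = - (of_real (- a) \<cdot>\<^sub>m D)" by (intro eq_matI) auto
  then show ?thesis
    using trace_bound_uminus[OF trace_bound_smult_nonneg[OF assms, of "-a"]] False by simp
qed (use trace_bound_smult_nonneg[OF assms, of a] in auto)

lemma trace_bound_unitary:
  assumes "trace_bound n D r" "unitary n U"
  shows "trace_bound n (U * D * adj U) r"
proof -
  have Uc: "U \<in> carrier_mat n n" using assms by (simp add: unitary_carrier)
  obtain P Q where 1: "P \<in> carrier_mat n n" "Q \<in> carrier_mat n n" "psd P" "psd Q"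
     "D = P - Q" "Re (mtrace P) + Re (mtrace Q) \<le> r" using assms by (auto simp: trace_bound_def)
  show ?thesis
    by (rule trace_boundI[of "U * P * adj U" n "U * Q * adj U"])
      (use 1 Uc assms(2) in \<open>auto simp: mtrace_unitary_conj mult_minus_distrib_mat[of U n n _ n] minus_mult_distrib_mat[of _ n n _ _ n] intro: psd_conj\<close>)
qed

section \<open>Sesquilinear expansions, polarization and passage to the trace norm\<close>

lemma sandwich_index:
  assumes "X \<in> carrier_mat n n" "S \<in> carrier_mat n n" "Y \<in> carrier_mat n n" "i < n" "j < n"
  shows "(X * S * adj Y) $$ (i, j) = (\<Sum>k<n. \<Sum>l<n. X $$ (i, k) * S $$ (k, l) * cnj (Y $$ (j, l)))"
proof -
  have "(X * S * adj Y) $$ (i, j) = (\<Sum>l<n. \<Sum>k<n. X $$ (i, k) * S $$ (k, l) * cnj (Y $$ (j, l)))"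
    using assms by (subst index_mult_mat_sum[of _ n n _ n])
      (auto simp: index_mult_mat_sum[OF assms(1,2)] adj_index[OF assms(3)] sum_distrib_right)
  then show ?thesis by (subst sum.swap) simp
qed

text \<open>Stated for single entries, so that identities between long sums of products
  \<open>X * S * adj Y\<close> reduce to ring identities between complex numbers.\<close>

lemma sandwich_linear:
  assumes "X \<in> carrier_mat n n" "S \<in> carrier_mat n n" "Y \<in> carrier_mat n n" "Z \<in> carrier_mat n n" "i < n" "j < n"
  shows "((X + Y) * S * adj Z) $$ (i, j) = (X * S * adj Z) $$ (i, j) + (Y * S * adj Z) $$ (i, j)"
    "((X - Y) * S * adj Z) $$ (i, j) = (X * S * adj Z) $$ (i, j) - (Y * S * adj Z) $$ (i, j)"
    "((c \<cdot>\<^sub>m X) * S * adj Z) $$ (i, j) = c * (X * S * adj Z) $$ (i, j)"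
    "(Z * S * adj (X + Y)) $$ (i, j) = (Z * S * adj X) $$ (i, j) + (Z * S * adj Y) $$ (i, j)"
    "(Z * S * adj (X - Y)) $$ (i, j) = (Z * S * adj X) $$ (i, j) - (Z * S * adj Y) $$ (i, j)"
    "(Z * S * adj (c \<cdot>\<^sub>m X)) $$ (i, j) = cnj c * (Z * S * adj X) $$ (i, j)"
proof -
  note c = add_carrier_mat[of _ n n] minus_carrier_mat[of _ n n] smult_carrier_mat[of _ n n]
  note s = sandwich_index[OF assms(1,2,4-6)] sandwich_index[OF assms(3,2,4-6)]
    sandwich_index[OF assms(4,2,1,5,6)] sandwich_index[OF assms(4,2,3,5,6)]
  show "((X + Y) * S * adj Z) $$ (i, j) = (X * S * adj Z) $$ (i, j) + (Y * S * adj Z) $$ (i, j)"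
    unfolding s sandwich_index[OF c(1)[OF assms(3)] assms(2,4-6)] sum.distrib[symmetric]
    using assms by (intro sum.cong refl) (simp add: algebra_simps)
  show "((X - Y) * S * adj Z) $$ (i, j) = (X * S * adj Z) $$ (i, j) - (Y * S * adj Z) $$ (i, j)"
    unfolding s sandwich_index[OF c(2)[OF assms(3)] assms(2,4-6)] sum_subtractf[symmetric]
    using assms by (intro sum.cong refl) (simp add: algebra_simps)
  show "((c \<cdot>\<^sub>m X) * S * adj Z) $$ (i, j) = c * (X * S * adj Z) $$ (i, j)"
    unfolding s sandwich_index[OF c(3)[OF assms(1)] assms(2,4-6)] sum_distrib_left
    using assms by (intro sum.cong refl) (simp add: algebra_simps)
  show "(Z * S * adj (X + Y)) $$ (i, j) = (Z * S * adj X) $$ (i, j) + (Z * S * adj Y) $$ (i, j)"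
    unfolding s sandwich_index[OF assms(4,2) c(1)[OF assms(3)] assms(5,6)] sum.distrib[symmetric]
    using assms by (intro sum.cong refl) (simp add: algebra_simps)
  show "(Z * S * adj (X - Y)) $$ (i, j) = (Z * S * adj X) $$ (i, j) - (Z * S * adj Y) $$ (i, j)"
    unfolding s sandwich_index[OF assms(4,2) c(2)[OF assms(3)] assms(5,6)] sum_subtractf[symmetric]
    using assms by (intro sum.cong refl) (simp add: algebra_simps)
  show "(Z * S * adj (c \<cdot>\<^sub>m X)) $$ (i, j) = cnj c * (Z * S * adj X) $$ (i, j)"
    unfolding s sandwich_index[OF assms(4,2) c(3)[OF assms(1)] assms(5,6)] sum_distrib_left
    using assms by (intro sum.cong refl) (simp add: algebra_simps)
qed

text \<open>Polarization: \<open>X S Y\<^sup>* + Y S X\<^sup>*\<close> is half the difference of the positive matrices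
  \<open>(X \<plusminus> Y) S (X \<plusminus> Y)\<^sup>*\<close>.\<close>

lemma trace_bound_cross:
  assumes S: "psd S" "S \<in> carrier_mat n n" and X: "X \<in> carrier_mat n n" and Y: "Y \<in> carrier_mat n n"
  shows "trace_bound n (X * S * adj Y + Y * S * adj X) (Re (mtrace (X * S * adj X)) + Re (mtrace (Y * S * adj Y)))"
proof -
  let ?P = "of_real (1/2) \<cdot>\<^sub>m ((X + Y) * S * adj (X + Y))"
  let ?Q = "of_real (1/2) \<cdot>\<^sub>m ((X - Y) * S * adj (X - Y))"
  have c: "X + Y \<in> carrier_mat n n" "X - Y \<in> carrier_mat n n" using X Y by auto
  have 1: "(X + Y) * S * adj (X + Y) \<in> carrier_mat n n" "(X - Y) * S * adj (X - Y) \<in> carrier_mat n n"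
    using c S by auto
  \<comment> \<open>Parallelogram law: the cross terms of the two squares cancel in the sum.\<close>
  have tr: "mtrace ?P + mtrace ?Q = mtrace (X * S * adj X) + mtrace (Y * S * adj Y)"
  proof -
    have 2: "X * S * adj X \<in> carrier_mat n n" "Y * S * adj Y \<in> carrier_mat n n" using X Y S by auto
    show ?thesis
      unfolding mtrace_carrier[OF smult_carrier_mat[OF 1(1)]] mtrace_carrier[OF smult_carrier_mat[OF 1(2)]]
        mtrace_carrier[OF 2(1)] mtrace_carrier[OF 2(2)] sum.distrib[symmetric]
      using X Y S 1 c by (intro sum.cong refl) (simp add: sandwich_linear[of _ n] field_simps)
  qed
  show ?thesis
  proof (rule trace_boundI[of ?P n ?Q])
    show "psd ?P" "psd ?Q" using psd_smult[OF _ 1(1), of "1/2"] psd_smult[OF _ 1(2), of "1/2"] psd_conj[OF S c(1)] psd_conj[OF S c(2)]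
      by auto
    show "X * S * adj Y + Y * S * adj X = ?P - ?Q"
      by (rule eq_matI) (use X Y S 1 c in \<open>auto simp: sandwich_linear[of _ n] field_simps\<close>)
    show "Re (mtrace ?P) + Re (mtrace ?Q) \<le> Re (mtrace (X * S * adj X)) + Re (mtrace (Y * S * adj Y))"
      using arg_cong[OF tr, of Re] by simp
  qed (use 1 in auto)
qed

text \<open>D is Hermitian, and its modulus, obtained by taking absolute values of the eigenvalues
  l, is the unique positive root of D adj D; so the trace norm is the sum of the
  \<open>|l i|\<close>. In the eigenbasis of D each \<open>l i\<close> is the difference of the
  diagonal entries of P and Q, both nonnegative, hence \<open>|l i|\<close> is at most their sum.
  Summing gives tr P + tr Q.\<close>

lemma trace_norm_le:
  assumes "trace_bound n D r"
  shows "trace_norm D \<le> r"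
proof -
  obtain P Q where PQ: "P \<in> carrier_mat n n" "Q \<in> carrier_mat n n" "psd P" "psd Q"
     "D = P - Q" "Re (mtrace P) + Re (mtrace Q) \<le> r" using assms by (auto simp: trace_bound_def)
  have Dc: "D \<in> carrier_mat n n" using assms by (rule trace_bound_carrier)
  have "adj D $$ (i, j) = D $$ (i, j)" if "i < n" "j < n" for i j
    using psd_hermitian[OF PQ(3,1)] psd_hermitian[OF PQ(4,2)] that PQ(1,2,5) adj_index[OF PQ(1) that] adj_index[OF PQ(2) that]
      adj_index[OF Dc that] by auto
  then have h: "adj D = D" using Dc by (intro eq_matI) (auto simp: adj_def)
  obtain V and l :: "nat \<Rightarrow> real" where V: "unitary n V" and D: "D = V * mdiag n (\<lambda>i. of_real (l i)) * adj V"
    using hermitian_spectral[OF Dc h] by auto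
  have Vc: "V \<in> carrier_mat n n" using V by (rule unitary_carrier)
  note as = assoc_mult_mat[of _ n n _ n _ n]
  define S where "S = V * mdiag n (\<lambda>i. of_real \<bar>l i\<bar>) * adj V"
  have Sc: "S \<in> carrier_mat n n" using Vc by (simp add: S_def)
  have Sp: "psd S" unfolding S_def unitary_mdiag_eq_gram[OF V, of "\<lambda>i. \<bar>l i\<bar>", simplified]
    using Vc by (intro psd_gram) auto
  have m: "mdiag n f * (mdiag n g * X) = mdiag n (\<lambda>i. f i * g i) * X" if "X \<in> carrier_mat n n" for f g X
    using that by (simp add: mdiag_mult flip: as)
  have SS: "S * S = D * adj D"
    unfolding h using V Vc by (simp add: S_def D as m flip: of_real_mult)
  have "msqrt (D * adj D) = S"
    unfolding msqrt_def
  proof (rule the_equality)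
    show "psd S \<and> S * S = D * adj D" using Sp SS by simp
    fix R assume R: "psd R \<and> R * R = D * adj D"
    \<comment> \<open>\<open>psd\<close> leaves the size of a competing root open; it is read off
      from the product \<open>R * R\<close>.\<close>
    then have "dim_row R = n" using Dc by (metis SS Sc carrier_matD(1) index_mult_mat(2))
    then have "R \<in> carrier_mat n n" using R by (auto simp: psd_def)
    then show "R = S" using psd_sqrt_unique[OF Sp Sc, of R] R SS by simp
  qed
  then have "trace_norm D = Re (mtrace S)" by (simp add: trace_norm_def)
  also have "\<dots> = (\<Sum>i<n. \<bar>l i\<bar>)"
    using V by (simp add: S_def mtrace_unitary_conj) (simp add: mtrace_def mdiag_def)
  also have "\<dots> \<le> (\<Sum>i<n. Re ((adj V * P * V) $$ (i, i)) + Re ((adj V * Q * V) $$ (i, i)))"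
  proof (rule sum_mono)
    fix i assume "i \<in> {..<n}"
    then have i: "i < n" by simp
    obtain p q where pq: "p \<ge> 0" "(adj V * P * V) $$ (i, i) = of_real p" "q \<ge> 0" "(adj V * Q * V) $$ (i, i) = of_real q"
      using psd_conj_diag[OF PQ(3,1), of "adj V" n i] psd_conj_diag[OF PQ(4,2), of "adj V" n i] Vc i by auto
    have "adj V * D * V = mdiag n (\<lambda>i. of_real (l i))"
      using V Vc by (simp add: D as) (simp add: unitary_def)
    moreover have "adj V * D * V = adj V * P * V - adj V * Q * V"
      using PQ Vc by (simp add: mult_minus_distrib_mat[of _ n n _ n] minus_mult_distrib_mat[of _ n n _ _ n])
    ultimately have "mdiag n (\<lambda>i. of_real (l i)) = adj V * P * V - adj V * Q * V" by simp
    from arg_cong[OF this, of "\<lambda>A. A $$ (i, i)"] have "complex_of_real (l i) = of_real (p - q)"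
      using i pq Vc PQ(1,2) by (simp add: mdiag_def index_minus_mat)
    then have "l i = p - q" by (simp only: of_real_eq_iff)
    then show "\<bar>l i\<bar> \<le> Re ((adj V * P * V) $$ (i, i)) + Re ((adj V * Q * V) $$ (i, i))"
      using pq by simp
  qed
  also have "\<dots> = Re (mtrace (adj V * P * V)) + Re (mtrace (adj V * Q * V))"
    using PQ Vc by (simp add: mtrace_carrier[of _ n] sum.distrib)
  also have "\<dots> \<le> r" using V PQ by (simp add: mtrace_unitary_conj)
  finally show ?thesis .
qed

section \<open>Kronecker products, exponentials and channels\<close>

text \<open>A composite index of a tensor product is \<open>a * q + b\<close>; this splits a sum
  over it into sums over the two factors.\<close>

lemma sum_div_mod:
  fixes f :: "nat \<Rightarrow> nat \<Rightarrow> 'a::comm_monoid_add"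
  assumes "q > 0"
  shows "(\<Sum>l<m * q. f (l div q) (l mod q)) = (\<Sum>a<m. \<Sum>b<q. f a b)"
proof -
  have "(\<Sum>l<m * q. f (l div q) (l mod q)) = (\<Sum>(a, b)\<in>{..<m} \<times> {..<q}. f a b)"
  proof (rule sum.reindex_bij_witness[of _ "\<lambda>(a, b). a * q + b" "\<lambda>l. (l div q, l mod q)"])
    fix ab assume "ab \<in> {..<m} \<times> {..<q}"
    then obtain a b where ab: "ab = (a, b)" "a < m" "b < q" by auto
    have "a * q + b < Suc a * q" using ab by simp
    also have "\<dots> \<le> m * q" using ab by (intro mult_right_mono) auto
    finally show "(case ab of (a, b) \<Rightarrow> a * q + b) \<in> {..<m * q}" using ab by simp
  qed (use assms in \<open>auto simp: less_mult_imp_div_less\<close>)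
  then show ?thesis by (simp add: sum.cartesian_product)
qed

lemma div_mod_less:
  assumes "i < n * (p::nat)"
  shows "i div p < n" "i mod p < p"
  using assms by (auto simp: less_mult_imp_div_less intro!: mod_less_divisor) (metis gr0I mult_0_right not_less0)

lemma div_mod_combine [simp]:
  "b < q \<Longrightarrow> (a * q + b) div q = (a::nat)" "b < q \<Longrightarrow> (a * q + b) mod q = b"
  by auto

lemma div_mod_combine_less: "a < m \<Longrightarrow> b < q \<Longrightarrow> a * q + b < m * (q::nat)"
  by (metis (no_types, lifting) add.commute add_less_cancel_left less_le_trans mult_Suc mult_le_mono1 Suc_leI)

lemma kron_carrier [simp]:
  "A \<in> carrier_mat n m \<Longrightarrow> B \<in> carrier_mat p q \<Longrightarrow> kron A B \<in> carrier_mat (n * p) (m * q)"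
  by (auto simp: kron_def)

lemma dim_kron [simp]:
  "dim_row (kron A B) = dim_row A * dim_row B" "dim_col (kron A B) = dim_col A * dim_col B"
  by (auto simp: kron_def)

lemma kron_index:
  assumes "A \<in> carrier_mat n m" "B \<in> carrier_mat p q" "i < n * p" "j < m * q"
  shows "kron A B $$ (i, j) = A $$ (i div p, j div q) * B $$ (i mod p, j mod q)"
  using assms by (auto simp: kron_def)

lemma kron_mult:
  assumes "A \<in> carrier_mat n m" "B \<in> carrier_mat p q" "C \<in> carrier_mat m k" "D \<in> carrier_mat q l"
  shows "kron A B * kron C D = kron (A * C) (B * D)"
proof (rule eq_matI)
  fix i j assume "i < dim_row (kron (A * C) (B * D))" "j < dim_col (kron (A * C) (B * D))"
  then have ij: "i < n * p" "j < k * l" using assms by auto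
  note d = div_mod_less[OF ij(1)] div_mod_less[OF ij(2)]
  have "(kron A B * kron C D) $$ (i, j) = (\<Sum>r<m * q. kron A B $$ (i, r) * kron C D $$ (r, j))"
    by (rule index_mult_mat_sum[OF kron_carrier[OF assms(1,2)] kron_carrier[OF assms(3,4)] ij])
  also have "\<dots> = (\<Sum>r<m * q. (A $$ (i div p, r div q) * B $$ (i mod p, r mod q)) *
      (C $$ (r div q, j div l) * D $$ (r mod q, j mod l)))"
    using ij by (intro sum.cong refl) (simp add: kron_index[OF assms(1,2)] kron_index[OF assms(3,4)])
  also have "\<dots> = (\<Sum>a<m. \<Sum>b<q. (A $$ (i div p, a) * B $$ (i mod p, b)) * (C $$ (a, j div l) * D $$ (b, j mod l)))"
  proof (cases "q = 0")
    case False
    then show ?thesis by (intro sum_div_mod[of q "\<lambda>a b. (A $$ (i div p, a) * B $$ (i mod p, b)) * (C $$ (a, j div l) * D $$ (b, j mod l))"]) simp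
  qed simp
  also have "\<dots> = (\<Sum>a<m. A $$ (i div p, a) * C $$ (a, j div l)) * (\<Sum>b<q. B $$ (i mod p, b) * D $$ (b, j mod l))"
    unfolding sum_product by (intro sum.cong refl) (simp add: mult_ac)
  also have "\<dots> = kron (A * C) (B * D) $$ (i, j)"
    using assms ij d by (simp add: kron_index[of _ n k _ p l] index_mult_mat_sum[of A n m C k] index_mult_mat_sum[of B p q D l])
  finally show "(kron A B * kron C D) $$ (i, j) = kron (A * C) (B * D) $$ (i, j)" .
qed (use assms in auto)

lemma adj_kron: "adj (kron A B) = kron (adj A) (adj B)"
proof (rule eq_matI)
  fix i j assume "i < dim_row (kron (adj A) (adj B))" "j < dim_col (kron (adj A) (adj B))"
  then have ij: "i < dim_col A * dim_col B" "j < dim_row A * dim_row B" by auto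
  show "adj (kron A B) $$ (i, j) = kron (adj A) (adj B) $$ (i, j)"
    using ij div_mod_less[OF ij(1)] div_mod_less[OF ij(2)] by (simp add: adj_def kron_def)
qed auto

lemma kron_one: "kron (1\<^sub>m n) (1\<^sub>m m) = 1\<^sub>m (n * m)"
proof (rule eq_matI)
  fix i j assume "i < dim_row (1\<^sub>m (n * m) :: complex mat)" "j < dim_col (1\<^sub>m (n * m) :: complex mat)"
  then have ij: "i < n * m" "j < n * m" by auto
  have "i = j" if "i div m = j div m" "i mod m = j mod m" using that by (metis div_mult_mod_eq)
  then show "kron (1\<^sub>m n) (1\<^sub>m m) $$ (i, j) = 1\<^sub>m (n * m) $$ (i, j)"
    using ij div_mod_less[OF ij(1)] div_mod_less[OF ij(2)] by (auto simp: kron_def)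
qed auto

text \<open>Associativity is a true equality, not merely an isomorphism, because the mixed-radix
  encoding of indices is associative. It lets the first sample be regrouped with the system when a
  copy is consumed.\<close>

lemma kron_assoc: "kron A (kron B C) = kron (kron A B) C"
proof (rule eq_matI)
  fix i j assume "i < dim_row (kron (kron A B) C)" "j < dim_col (kron (kron A B) C)"
  then have ij: "i < dim_row A * dim_row B * dim_row C" "j < dim_col A * dim_col B * dim_col C" by auto
  let ?p = "dim_row B" and ?q = "dim_row C" and ?r = "dim_col B" and ?s = "dim_col C"
  have ij': "i < dim_row A * (?p * ?q)" "j < dim_col A * (?r * ?s)" using ij by (auto simp: mult_ac)
  note d = div_mod_less[OF ij(1)] div_mod_less[OF ij(2)] div_mod_less[OF ij'(1)] div_mod_less[OF ij'(2)]
  note dm = div_mult2_eq[of _ ?q ?p] div_mult2_eq[of _ ?s ?r] mod_mult2_eq[of _ ?q ?p] mod_mult2_eq[of _ ?s ?r]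
  have "kron A (kron B C) $$ (i, j) = A $$ (i div (?p * ?q), j div (?r * ?s)) *
      (B $$ (i mod (?p * ?q) div ?q, j mod (?r * ?s) div ?s) * C $$ (i mod (?p * ?q) mod ?q, j mod (?r * ?s) mod ?s))"
    using ij' d by (simp add: kron_def)
  also have "\<dots> = A $$ (i div ?q div ?p, j div ?s div ?r) * (B $$ (i div ?q mod ?p, j div ?s mod ?r) * C $$ (i mod ?q, j mod ?s))"
    using d dm[of i] dm[of j] by (simp add: mult.commute[of ?p] mult.commute[of ?r])
  also have "\<dots> = kron (kron A B) C $$ (i, j)"
    using ij d by (simp add: kron_def)
  finally show "kron A (kron B C) $$ (i, j) = kron (kron A B) C $$ (i, j)" .
qed auto

lemma kron_one_right [simp]: "kron A (1\<^sub>m 1) = A"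
  by (rule eq_matI) (auto simp: kron_def)

lemma kron_add_left:
  assumes "A \<in> carrier_mat n m" "B \<in> carrier_mat n m"
  shows "kron (A + B) C = kron A C + kron B C"
proof (rule eq_matI)
  fix i j assume "i < dim_row (kron A C + kron B C)" "j < dim_col (kron A C + kron B C)"
  then have ij: "i < n * dim_row C" "j < m * dim_col C" using assms by auto
  show "kron (A + B) C $$ (i, j) = (kron A C + kron B C) $$ (i, j)"
    using ij div_mod_less[OF ij(1)] div_mod_less[OF ij(2)] assms by (simp add: kron_def algebra_simps)
qed (use assms in auto)

lemma kron_zero_left: "kron (0\<^sub>m n m) C = 0\<^sub>m (n * dim_row C) (m * dim_col C)"
proof (rule eq_matI)
  fix i j assume "i < dim_row (0\<^sub>m (n * dim_row C) (m * dim_col C) :: complex mat)"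
    "j < dim_col (0\<^sub>m (n * dim_row C) (m * dim_col C) :: complex mat)"
  then have ij: "i < n * dim_row C" "j < m * dim_col C" by auto
  show "kron (0\<^sub>m n m) C $$ (i, j) = 0\<^sub>m (n * dim_row C) (m * dim_col C) $$ (i, j)"
    using ij div_mod_less[OF ij(1)] div_mod_less[OF ij(2)] by (simp add: kron_def)
qed auto

lemma unitary_kron:
  assumes "unitary n V" "unitary m W"
  shows "unitary (n * m) (kron V W)"
  using assms
  by (auto simp: unitary_def adj_kron kron_mult[of _ n n _ m m _ n _ m] kron_one)

lemma unitary_one: "unitary n (1\<^sub>m n)"
  by (simp add: unitary_def)

lemma kron_mdiag_one: "kron (mdiag n f) (1\<^sub>m m) = mdiag (n * m) (\<lambda>i. f (i div m))"
proof (rule eq_matI)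
  fix i j assume "i < dim_row (mdiag (n * m) (\<lambda>i. f (i div m)))" "j < dim_col (mdiag (n * m) (\<lambda>i. f (i div m)))"
  then have ij: "i < n * m" "j < n * m" by auto
  have "i = j" if "i div m = j div m" "i mod m = j mod m" using that by (metis div_mult_mod_eq)
  then show "kron (mdiag n f) (1\<^sub>m m) $$ (i, j) = mdiag (n * m) (\<lambda>i. f (i div m)) $$ (i, j)"
    using ij div_mod_less[OF ij(1)] div_mod_less[OF ij(2)] by (auto simp: kron_def mdiag_def)
qed auto

text \<open>Tensoring with an identity keeps the spectral form: the eigenbasis becomes V tensor 1
  and every eigenvalue is repeated m times.\<close>

lemma kron_unitary_conj_mdiag:
  assumes "V \<in> carrier_mat n n"
  shows "kron (V * mdiag n f * adj V) (1\<^sub>m m) =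
    kron V (1\<^sub>m m) * mdiag (n * m) (\<lambda>i. f (i div m)) * adj (kron V (1\<^sub>m m))"
  using assms
  by (simp add: adj_kron kron_mult[of _ n n _ m m _ n _ m] flip: kron_mdiag_one)

lemma psd_kron:
  assumes "psd A" "A \<in> carrier_mat n n" "psd B" "B \<in> carrier_mat m m"
  shows "psd (kron A B)"
proof -
  obtain C where C: "C \<in> carrier_mat n n" "A = C * adj C" using psd_factor[OF assms(1,2)] .
  obtain D where D: "D \<in> carrier_mat m m" "B = D * adj D" using psd_factor[OF assms(3,4)] .
  have "kron A B = kron C D * adj (kron C D)"
    using C D by (simp add: adj_kron kron_mult[of _ n n _ m m _ n _ m])
  then show ?thesis using psd_gram[of "kron C D" "n * m" "n * m"] C D by auto
qed

lemma mtrace_kron: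
  assumes "A \<in> carrier_mat n n" "B \<in> carrier_mat m m"
  shows "mtrace (kron A B) = mtrace A * mtrace B"
proof (cases "m = 0")
  case True
  then show ?thesis using assms by (simp add: mtrace_def)
next
  case False
  have "mtrace (kron A B) = (\<Sum>i<n * m. A $$ (i div m, i div m) * B $$ (i mod m, i mod m))"
    using assms by (subst mtrace_carrier[of _ "n * m"]) (auto simp: kron_index[of _ n n _ m m])
  also have "\<dots> = (\<Sum>a<n. \<Sum>b<m. A $$ (a, a) * B $$ (b, b))"
    using False by (intro sum_div_mod[of m "\<lambda>a b. A $$ (a, a) * B $$ (b, b)"]) simp
  finally show ?thesis using assms by (simp add: mtrace_carrier sum_product)
qed

section \<open>Functional calculus and the matrix exponential\<close>

lemma unitary_conj_mdiag_mult:
  assumes "unitary n V"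
  shows "(V * mdiag n f * adj V) * (V * mdiag n g * adj V) = V * mdiag n (\<lambda>i. f i * g i) * adj V"
proof -
  have Vc: "V \<in> carrier_mat n n" using assms by (rule unitary_carrier)
  have m: "mdiag n f * (mdiag n g * X) = mdiag n (\<lambda>i. f i * g i) * X" if "X \<in> carrier_mat n n" for X
    using that by (simp add: mdiag_mult flip: assoc_mult_mat[of _ n n _ n _ n])
  show ?thesis using Vc assms by (simp add: assoc_mult_mat[of _ n n _ n _ n] m)
qed

lemma unitary_conj_mdiag_one:
  assumes "unitary n V" "\<And>i. i < n \<Longrightarrow> f i = 1"
  shows "V * mdiag n f * adj V = 1\<^sub>m n"
proof -
  have "mdiag n f = 1\<^sub>m n" using assms(2) by (intro eq_matI) (auto simp: mdiag_def)
  then show ?thesis using assms(1) by (simp add: unitary_def right_mult_one_mat[of V n n])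
qed

lemma unitary_conj_mdiag_pow:
  assumes "unitary n V"
  shows "(V * mdiag n f * adj V) ^\<^sub>m k = V * mdiag n (\<lambda>i. f i ^ k) * adj V"
proof (induction k)
  case 0
  show ?case using unitary_conj_mdiag_one[OF assms, of "\<lambda>i. f i ^ 0"] unitary_carrier[OF assms] by simp
next
  case (Suc k)
  then show ?case using assms by (simp add: unitary_conj_mdiag_mult mult.commute)
qed

text \<open>In spectral form each entry of the exponential series is a finite combination of scalar
  exponential series, which also settles convergence of the entrywise \<open>suminf\<close>.\<close>

lemma mexp_unitary_conj_mdiag:
  assumes "unitary n V"
  shows "mexp (V * mdiag n f * adj V) = V * mdiag n (\<lambda>i. exp (f i)) * adj V"
proof (rule eq_matI)
  have Vc: "V \<in> carrier_mat n n" using assms by (rule unitary_carrier)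
  fix i j assume "i < dim_row (V * mdiag n (\<lambda>i. exp (f i)) * adj V)" "j < dim_col (V * mdiag n (\<lambda>i. exp (f i)) * adj V)"
  then have ij: "i < n" "j < n" using Vc by auto
  have "(\<lambda>k. f l ^ k / of_nat (fact k)) sums exp (f l)" for l
    using exp_converges[of "f l"] by (simp add: scaleR_conv_of_real field_simps)
  then have "(\<lambda>k. \<Sum>l<n. V $$ (i, l) * (f l ^ k / of_nat (fact k)) * cnj (V $$ (j, l)))
      sums (\<Sum>l<n. V $$ (i, l) * exp (f l) * cnj (V $$ (j, l)))"
    by (intro sums_sum sums_mult sums_mult2)
  moreover have "(\<Sum>l<n. V $$ (i, l) * (f l ^ k / of_nat (fact k)) * cnj (V $$ (j, l))) =
      ((V * mdiag n f * adj V) ^\<^sub>m k) $$ (i, j) / of_nat (fact k)" for k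
    using ij by (simp add: unitary_conj_mdiag_pow[OF assms] unitary_conj_index[OF Vc] sum_divide_distrib)
  ultimately have "(\<lambda>k. ((V * mdiag n f * adj V) ^\<^sub>m k) $$ (i, j) / of_nat (fact k)) sums
      ((V * mdiag n (\<lambda>i. exp (f i)) * adj V) $$ (i, j))"
    using ij by (simp add: unitary_conj_index[OF Vc])
  then show "mexp (V * mdiag n f * adj V) $$ (i, j) = (V * mdiag n (\<lambda>i. exp (f i)) * adj V) $$ (i, j)"
    using ij Vc by (simp add: mexp_def sums_unique[symmetric])
qed (use unitary_carrier[OF assms] in \<open>auto simp: mexp_def\<close>)

section \<open>Sums over lists of Kraus operators; channels preserve states\<close>

text \<open>The fold that underlies both \<open>is_channel\<close> and \<open>apply_channel\<close>.
  The dimensions are arguments since the empty list has to yield a zero matrix of the right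
  size.\<close>

definition msum :: "nat \<Rightarrow> nat \<Rightarrow> ('a \<Rightarrow> complex mat) \<Rightarrow> 'a list \<Rightarrow> complex mat" where
  "msum n m f xs = foldr (\<lambda>x M. f x + M) xs (0\<^sub>m n m)"

lemma msum_simps [simp]: "msum n m f [] = 0\<^sub>m n m" "msum n m f (x # xs) = f x + msum n m f xs"
  by (simp_all add: msum_def)

lemma msum_carrier [simp]: "(\<And>x. x \<in> set xs \<Longrightarrow> f x \<in> carrier_mat n m) \<Longrightarrow> msum n m f xs \<in> carrier_mat n m"
  by (induction xs) auto

lemma msum_cong: "(\<And>x. x \<in> set xs \<Longrightarrow> f x = g x) \<Longrightarrow> msum n m f xs = msum n m g xs"
  by (induction xs) auto

lemma add_index_carrier:
  "A \<in> carrier_mat n m \<Longrightarrow> B \<in> carrier_mat n m \<Longrightarrow> i < n \<Longrightarrow> j < m \<Longrightarrow> (A + B) $$ (i, j) = A $$ (i, j) + B $$ (i, j)"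
  by auto

lemma msum_index:
  assumes "\<And>x. x \<in> set xs \<Longrightarrow> f x \<in> carrier_mat n m" "i < n" "j < m"
  shows "msum n m f xs $$ (i, j) = (\<Sum>x\<leftarrow>xs. f x $$ (i, j))"
  using assms(1)
proof (induction xs)
  case (Cons x xs)
  have "msum n m f xs \<in> carrier_mat n m" using Cons.prems by simp
  then show ?case using Cons assms(2,3) by (simp add: add_index_carrier[of _ n m])
qed (use assms in auto)

lemma msum_add:
  assumes "\<And>x. x \<in> set xs \<Longrightarrow> f x \<in> carrier_mat n m" "\<And>x. x \<in> set xs \<Longrightarrow> g x \<in> carrier_mat n m"
  shows "msum n m (\<lambda>x. f x + g x) xs = msum n m f xs + msum n m g xs"
proof (rule eq_matI)
  have c: "msum n m f xs \<in> carrier_mat n m" "msum n m g xs \<in> carrier_mat n m"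
    "msum n m (\<lambda>x. f x + g x) xs \<in> carrier_mat n m" using assms by auto
  fix i j assume "i < dim_row (msum n m f xs + msum n m g xs)" "j < dim_col (msum n m f xs + msum n m g xs)"
  then have ij: "i < n" "j < m" using c by auto
  have "(\<Sum>x\<leftarrow>xs. (f x + g x) $$ (i, j)) = (\<Sum>x\<leftarrow>xs. f x $$ (i, j) + g x $$ (i, j))"
    using assms ij by (intro arg_cong[of _ _ sum_list] map_cong) (auto intro: add_index_carrier[of _ n m])
  then show "msum n m (\<lambda>x. f x + g x) xs $$ (i, j) = (msum n m f xs + msum n m g xs) $$ (i, j)"
    using ij c assms by (simp add: msum_index sum_list_addf add_index_carrier[OF c(1,2)])
next
  have c: "msum n m f xs \<in> carrier_mat n m" "msum n m g xs \<in> carrier_mat n m"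
    "msum n m (\<lambda>x. f x + g x) xs \<in> carrier_mat n m" using assms by auto
  show "dim_row (msum n m (\<lambda>x. f x + g x) xs) = dim_row (msum n m f xs + msum n m g xs)"
    "dim_col (msum n m (\<lambda>x. f x + g x) xs) = dim_col (msum n m f xs + msum n m g xs)"
    using c by auto
qed

lemma msum_append:
  assumes "\<And>x. x \<in> set (xs @ ys) \<Longrightarrow> f x \<in> carrier_mat n m"
  shows "msum n m f (xs @ ys) = msum n m f xs + msum n m f ys"
  using assms
proof (induction xs)
  case Nil
  have "msum n m f ys \<in> carrier_mat n m" using Nil by simp
  then show ?case by simp
next
  case (Cons x xs)
  have "msum n m f xs \<in> carrier_mat n m" "msum n m f ys \<in> carrier_mat n m" "f x \<in> carrier_mat n m"
    using Cons.prems by auto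
  then show ?case using Cons by (simp add: assoc_add_mat[of _ n m])
qed

lemma msum_map: "msum n m f (map g xs) = msum n m (\<lambda>x. f (g x)) xs"
  by (induction xs) auto

lemma msum_concat_map:
  assumes "\<And>x y. x \<in> set xs \<Longrightarrow> y \<in> set (g x) \<Longrightarrow> f y \<in> carrier_mat n m"
  shows "msum n m f (concat (map g xs)) = msum n m (\<lambda>x. msum n m f (g x)) xs"
  using assms
proof (induction xs)
  case (Cons x xs)
  have "msum n m f (g x @ concat (map g xs)) = msum n m f (g x) + msum n m f (concat (map g xs))"
    by (rule msum_append) (use Cons.prems in auto)
  moreover have "msum n m f (concat (map g xs)) = msum n m (\<lambda>x. msum n m f (g x)) xs"
    by (rule Cons.IH) (use Cons.prems in auto)
  ultimately show ?case by simp
qed simp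

lemma msum_swap:
  assumes "\<And>x y. x \<in> set xs \<Longrightarrow> y \<in> set ys \<Longrightarrow> f x y \<in> carrier_mat n m"
  shows "msum n m (\<lambda>x. msum n m (f x) ys) xs = msum n m (\<lambda>y. msum n m (\<lambda>x. f x y) xs) ys"
  using assms
proof (induction xs)
  case Nil
  then show ?case by (induction ys) auto
next
  case (Cons x xs)
  then show ?case by (simp add: msum_add)
qed

lemma mult_msum:
  assumes "A \<in> carrier_mat k n" "\<And>x. x \<in> set xs \<Longrightarrow> f x \<in> carrier_mat n m"
  shows "A * msum n m f xs = msum k m (\<lambda>x. A * f x) xs"
  using assms(2)
proof (induction xs)
  case (Cons x xs)
  then show ?case using assms(1) by (simp add: mult_add_distrib_mat[of A k n _ m])
qed (use assms in auto)

lemma msum_mult: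
  assumes "A \<in> carrier_mat m k" "\<And>x. x \<in> set xs \<Longrightarrow> f x \<in> carrier_mat n m"
  shows "msum n m f xs * A = msum n k (\<lambda>x. f x * A) xs"
  using assms(2)
proof (induction xs)
  case (Cons x xs)
  then show ?case using assms(1) by (simp add: add_mult_distrib_mat[of _ n m _ A k])
qed (use assms in auto)

lemma kron_msum_left:
  assumes "\<And>x. x \<in> set xs \<Longrightarrow> f x \<in> carrier_mat n m" "C \<in> carrier_mat p q"
  shows "kron (msum n m f xs) C = msum (n * p) (m * q) (\<lambda>x. kron (f x) C) xs"
  using assms(1)
proof (induction xs)
  case (Cons x xs)
  then show ?case by (simp add: kron_add_left[of _ n m])
qed (use assms(2) in \<open>auto simp: kron_zero_left\<close>)

lemma psd_msum:
  assumes "\<And>x. x \<in> set xs \<Longrightarrow> f x \<in> carrier_mat n n" "\<And>x. x \<in> set xs \<Longrightarrow> psd (f x)"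
  shows "psd (msum n n f xs)"
  using assms by (induction xs) (auto simp: psd_zero intro!: psd_add[of _ n])

lemma is_channel_msum:
  "is_channel din dout Ks \<longleftrightarrow> (\<forall>K \<in> set Ks. K \<in> carrier_mat dout din) \<and> msum din din (\<lambda>K. adj K * K) Ks = 1\<^sub>m din"
  by (simp add: is_channel_def msum_def)

lemma apply_channel_msum: "apply_channel dout Ks X = msum dout dout (\<lambda>K. K * X * adj K) Ks"
  by (simp add: apply_channel_def msum_def)

lemma conj_carrier: "K \<in> carrier_mat m n \<Longrightarrow> X \<in> carrier_mat n n \<Longrightarrow> K * X * adj K \<in> carrier_mat m m"
  by (auto intro!: mult_carrier_mat[of _ m n])

lemma adj_mult_carrier: "K \<in> carrier_mat m n \<Longrightarrow> adj K * K \<in> carrier_mat n n"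
  by (auto intro!: mult_carrier_mat[of _ n m])

lemma apply_channel_carrier:
  assumes "is_channel n m Ks" "X \<in> carrier_mat n n"
  shows "apply_channel m Ks X \<in> carrier_mat m m"
  unfolding apply_channel_msum using assms by (intro msum_carrier) (auto simp: is_channel_def intro: conj_carrier)

lemma apply_channel_psd:
  assumes "is_channel n m Ks" "X \<in> carrier_mat n n" "psd X"
  shows "psd (apply_channel m Ks X)"
  unfolding apply_channel_msum using assms
  by (intro psd_msum) (auto simp: is_channel_def intro: conj_carrier psd_conj)

text \<open>By cyclicity each summand K X adj K has the trace of adj K K X, and the matrices adj K K
  add up to the identity.\<close>

lemma mtrace_apply_channel:
  assumes "is_channel n m Ks" and X: "X \<in> carrier_mat n n"
  shows "mtrace (apply_channel m Ks X) = mtrace X"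
proof -
  have "(\<forall>K \<in> set Ks. K \<in> carrier_mat m n) \<Longrightarrow>
    mtrace (msum m m (\<lambda>K. K * X * adj K) Ks) = mtrace (msum n n (\<lambda>K. adj K * K) Ks * X)"
  proof (induction Ks)
    case Nil
    then show ?case using X by (simp add: mtrace_def)
  next
    case (Cons K Ks)
    have K: "K \<in> carrier_mat m n" using Cons by simp
    have c: "msum m m (\<lambda>K. K * X * adj K) Ks \<in> carrier_mat m m" "msum n n (\<lambda>K. adj K * K) Ks \<in> carrier_mat n n"
      using Cons.prems X by (auto intro!: msum_carrier conj_carrier adj_mult_carrier)
    have "mtrace (K * X * adj K) = mtrace (adj K * (K * X))"
      using K X by (intro mtrace_mult_comm[of _ m n]) auto
    also have "adj K * (K * X) = adj K * K * X"
      using K X by (simp add: assoc_mult_mat[of _ n m _ n _ n])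
    finally show ?case
      using Cons c K X conj_carrier[OF K X] adj_mult_carrier[OF K]
      by (simp add: mtrace_add[of _ m] mtrace_add[of _ n] add_mult_distrib_mat[of _ n n _ _ n])
  qed
  then show ?thesis using assms by (simp add: is_channel_msum apply_channel_msum)
qed

section \<open>The partial swap channel\<close>

text \<open>For \<open>\<alpha> = cos x\<close> and \<open>\<beta> = - \<i> s sin x\<close>, \<open>swap_kraus\<close> is the partial matrix element
  \<open>\<langle>a|\<^sub>A\<^sub>' exp (- \<i> s x SWAP\<^sub>A\<^sub>A\<^sub>')\<close>, where the system is ordered as \<open>A \<otimes> B \<otimes> A'\<close>.\<close>

definition swap_kraus :: "nat \<Rightarrow> nat \<Rightarrow> complex \<Rightarrow> complex \<Rightarrow> nat \<Rightarrow> complex mat" where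
  "swap_kraus dA dB \<alpha> \<beta> a = mat (dA * dB) (dA * dB * dA) (\<lambda>(i, k).
     (if k = i * dA + a then \<alpha> else 0) + (if k = (a * dB + i mod dB) * dA + i div dB then \<beta> else 0))"

text \<open>Letting a run over the basis of the sample register amounts to the partial trace over
  that register after the interaction.\<close>

definition swap_channel :: "nat \<Rightarrow> nat \<Rightarrow> complex \<Rightarrow> complex \<Rightarrow> complex mat list" where
  "swap_channel dA dB \<alpha> \<beta> = map (swap_kraus dA dB \<alpha> \<beta>) [0..<dA]"

lemma swap_kraus_carrier [simp]: "swap_kraus dA dB \<alpha> \<beta> a \<in> carrier_mat (dA * dB) (dA * dB * dA)"
  by (simp add: swap_kraus_def)

lemma swap_index_less:
  assumes "i < dA * dB" "a < (dA::nat)"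
  shows "i * dA + a < dA * dB * dA" "a * dB + i mod dB < dA * dB" "(a * dB + i mod dB) * dA + i div dB < dA * dB * dA"
  using assms div_mod_less[OF assms(1)] by (auto intro!: div_mod_combine_less)

text \<open>A row of a Kraus operator is supported on two positions, the index itself and its image
  under the swap; where they coincide the coefficients add.\<close>

lemma swap_kraus_mult_index:
  assumes "Y \<in> carrier_mat (dA * dB * dA) m" "a < dA" "i < dA * dB" "k < m"
  shows "(swap_kraus dA dB \<alpha> \<beta> a * Y) $$ (i, k) =
    \<alpha> * Y $$ (i * dA + a, k) + \<beta> * Y $$ ((a * dB + i mod dB) * dA + i div dB, k)"
proof -
  let ?p = "i * dA + a" and ?q = "(a * dB + i mod dB) * dA + i div dB"
  have "(swap_kraus dA dB \<alpha> \<beta> a * Y) $$ (i, k) = (\<Sum>l<dA * dB * dA. swap_kraus dA dB \<alpha> \<beta> a $$ (i, l) * Y $$ (l, k))"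
    using assms by (intro index_mult_mat_sum) auto
  also have "\<dots> = (\<Sum>l<dA * dB * dA. (if l = ?p then \<alpha> * Y $$ (l, k) else 0) + (if l = ?q then \<beta> * Y $$ (l, k) else 0))"
    using assms by (intro sum.cong refl) (auto simp: swap_kraus_def algebra_simps)
  also have "\<dots> = \<alpha> * Y $$ (?p, k) + \<beta> * Y $$ (?q, k)"
    using swap_index_less[OF assms(3,2)] by (simp add: sum.distrib)
  finally show ?thesis .
qed

lemma mult_adj_swap_kraus_index:
  assumes "Y \<in> carrier_mat m (dA * dB * dA)" "a < dA" "j < dA * dB" "k < m"
  shows "(Y * adj (swap_kraus dA dB \<alpha> \<beta> a)) $$ (k, j) =
    cnj \<alpha> * Y $$ (k, j * dA + a) + cnj \<beta> * Y $$ (k, (a * dB + j mod dB) * dA + j div dB)"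
proof -
  let ?L = "swap_kraus dA dB \<alpha> \<beta> a"
  have "(Y * adj ?L) $$ (k, j) = cnj (adj (Y * adj ?L) $$ (j, k))"
    using assms by (subst adj_index[of _ m "dA * dB"]) (auto intro: mult_carrier_mat[of _ m "dA * dB * dA"])
  also have "adj (Y * adj ?L) = ?L * adj Y"
    using assms by (simp add: adj_mult[of Y m "dA * dB * dA" _ "dA * dB"])
  finally show ?thesis
    using assms swap_index_less[OF assms(3,2)]
    by (simp add: swap_kraus_mult_index[of _ dA dB m] adj_index[of Y m "dA * dB * dA"])
qed

text \<open>Summed over a, the four terms are: X times the trace of \<rho>, multiplication of X by
  \<rho> tensor 1 from the left and from the right, and \<rho> tensor the partial trace of X over A.
  The formula is visibly linear in X.\<close>

lemma apply_swap_channel_index: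
  assumes X: "X \<in> carrier_mat (dA * dB) (dA * dB)" and \<rho>: "\<rho> \<in> carrier_mat dA dA"
    and ij: "i < dA * dB" "j < dA * dB"
  shows "apply_channel (dA * dB) (swap_channel dA dB \<alpha> \<beta>) (kron X \<rho>) $$ (i, j) =
    (\<Sum>a<dA. \<alpha> * cnj \<alpha> * (X $$ (i, j) * \<rho> $$ (a, a))
      + \<beta> * cnj \<alpha> * (\<rho> $$ (i div dB, a) * X $$ (a * dB + i mod dB, j))
      + \<alpha> * cnj \<beta> * (X $$ (i, a * dB + j mod dB) * \<rho> $$ (a, j div dB))
      + \<beta> * cnj \<beta> * (X $$ (a * dB + i mod dB, a * dB + j mod dB) * \<rho> $$ (i div dB, j div dB)))"
    (is "_ = (\<Sum>a<dA. ?t a)")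
proof -
  let ?N = "dA * dB"
  have Y: "kron X \<rho> \<in> carrier_mat (?N * dA) (?N * dA)" using X \<rho> by simp
  have "apply_channel ?N (swap_channel dA dB \<alpha> \<beta>) (kron X \<rho>) $$ (i, j) =
    (\<Sum>a\<leftarrow>[0..<dA]. (swap_kraus dA dB \<alpha> \<beta> a * kron X \<rho> * adj (swap_kraus dA dB \<alpha> \<beta> a)) $$ (i, j))"
    unfolding apply_channel_msum swap_channel_def msum_map
    using Y ij by (intro msum_index conj_carrier[OF swap_kraus_carrier]) auto
  also have "\<dots> = (\<Sum>a<dA. (swap_kraus dA dB \<alpha> \<beta> a * kron X \<rho> * adj (swap_kraus dA dB \<alpha> \<beta> a)) $$ (i, j))"
    by (simp add: interv_sum_list_conv_sum_set_nat lessThan_atLeast0)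
  also have "\<dots> = (\<Sum>a<dA. ?t a)"
  proof (intro sum.cong refl)
    fix a assume "a \<in> {..<dA}"
    then have a: "a < dA" by simp
    note d = div_mod_less[OF ij(1)] div_mod_less[OF ij(2)]
      swap_index_less[OF ij(1) a] swap_index_less[OF ij(2) a]
    have LY: "swap_kraus dA dB \<alpha> \<beta> a * kron X \<rho> \<in> carrier_mat ?N (?N * dA)"
      using Y by (intro mult_carrier_mat[OF swap_kraus_carrier])
    show "(swap_kraus dA dB \<alpha> \<beta> a * kron X \<rho> * adj (swap_kraus dA dB \<alpha> \<beta> a)) $$ (i, j) = ?t a"
      using ij a d
      by (simp add: mult_adj_swap_kraus_index[OF LY a] swap_kraus_mult_index[OF Y a] kron_index[OF X \<rho>]) 
         (simp add: algebra_simps)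
  qed
  finally show ?thesis .
qed

lemma kron_one_mult_index:
  assumes X: "X \<in> carrier_mat (dA * dB) m" and \<rho>: "\<rho> \<in> carrier_mat dA dA"
    and ij: "i < dA * dB" "j < m"
  shows "(kron \<rho> (1\<^sub>m dB) * X) $$ (i, j) = (\<Sum>a<dA. \<rho> $$ (i div dB, a) * X $$ (a * dB + i mod dB, j))"
proof -
  have dB: "dB > 0" using ij by (cases "dB = 0") auto
  note d = div_mod_less[OF ij(1)]
  have "(kron \<rho> (1\<^sub>m dB) * X) $$ (i, j) = (\<Sum>l<dA * dB. kron \<rho> (1\<^sub>m dB) $$ (i, l) * X $$ (l, j))"
    using assms by (intro index_mult_mat_sum) auto
  also have "\<dots> = (\<Sum>l<dA * dB. \<rho> $$ (i div dB, l div dB) * (if l mod dB = i mod dB then X $$ ((l div dB) * dB + l mod dB, j) else 0))"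
    using d ij dB by (intro sum.cong refl) (simp add: kron_index[OF \<rho> one_carrier_mat], metis div_mult_mod_eq)
  also have "\<dots> = (\<Sum>a<dA. \<Sum>b<dB. \<rho> $$ (i div dB, a) * (if b = i mod dB then X $$ (a * dB + b, j) else 0))"
    by (rule sum_div_mod[OF dB, of "\<lambda>a b. \<rho> $$ (i div dB, a) * (if b = i mod dB then X $$ (a * dB + b, j) else 0)"])
  also have "\<dots> = (\<Sum>a<dA. \<rho> $$ (i div dB, a) * X $$ (a * dB + i mod dB, j))"
    using d by (intro sum.cong refl) (simp flip: sum_distrib_left)
  finally show ?thesis .
qed

lemma mult_kron_one_index:
  assumes X: "X \<in> carrier_mat m (dA * dB)" and \<rho>: "\<rho> \<in> carrier_mat dA dA"
    and ij: "i < m" "j < dA * dB"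
  shows "(X * kron \<rho> (1\<^sub>m dB)) $$ (i, j) = (\<Sum>a<dA. X $$ (i, a * dB + j mod dB) * \<rho> $$ (a, j div dB))"
proof -
  have r: "kron \<rho> (1\<^sub>m dB) \<in> carrier_mat (dA * dB) (dA * dB)" using \<rho> by simp
  have "(X * kron \<rho> (1\<^sub>m dB)) $$ (i, j) = cnj (adj (X * kron \<rho> (1\<^sub>m dB)) $$ (j, i))"
    using X r ij by (subst adj_index[of _ m "dA * dB"]) (auto intro: mult_carrier_mat)
  also have "adj (X * kron \<rho> (1\<^sub>m dB)) = kron (adj \<rho>) (1\<^sub>m dB) * adj X"
    using X r by (simp add: adj_mult[OF X r] adj_kron)
  also have "(kron (adj \<rho>) (1\<^sub>m dB) * adj X) $$ (j, i) = (\<Sum>a<dA. adj \<rho> $$ (j div dB, a) * adj X $$ (a * dB + j mod dB, i))"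
    using X \<rho> ij by (intro kron_one_mult_index) auto
  also have "\<dots> = (\<Sum>a<dA. cnj (X $$ (i, a * dB + j mod dB) * \<rho> $$ (a, j div dB)))"
    using ij div_mod_less[OF ij(2)] swap_index_less(2)[OF ij(2)]
    by (intro sum.cong refl) (simp add: adj_index[OF X] adj_index[OF \<rho>] mult.commute)
  finally show ?thesis by (simp add: cnj_sum)
qed

text \<open>The two hypotheses say exactly that \<alpha> 1 + \<beta> SWAP is unitary, as SWAP is a
  Hermitian involution. The sum of adj K K over the Kraus operators is the product of the adjoint of
  this matrix with itself.\<close>

lemma swap_channel_is_channel:
  assumes n: "cmod \<alpha> ^ 2 + cmod \<beta> ^ 2 = 1" and z: "Re (cnj \<alpha> * \<beta>) = 0"
  shows "is_channel (dA * dB * dA) (dA * dB) (swap_channel dA dB \<alpha> \<beta>)"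
  unfolding is_channel_msum
proof
  let ?N = "dA * dB" and ?M = "dA * dB * dA"
  let ?L = "swap_kraus dA dB \<alpha> \<beta>"
  \<comment> \<open>SWAP as a permutation of composite indices: with m = (p dB + b) dA + q it
    exchanges p and q.\<close>
  define sw where "sw m = (m mod dA * dB + (m div dA) mod dB) * dA + m div dA div dB" for m
  show "\<forall>K\<in>set (swap_channel dA dB \<alpha> \<beta>). K \<in> carrier_mat ?N ?M" by (auto simp: swap_channel_def)
  have c: "msum ?M ?M (\<lambda>K. adj K * K) (swap_channel dA dB \<alpha> \<beta>) \<in> carrier_mat ?M ?M"
    by (auto intro!: msum_carrier adj_mult_carrier[of _ ?N] simp: swap_channel_def)
  show "msum ?M ?M (\<lambda>K. adj K * K) (swap_channel dA dB \<alpha> \<beta>) = 1\<^sub>m ?M"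
  proof (rule eq_matI)
    fix k l assume "k < dim_row (1\<^sub>m ?M :: complex mat)" "l < dim_col (1\<^sub>m ?M :: complex mat)"
    then have kl: "k < ?M" "l < ?M" by auto
    have dA: "dA > 0" using kl by (cases "dA = 0") auto
    have swl: "sw m < ?M" if "m < ?M" for m
      using swap_index_less(3)[of "m div dA" dA dB "m mod dA"] div_mod_less[OF that] by (simp add: sw_def)
    have sw2: "sw (sw m) = m" if "m < ?M" for m
    proof -
      note d = div_mod_less[OF that]
      note e = div_mod_less[OF d(1)]
      have "sw m div dA = m mod dA * dB + (m div dA) mod dB" "sw m mod dA = m div dA div dB"
        unfolding sw_def using e by auto
      then show ?thesis unfolding sw_def[of "sw m"] using e by (simp only:) simp
    qed
    have sw: "k = sw l \<longleftrightarrow> l = sw k" using sw2 kl by metis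
    have sws: "k = l" if "sw k = sw l" using that sw2 kl by metis
    have "msum ?M ?M (\<lambda>K. adj K * K) (swap_channel dA dB \<alpha> \<beta>) $$ (k, l) = (\<Sum>a\<leftarrow>[0..<dA]. (adj (?L a) * ?L a) $$ (k, l))"
      unfolding swap_channel_def msum_map
      using kl by (intro msum_index adj_mult_carrier[OF swap_kraus_carrier]) auto
    also have "\<dots> = (\<Sum>a<dA. (adj (?L a) * ?L a) $$ (k, l))"
      by (simp add: interv_sum_list_conv_sum_set_nat lessThan_atLeast0)
    also have "\<dots> = (\<Sum>a<dA. \<Sum>i<?N. cnj (?L a $$ (i, k)) * ?L a $$ (i, l))"
      using kl by (intro sum.cong refl, subst index_mult_mat_sum[of _ ?M ?N _ ?M])
        (auto simp: adj_index[OF swap_kraus_carrier])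
    also have "\<dots> = (\<Sum>i<?N. \<Sum>a<dA. cnj (?L a $$ (i, k)) * ?L a $$ (i, l))"
      by (rule sum.swap)
    \<comment> \<open>The output index i and the Kraus index a merge into one index of the full
      space; stacking the Kraus operators this way recovers the whole matrix \<alpha> 1 + \<beta>
      SWAP.\<close>
    also have "\<dots> = (\<Sum>m<?M. cnj (?L (m mod dA) $$ (m div dA, k)) * ?L (m mod dA) $$ (m div dA, l))"
      by (rule sum_div_mod[OF dA, of "\<lambda>i a. cnj (?L a $$ (i, k)) * ?L a $$ (i, l)", symmetric])
    also have "\<dots> = (\<Sum>m<?M. cnj ((if k = m then \<alpha> else 0) + (if k = sw m then \<beta> else 0)) *
        ((if l = m then \<alpha> else 0) + (if l = sw m then \<beta> else 0)))"
      using kl div_mod_less[of _ ?N dA] by (intro sum.cong refl) (simp add: swap_kraus_def sw_def)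
    also have "\<dots> = (\<Sum>m<?M. (if m = k then cnj \<alpha> * ((if l = k then \<alpha> else 0) + (if l = sw k then \<beta> else 0)) else 0) +
        (if m = sw k then cnj \<beta> * ((if l = sw k then \<alpha> else 0) + (if l = k then \<beta> else 0)) else 0))"
    proof (intro sum.cong refl)
      fix m assume "m \<in> {..<?M}"
      then have m: "m < ?M" by simp
      have "k = sw m \<longleftrightarrow> m = sw k" using sw2[OF m] sw2[OF kl(1)] by metis
      then show "cnj ((if k = m then \<alpha> else 0) + (if k = sw m then \<beta> else 0)) *
        ((if l = m then \<alpha> else 0) + (if l = sw m then \<beta> else 0)) =
        (if m = k then cnj \<alpha> * ((if l = k then \<alpha> else 0) + (if l = sw k then \<beta> else 0)) else 0) +
        (if m = sw k then cnj \<beta> * ((if l = sw k then \<alpha> else 0) + (if l = k then \<beta> else 0)) else 0)"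
        using sw2[OF kl(1)] by (cases "m = k"; cases "m = sw k") (simp_all add: algebra_simps)
    qed
    also have "\<dots> = (cnj \<alpha> * \<alpha> + cnj \<beta> * \<beta>) * (if k = l then 1 else 0) + (cnj \<alpha> * \<beta> + cnj \<beta> * \<alpha>) * (if l = sw k then 1 else 0)"
      using kl swl[OF kl(1)] by (simp add: sum.distrib algebra_simps)
    also have "cnj \<alpha> * \<alpha> + cnj \<beta> * \<beta> = of_real (cmod \<alpha> ^ 2 + cmod \<beta> ^ 2)"
      unfolding of_real_add complex_norm_square by (simp add: mult.commute)
    \<comment> \<open>The coefficient of SWAP is twice the real part of
      \<open>cnj \<alpha> * \<beta>\<close>.\<close>
    also have "cnj \<alpha> * \<beta> + cnj \<beta> * \<alpha> = 0"
      using z by (simp add: complex_eq_iff mult.commute)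
    finally show "msum ?M ?M (\<lambda>K. adj K * K) (swap_channel dA dB \<alpha> \<beta>) $$ (k, l) = 1\<^sub>m ?M $$ (k, l)"
      using kl n by simp
  qed (use c in auto)
qed

text \<open>When \<beta> times the conjugate of \<alpha> is purely imaginary, the two middle terms
  combine to a multiple of the commutator with \<rho> tensor 1. The last term is recognised as the
  full swap, \<alpha> = 0 and \<beta> = 1, which is itself a channel; so its value is a state
  whenever X is.\<close>

lemma apply_swap_channel_commutator:
  assumes X: "X \<in> carrier_mat (dA * dB) (dA * dB)" and \<rho>: "\<rho> \<in> carrier_mat dA dA" "mtrace \<rho> = 1"
    and ij: "i < dA * dB" "j < dA * dB"
  shows "apply_channel (dA * dB) (swap_channel dA dB \<alpha> \<beta>) (kron X \<rho>) $$ (i, j) =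
    \<alpha> * cnj \<alpha> * X $$ (i, j) + \<beta> * cnj \<alpha> * (kron \<rho> (1\<^sub>m dB) * X) $$ (i, j)
    + \<alpha> * cnj \<beta> * (X * kron \<rho> (1\<^sub>m dB)) $$ (i, j)
    + \<beta> * cnj \<beta> * apply_channel (dA * dB) (swap_channel dA dB 0 1) (kron X \<rho>) $$ (i, j)"
proof -
  have "(\<Sum>a<dA. \<rho> $$ (a, a)) = 1" using \<rho> by (simp add: mtrace_carrier)
  then have "\<alpha> * cnj \<alpha> * X $$ (i, j) = (\<Sum>a<dA. \<alpha> * cnj \<alpha> * (X $$ (i, j) * \<rho> $$ (a, a)))"
    by (simp flip: sum_distrib_left)
  then show ?thesis
    unfolding apply_swap_channel_index[OF X \<rho>(1) ij] kron_one_mult_index[OF X \<rho>(1) ij]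
      mult_kron_one_index[OF X \<rho>(1) ij] sum_distrib_left
    by (simp add: sum.distrib)
qed

section \<open>Averaging over sampled sequences\<close>

text \<open>Shaped like the body of \<open>protocol_output\<close>, so that a protocol output is
  literally a weighted sum over the sampled sequences.\<close>

definition wsum :: "nat \<Rightarrow> 'a set \<Rightarrow> ('a \<Rightarrow> complex) \<Rightarrow> ('a \<Rightarrow> complex mat) \<Rightarrow> complex mat" where
  "wsum n J w Y = mat n n (\<lambda>(i, k). \<Sum>j\<in>J. w j * Y j $$ (i, k))"

lemma wsum_carrier [simp]: "wsum n J w Y \<in> carrier_mat n n"
  by (simp add: wsum_def)

lemma wsum_index: "i < n \<Longrightarrow> k < n \<Longrightarrow> wsum n J w Y $$ (i, k) = (\<Sum>j\<in>J. w j * Y j $$ (i, k))"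
  by (simp add: wsum_def)

lemma psd_wsum:
  assumes "finite J" "\<And>j. j \<in> J \<Longrightarrow> Y j \<in> carrier_mat n n" "\<And>j. j \<in> J \<Longrightarrow> psd (Y j)" "\<And>j. j \<in> J \<Longrightarrow> w j \<ge> (0::real)"
  shows "psd (wsum n J (\<lambda>j. of_real (w j)) Y)"
  using assms
proof (induction J rule: finite_induct)
  case empty
  have "wsum n {} (\<lambda>j. of_real (w j)) Y = 0\<^sub>m n n" by (rule eq_matI) (auto simp: wsum_def)
  then show ?case by (simp add: psd_zero)
next
  case (insert a J)
  have "wsum n (insert a J) (\<lambda>j. of_real (w j)) Y = of_real (w a) \<cdot>\<^sub>m Y a + wsum n J (\<lambda>j. of_real (w j)) Y"
    using insert.hyps insert.prems(1)[of a] by (intro eq_matI) (auto simp: wsum_def)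
  then show ?case using insert by (auto intro!: psd_add[of _ n] psd_smult[of _ n])
qed

lemma mtrace_wsum:
  assumes "\<And>j. j \<in> J \<Longrightarrow> Y j \<in> carrier_mat n n"
  shows "mtrace (wsum n J w Y) = (\<Sum>j\<in>J. w j * mtrace (Y j))"
proof -
  have "mtrace (wsum n J w Y) = (\<Sum>i<n. \<Sum>j\<in>J. w j * Y j $$ (i, i))"
    by (subst mtrace_carrier[of _ n]) (auto simp: wsum_index)
  also have "\<dots> = (\<Sum>j\<in>J. \<Sum>i<n. w j * Y j $$ (i, i))" by (rule sum.swap)
  also have "\<dots> = (\<Sum>j\<in>J. w j * mtrace (Y j))"
    using assms by (intro sum.cong refl) (simp add: mtrace_carrier[of _ n] sum_distrib_left)
  finally show ?thesis .
qed

lemma density_wsum: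
  assumes "finite J" "\<And>j. j \<in> J \<Longrightarrow> density n (Y j)" "\<And>j. j \<in> J \<Longrightarrow> w j \<ge> (0::real)" "(\<Sum>j\<in>J. w j) = 1"
  shows "density n (wsum n J (\<lambda>j. of_real (w j)) Y)"
proof -
  have "mtrace (wsum n J (\<lambda>j. of_real (w j)) Y) = (\<Sum>j\<in>J. of_real (w j))"
    using assms by (subst mtrace_wsum) (auto simp: density_def)
  then have "mtrace (wsum n J (\<lambda>j. of_real (w j)) Y) = 1" using assms(4) by (simp flip: of_real_sum)
  then show ?thesis using assms by (auto simp: density_def intro!: psd_wsum)
qed

lemma density_apply_channel:
  assumes "is_channel n m Ks" "density n X"
  shows "density m (apply_channel m Ks X)"
  using assms apply_channel_carrier[OF assms(1)] apply_channel_psd[OF assms(1)] mtrace_apply_channel[OF assms(1)]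
  by (auto simp: density_def)

lemma density_kron:
  assumes "density n X" "density m Y"
  shows "density (n * m) (kron X Y)"
  using assms by (auto simp: density_def mtrace_kron[of _ n _ m] intro: psd_kron)

text \<open>Linearity of one interaction in the system state; it lets the average over earlier
  samples be taken before the next round.\<close>

lemma apply_swap_channel_wsum:
  assumes Y: "\<And>s. s \<in> J \<Longrightarrow> Y s \<in> carrier_mat (dA * dB) (dA * dB)" and \<rho>: "\<rho> \<in> carrier_mat dA dA"
    and ij: "i < dA * dB" "j < dA * dB"
  shows "apply_channel (dA * dB) (swap_channel dA dB \<alpha> \<beta>) (kron (wsum (dA * dB) J w Y) \<rho>) $$ (i, j) =
    (\<Sum>s\<in>J. w s * apply_channel (dA * dB) (swap_channel dA dB \<alpha> \<beta>) (kron (Y s) \<rho>) $$ (i, j))"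
proof -
  let ?t = "\<lambda>a X. \<alpha> * cnj \<alpha> * (X $$ (i, j) * \<rho> $$ (a, a))
      + \<beta> * cnj \<alpha> * (\<rho> $$ (i div dB, a) * X $$ (a * dB + i mod dB, j))
      + \<alpha> * cnj \<beta> * (X $$ (i, a * dB + j mod dB) * \<rho> $$ (a, j div dB))
      + \<beta> * cnj \<beta> * (X $$ (a * dB + i mod dB, a * dB + j mod dB) * \<rho> $$ (i div dB, j div dB))"
  have "(\<Sum>a<dA. ?t a (wsum (dA * dB) J w Y)) = (\<Sum>a<dA. \<Sum>s\<in>J. w s * ?t a (Y s))"
    using ij swap_index_less(2)[OF ij(1)] swap_index_less(2)[OF ij(2)]
    by (intro sum.cong refl)
      (simp add: wsum_index sum_distrib_left sum_distrib_right distrib_left sum.distrib mult_ac)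
  also have "\<dots> = (\<Sum>s\<in>J. \<Sum>a<dA. w s * ?t a (Y s))" by (rule sum.swap)
  also have "\<dots> = (\<Sum>s\<in>J. w s * (\<Sum>a<dA. ?t a (Y s)))" by (simp only: sum_distrib_left)
  finally have *: "(\<Sum>a<dA. ?t a (wsum (dA * dB) J w Y)) = (\<Sum>s\<in>J. w s * (\<Sum>a<dA. ?t a (Y s)))" .
  show ?thesis
    unfolding apply_swap_channel_index[OF wsum_carrier \<rho> ij] *
    by (intro sum.cong refl) (simp only: apply_swap_channel_index[OF Y \<rho> ij])
qed

section \<open>One channel on the whole sample register against a sequence of interactions\<close>

lemma kron_list_carrier:
  "(\<And>j. j \<in> set js \<Longrightarrow> \<rho> j \<in> carrier_mat d d) \<Longrightarrow> kron_list (map \<rho> js) \<in> carrier_mat (d ^ length js) (d ^ length js)"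
  by (induction js) auto

text \<open>The sample register is consumed from the left: one swap interaction absorbs the first copy and
  leaves the remaining ones untouched.\<close>

fun sim_channel :: "nat \<Rightarrow> nat \<Rightarrow> complex \<Rightarrow> (nat \<Rightarrow> complex) \<Rightarrow> nat list \<Rightarrow> complex mat list" where
  "sim_channel dA dB \<alpha> \<beta> [] = [1\<^sub>m (dA * dB)]"
| "sim_channel dA dB \<alpha> \<beta> (j # js) = concat (map (\<lambda>M. map (\<lambda>L. M * kron L (1\<^sub>m (dA ^ length js)))
     (swap_channel dA dB \<alpha> (\<beta> j))) (sim_channel dA dB \<alpha> \<beta> js))"

text \<open>Completeness of a composition: for fixed L the inner sum over the later operators M
  collapses to the identity, leaving adj L L tensor 1, and then the sum over L gives the identity
  again.\<close>

lemma sim_channel_is_channel: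
  assumes "\<And>j. j \<in> set js \<Longrightarrow> is_channel (dA * dB * dA) (dA * dB) (swap_channel dA dB \<alpha> (\<beta> j))"
  shows "is_channel (dA * dB * dA ^ length js) (dA * dB) (sim_channel dA dB \<alpha> \<beta> js)"
  using assms
proof (induction js)
  case Nil
  show ?case by (simp add: is_channel_def)
next
  case (Cons j js)
  let ?N = "dA * dB" and ?e = "dA ^ length js"
  let ?M = "?N * dA * ?e"
  let ?Ls = "swap_channel dA dB \<alpha> (\<beta> j)" and ?Ms = "sim_channel dA dB \<alpha> \<beta> js"
  let ?k = "\<lambda>L. kron L (1\<^sub>m ?e)"
  have IH: "is_channel (?N * ?e) ?N ?Ms" using Cons by simp
  then have Mc: "M \<in> carrier_mat ?N (?N * ?e)" if "M \<in> set ?Ms" for M using that by (simp add: is_channel_def)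
  have st: "is_channel (?N * dA) ?N ?Ls" using Cons.prems by simp
  then have Lc: "L \<in> carrier_mat ?N (?N * dA)" if "L \<in> set ?Ls" for L using that by (simp add: is_channel_def)
  have kc: "?k L \<in> carrier_mat (?N * ?e) ?M" if "L \<in> set ?Ls" for L
    using Lc[OF that] by (rule kron_carrier) simp
  have mk: "M * ?k L \<in> carrier_mat ?N ?M" if "M \<in> set ?Ms" "L \<in> set ?Ls" for M L
    using Mc[OF that(1)] kc[OF that(2)] by (rule mult_carrier_mat)
  have eq: "adj (M * ?k L) * (M * ?k L) = adj (?k L) * (adj M * M) * ?k L" if "M \<in> set ?Ms" "L \<in> set ?Ls" for M L
  proof -
    note c = Mc[OF that(1)] kc[OF that(2)]
    have "adj (M * ?k L) * (M * ?k L) = adj (?k L) * adj M * (M * ?k L)"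
      using adj_mult[OF c] by simp
    also have "\<dots> = adj (?k L) * (adj M * (M * ?k L))"
      using c mk[OF that] by (intro assoc_mult_mat[of _ ?M "?N * ?e" _ ?N _ ?M]) auto
    also have "adj M * (M * ?k L) = adj M * M * ?k L"
      using c by (intro assoc_mult_mat[symmetric, of _ "?N * ?e" ?N _ "?N * ?e" _ ?M]) auto
    also have "adj (?k L) * (adj M * M * ?k L) = adj (?k L) * (adj M * M) * ?k L"
      using c adj_mult_carrier[OF c(1)]
      by (intro assoc_mult_mat[symmetric, of _ ?M "?N * ?e" _ "?N * ?e" _ ?M]) auto
    finally show ?thesis .
  qed
  have c1: "adj (?k L) * (adj M * M) \<in> carrier_mat ?M (?N * ?e)" if "M \<in> set ?Ms" "L \<in> set ?Ls" for M L
    using adj_carrier[OF kc[OF that(2)]] adj_mult_carrier[OF Mc[OF that(1)]] by (rule mult_carrier_mat)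
  have c2: "adj (?k L) * (adj M * M) * ?k L \<in> carrier_mat ?M ?M" if "M \<in> set ?Ms" "L \<in> set ?Ls" for M L
    using c1[OF that] kc[OF that(2)] by (rule mult_carrier_mat)
  have "msum ?M ?M (\<lambda>K. adj K * K) (sim_channel dA dB \<alpha> \<beta> (j # js)) =
      msum ?M ?M (\<lambda>M. msum ?M ?M (\<lambda>L. adj (M * ?k L) * (M * ?k L)) ?Ls) ?Ms"
    by (simp only: sim_channel.simps, subst msum_concat_map) (auto simp: msum_map intro!: adj_mult_carrier[OF mk])
  also have "\<dots> = msum ?M ?M (\<lambda>M. msum ?M ?M (\<lambda>L. adj (?k L) * (adj M * M) * ?k L) ?Ls) ?Ms"
    by (intro msum_cong eq)
  \<comment> \<open>Exchange the sums: the operators M stand innermost in the product, so their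
    completeness has to be used first.\<close>
  also have "\<dots> = msum ?M ?M (\<lambda>L. msum ?M ?M (\<lambda>M. adj (?k L) * (adj M * M) * ?k L) ?Ms) ?Ls"
    by (intro msum_swap c2)
  also have "\<dots> = msum ?M ?M (\<lambda>L. kron (adj L * L) (1\<^sub>m ?e)) ?Ls"
  proof (intro msum_cong)
    fix L assume L: "L \<in> set ?Ls"
    have "msum ?M ?M (\<lambda>M. adj (?k L) * (adj M * M) * ?k L) ?Ms = msum ?M (?N * ?e) (\<lambda>M. adj (?k L) * (adj M * M)) ?Ms * ?k L"
      using kc[OF L] c1 L by (intro msum_mult[symmetric]) auto
    also have "msum ?M (?N * ?e) (\<lambda>M. adj (?k L) * (adj M * M)) ?Ms = adj (?k L) * msum (?N * ?e) (?N * ?e) (\<lambda>M. adj M * M) ?Ms"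
      using kc[OF L] by (intro mult_msum[symmetric] adj_carrier adj_mult_carrier[OF Mc]) auto
    also have "msum (?N * ?e) (?N * ?e) (\<lambda>M. adj M * M) ?Ms = 1\<^sub>m (?N * ?e)"
      using IH by (simp add: is_channel_msum)
    also have "adj (?k L) * 1\<^sub>m (?N * ?e) = adj (?k L)"
      using adj_carrier[OF kc[OF L]] by (rule right_mult_one_mat)
    also have "adj (?k L) * ?k L = kron (adj L * L) (1\<^sub>m ?e)"
      using Lc[OF L] by (simp add: adj_kron kron_mult[of _ "?N * dA" ?N _ ?e ?e _ "?N * dA" _ ?e])
    finally show "msum ?M ?M (\<lambda>M. adj (?k L) * (adj M * M) * ?k L) ?Ms = kron (adj L * L) (1\<^sub>m ?e)" .
  qed
  also have "\<dots> = kron (msum (?N * dA) (?N * dA) (\<lambda>L. adj L * L) ?Ls) (1\<^sub>m ?e)"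
    by (intro kron_msum_left[symmetric] adj_mult_carrier[OF Lc]) auto
  also have "\<dots> = 1\<^sub>m ?M" using st by (simp add: is_channel_msum kron_one)
  finally have "msum ?M ?M (\<lambda>K. adj K * K) (sim_channel dA dB \<alpha> \<beta> (j # js)) = 1\<^sub>m ?M" .
  moreover have "\<forall>K\<in>set (sim_channel dA dB \<alpha> \<beta> (j # js)). K \<in> carrier_mat ?N ?M"
    using mk by auto
  moreover have "dA * dB * dA ^ length (j # js) = ?M" by (simp add: mult_ac)
  ultimately show ?case by (simp only: is_channel_msum)
qed

text \<open>After regrouping by associativity of \<open>kron\<close>, the lifted L acts on X tensor
  the first copy and leaves the remaining copies R alone. Summing over L, for fixed M, turns the
  system state into X' while R survives, and the induction hypothesis applies to X'.\<close>

lemma apply_sim_channel: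
  assumes "\<And>j. j \<in> set js \<Longrightarrow> is_channel (dA * dB * dA) (dA * dB) (swap_channel dA dB \<alpha> (\<beta> j))"
    and "\<And>j. j \<in> set js \<Longrightarrow> \<rho> j \<in> carrier_mat dA dA" and "X \<in> carrier_mat (dA * dB) (dA * dB)"
  shows "apply_channel (dA * dB) (sim_channel dA dB \<alpha> \<beta> js) (kron X (kron_list (map \<rho> js))) =
    foldl (\<lambda>Y j. apply_channel (dA * dB) (swap_channel dA dB \<alpha> (\<beta> j)) (kron Y (\<rho> j))) X js"
  using assms
proof (induction js arbitrary: X)
  case Nil
  then show ?case by (simp add: apply_channel_def kron_one_right[unfolded One_nat_def])
next
  case (Cons j js)
  let ?N = "dA * dB" and ?e = "dA ^ length js"
  let ?M = "?N * dA * ?e"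
  let ?Ls = "swap_channel dA dB \<alpha> (\<beta> j)" and ?Ms = "sim_channel dA dB \<alpha> \<beta> js"
  let ?k = "\<lambda>L. kron L (1\<^sub>m ?e)"
  define R where "R = kron_list (map \<rho> js)"
  define Z where "Z = kron X (\<rho> j)"
  have R: "R \<in> carrier_mat ?e ?e" unfolding R_def using Cons.prems by (intro kron_list_carrier) auto
  have Z: "Z \<in> carrier_mat (?N * dA) (?N * dA)" unfolding Z_def using Cons.prems by auto
  have ch: "is_channel (?N * ?e) ?N ?Ms" using Cons.prems by (intro sim_channel_is_channel) auto
  then have Mc: "M \<in> carrier_mat ?N (?N * ?e)" if "M \<in> set ?Ms" for M using that by (simp add: is_channel_def)
  have st: "is_channel (?N * dA) ?N ?Ls" using Cons.prems by simp
  then have Lc: "L \<in> carrier_mat ?N (?N * dA)" if "L \<in> set ?Ls" for L using that by (simp add: is_channel_def)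
  have kc: "?k L \<in> carrier_mat (?N * ?e) ?M" if "L \<in> set ?Ls" for L
    using Lc[OF that] by (rule kron_carrier) simp
  have mk: "M * ?k L \<in> carrier_mat ?N ?M" if "M \<in> set ?Ms" "L \<in> set ?Ls" for M L
    using Mc[OF that(1)] kc[OF that(2)] by (rule mult_carrier_mat)
  have ZR: "kron Z R \<in> carrier_mat ?M ?M" using Z R by (rule kron_carrier)
  have LZ: "L * Z * adj L \<in> carrier_mat ?N ?N" if "L \<in> set ?Ls" for L using Lc[OF that] Z by (rule conj_carrier)
  have kLZ: "kron (L * Z * adj L) R \<in> carrier_mat (?N * ?e) (?N * ?e)" if "L \<in> set ?Ls" for L
    using LZ[OF that] R by (rule kron_carrier)
  have MkLZ: "M * kron (L * Z * adj L) R \<in> carrier_mat ?N (?N * ?e)" if "M \<in> set ?Ms" "L \<in> set ?Ls" for M L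
    using Mc[OF that(1)] kLZ[OF that(2)] by (rule mult_carrier_mat)
  have eq: "M * ?k L * kron Z R * adj (M * ?k L) = M * kron (L * Z * adj L) R * adj M"
    if "M \<in> set ?Ms" "L \<in> set ?Ls" for M L
  proof -
    note c = Mc[OF that(1)] kc[OF that(2)]
    have LZc: "L * Z \<in> carrier_mat ?N (?N * dA)" using Lc[OF that(2)] Z by (rule mult_carrier_mat)
    have a: "?k L * kron Z R * adj (?k L) = kron (L * Z * adj L) R"
      using Lc[OF that(2)] Z R LZc
      by (simp add: adj_kron kron_mult[of _ ?N "?N * dA" _ ?e ?e _ "?N * dA" _ ?e] kron_mult[of _ ?N "?N * dA" _ ?e ?e _ ?N _ ?e])
    have kZ: "?k L * kron Z R \<in> carrier_mat (?N * ?e) ?M" using c(2) ZR by (rule mult_carrier_mat)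
    have "M * ?k L * kron Z R * adj (M * ?k L) = M * (?k L * kron Z R) * (adj (?k L) * adj M)"
      unfolding adj_mult[OF c] assoc_mult_mat[OF c ZR] ..
    also have "\<dots> = M * (?k L * kron Z R) * adj (?k L) * adj M"
      using c mult_carrier_mat[OF c(1) kZ] by (intro assoc_mult_mat[symmetric]) auto
    also have "M * (?k L * kron Z R) * adj (?k L) = M * (?k L * kron Z R * adj (?k L))"
      by (rule assoc_mult_mat[OF c(1) kZ adj_carrier[OF c(2)]])
    finally show ?thesis unfolding a .
  qed
  define X' where "X' = apply_channel ?N ?Ls Z"
  have X': "X' \<in> carrier_mat ?N ?N" unfolding X'_def using st Z by (rule apply_channel_carrier)
  have "apply_channel ?N (sim_channel dA dB \<alpha> \<beta> (j # js)) (kron Z R) =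
      msum ?N ?N (\<lambda>M. msum ?N ?N (\<lambda>L. M * ?k L * kron Z R * adj (M * ?k L)) ?Ls) ?Ms"
    unfolding apply_channel_msum sim_channel.simps
    by (subst msum_concat_map) (auto simp: msum_map intro!: conj_carrier[OF mk ZR])
  also have "\<dots> = msum ?N ?N (\<lambda>M. msum ?N ?N (\<lambda>L. M * kron (L * Z * adj L) R * adj M) ?Ls) ?Ms"
    by (intro msum_cong eq)
  also have "\<dots> = msum ?N ?N (\<lambda>M. M * kron X' R * adj M) ?Ms"
  proof (intro msum_cong)
    fix M assume M: "M \<in> set ?Ms"
    have "msum ?N ?N (\<lambda>L. M * kron (L * Z * adj L) R * adj M) ?Ls = msum ?N (?N * ?e) (\<lambda>L. M * kron (L * Z * adj L) R) ?Ls * adj M"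
      using MkLZ[OF M] Mc[OF M] by (intro msum_mult[symmetric]) auto
    also have "msum ?N (?N * ?e) (\<lambda>L. M * kron (L * Z * adj L) R) ?Ls = M * msum (?N * ?e) (?N * ?e) (\<lambda>L. kron (L * Z * adj L) R) ?Ls"
      using kLZ Mc[OF M] by (intro mult_msum[symmetric]) auto
    also have "msum (?N * ?e) (?N * ?e) (\<lambda>L. kron (L * Z * adj L) R) ?Ls = kron X' R"
      unfolding X'_def apply_channel_msum using R LZ by (intro kron_msum_left[symmetric]) auto
    finally show "msum ?N ?N (\<lambda>L. M * kron (L * Z * adj L) R * adj M) ?Ls = M * kron X' R * adj M" .
  qed
  also have "\<dots> = apply_channel ?N ?Ms (kron X' R)" by (simp add: apply_channel_msum)
  also have "\<dots> = foldl (\<lambda>Y j. apply_channel ?N (swap_channel dA dB \<alpha> (\<beta> j)) (kron Y (\<rho> j))) X' js"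
    unfolding R_def using Cons.prems X' by (intro Cons.IH) auto
  finally show ?case by (simp add: X'_def Z_def R_def kron_assoc)
qed

section \<open>Random index sequences and the averaged round\<close>

definition index_lists :: "nat \<Rightarrow> nat \<Rightarrow> nat list set" where
  "index_lists K n = {js. set js \<subseteq> {..<K} \<and> length js = n}"

lemma index_lists_0 [simp]: "index_lists K 0 = {[]}"
  by (auto simp: index_lists_def)

lemma finite_index_lists [simp]: "finite (index_lists K n)"
  unfolding index_lists_def by (rule finite_lists_length_eq) simp

text \<open>The last entry is split off, not the first, since the last interaction is the outermost
  one in the \<open>foldl\<close> and in the iterate of the averaged round.\<close>

lemma sum_index_lists_Suc:
  fixes f :: "nat list \<Rightarrow> 'a::comm_monoid_add"
  shows "(\<Sum>js\<in>index_lists K (Suc n). f js) = (\<Sum>js\<in>index_lists K n. \<Sum>j<K. f (js @ [j]))"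
proof -
  have "(\<Sum>js\<in>index_lists K (Suc n). f js) = (\<Sum>(js, j)\<in>index_lists K n \<times> {..<K}. f (js @ [j]))"
    by (rule sum.reindex_bij_witness[of _ "\<lambda>(js, j). js @ [j]" "\<lambda>js. (butlast js, last js)"])
      (auto simp: index_lists_def length_Suc_conv_rev)
  then show ?thesis by (simp add: sum.cartesian_product)
qed

lemma sum_index_lists_prod:
  fixes w :: "nat \<Rightarrow> real"
  assumes "(\<Sum>j<K. w j) = 1"
  shows "(\<Sum>js\<in>index_lists K n. prod_list (map w js)) = 1"
  by (induction n) (simp_all add: sum_index_lists_Suc assms flip: sum_distrib_left)

text \<open>Linearity of expectation for n independent draws; the added entry contributes
  \<open>w j\<close>.\<close>

lemma sum_index_lists_count:
  fixes w :: "nat \<Rightarrow> real"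
  assumes w: "(\<Sum>j<K. w j) = 1" and j: "j < K"
  shows "(\<Sum>js\<in>index_lists K n. prod_list (map w js) * real (count_list js j)) = real n * w j"
proof (induction n)
  case (Suc n)
  have "(\<Sum>js\<in>index_lists K (Suc n). prod_list (map w js) * real (count_list js j)) =
    (\<Sum>js\<in>index_lists K n. (\<Sum>i<K. w i) * (prod_list (map w js) * real (count_list js j)) + prod_list (map w js) * (\<Sum>i<K. if i = j then w i else 0))"
    unfolding sum_index_lists_Suc sum_distrib_left sum_distrib_right sum.distrib[symmetric]
    by (intro sum.cong refl) (auto simp: algebra_simps)
  also have "\<dots> = real n * w j + w j"
    using j by (simp add: w sum.distrib Suc sum_index_lists_prod[OF w] flip: sum_distrib_right)
  finally show ?case by (simp add: algebra_simps)
qed simp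

definition avg_step :: "nat \<Rightarrow> nat \<Rightarrow> nat \<Rightarrow> (nat \<Rightarrow> real) \<Rightarrow> complex \<Rightarrow> (nat \<Rightarrow> complex) \<Rightarrow> (nat \<Rightarrow> complex mat) \<Rightarrow> complex mat \<Rightarrow> complex mat" where
  "avg_step dA dB K w \<alpha> \<beta> \<rho> X = wsum (dA * dB) {..<K} (\<lambda>j. of_real (w j))
     (\<lambda>j. apply_channel (dA * dB) (swap_channel dA dB \<alpha> (\<beta> j)) (kron X (\<rho> j)))"

text \<open>The weights are products and every interaction is linear, so averaging over whole
  sequences equals averaging after each round. The randomised protocol thereby becomes the n-th
  iterate of one fixed map.\<close>

lemma protocol_output_eq_avg_step:
  assumes ch: "\<And>j. j < K \<Longrightarrow> is_channel (dA * dB * dA) (dA * dB) (swap_channel dA dB \<alpha> (\<beta> j))"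
    and \<rho>: "\<And>j. j < K \<Longrightarrow> \<rho> j \<in> carrier_mat dA dA" and X: "X \<in> carrier_mat (dA * dB) (dA * dB)"
  shows "protocol_output dA dB (index_lists K n) (\<lambda>js. prod_list (map w js)) (sim_channel dA dB \<alpha> \<beta>) \<rho> X =
    (avg_step dA dB K w \<alpha> \<beta> \<rho> ^^ n) X"
proof -
  let ?N = "dA * dB"
  define step where "step j Y = apply_channel ?N (swap_channel dA dB \<alpha> (\<beta> j)) (kron Y (\<rho> j))" for j Y
  define run where "run js = foldl (\<lambda>Y j. step j Y) X js" for js
  have stepc: "step j Y \<in> carrier_mat ?N ?N" if "j < K" "Y \<in> carrier_mat ?N ?N" for j Y
    unfolding step_def using ch[OF that(1)] kron_carrier[OF that(2) \<rho>[OF that(1)]] by (rule apply_channel_carrier)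
  have runc: "run js \<in> carrier_mat ?N ?N" if "set js \<subseteq> {..<K}" for js
    using that by (induction js rule: rev_induct) (auto simp: run_def X stepc)
  have "protocol_output dA dB (index_lists K n) (\<lambda>js. prod_list (map w js)) (sim_channel dA dB \<alpha> \<beta>) \<rho> X =
    wsum ?N (index_lists K n) (\<lambda>js. of_real (prod_list (map w js))) run"
    unfolding protocol_output_def wsum_def run_def step_def
  proof (intro arg_cong[of _ _ "mat ?N ?N"] ext)
    fix ik
    show "(case ik of (i, k) \<Rightarrow> \<Sum>js\<in>index_lists K n. complex_of_real (prod_list (map w js)) *
        apply_channel ?N (sim_channel dA dB \<alpha> \<beta> js) (kron X (kron_list (map \<rho> js))) $$ (i, k)) =
      (case ik of (i, k) \<Rightarrow> \<Sum>js\<in>index_lists K n. complex_of_real (prod_list (map w js)) *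
        foldl (\<lambda>Y j. apply_channel ?N (swap_channel dA dB \<alpha> (\<beta> j)) (kron Y (\<rho> j))) X js $$ (i, k))"
      unfolding split_beta
      by (intro sum.cong refl, subst apply_sim_channel) (auto simp: index_lists_def ch \<rho> X)
  qed
  also have "\<dots> = (avg_step dA dB K w \<alpha> \<beta> \<rho> ^^ n) X"
  proof (induction n)
    case 0
    show ?case using X by (intro eq_matI) (auto simp: wsum_def run_def)
  next
    case (Suc n)
    show ?case
    proof (rule eq_matI)
      let ?W = "wsum ?N (index_lists K n) (\<lambda>js. of_real (prod_list (map w js))) run"
      fix i k assume "i < dim_row ((avg_step dA dB K w \<alpha> \<beta> \<rho> ^^ Suc n) X)" "k < dim_col ((avg_step dA dB K w \<alpha> \<beta> \<rho> ^^ Suc n) X)"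
      then have ik: "i < ?N" "k < ?N" by (auto simp: avg_step_def wsum_def)
      have "wsum ?N (index_lists K (Suc n)) (\<lambda>js. of_real (prod_list (map w js))) run $$ (i, k) =
        (\<Sum>js\<in>index_lists K n. \<Sum>j<K. of_real (w j) * (of_real (prod_list (map w js)) * step j (run js) $$ (i, k)))"
        using ik by (simp add: wsum_index sum_index_lists_Suc run_def mult_ac)
      also have "\<dots> = (\<Sum>j<K. \<Sum>js\<in>index_lists K n. of_real (w j) * (of_real (prod_list (map w js)) * step j (run js) $$ (i, k)))"
        by (rule sum.swap)
      \<comment> \<open>For each last index j the average over the earlier indices moves inside the
        interaction by linearity.\<close>
      also have "\<dots> = (\<Sum>j<K. of_real (w j) * step j ?W $$ (i, k))"
        unfolding sum_distrib_left[symmetric]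
      proof (intro sum.cong refl arg_cong2[of _ _ _ _ "(*)"])
        fix j assume "j \<in> {..<K}"
        then show "(\<Sum>js\<in>index_lists K n. complex_of_real (prod_list (map w js)) * step j (run js) $$ (i, k)) = step j ?W $$ (i, k)"
          unfolding step_def using \<rho> ik runc
          by (intro apply_swap_channel_wsum[symmetric]) (auto simp: index_lists_def)
      qed
      also have "\<dots> = avg_step dA dB K w \<alpha> \<beta> \<rho> ?W $$ (i, k)"
        using ik by (simp add: avg_step_def wsum_index step_def)
      finally show "wsum ?N (index_lists K (Suc n)) (\<lambda>js. of_real (prod_list (map w js))) run $$ (i, k) =
        (avg_step dA dB K w \<alpha> \<beta> \<rho> ^^ Suc n) X $$ (i, k)" by (simp add: Suc)
    qed (auto simp: avg_step_def wsum_def)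
  qed
  finally show ?thesis .
qed

lemma density_avg_step:
  assumes "\<And>j. j < K \<Longrightarrow> is_channel (dA * dB * dA) (dA * dB) (swap_channel dA dB \<alpha> (\<beta> j))"
    and "\<And>j. j < K \<Longrightarrow> density dA (\<rho> j)" "density (dA * dB) X"
    and "\<And>j. j < K \<Longrightarrow> w j \<ge> 0" "(\<Sum>j<K. w j) = 1"
  shows "density (dA * dB) (avg_step dA dB K w \<alpha> \<beta> \<rho> X)"
  unfolding avg_step_def using assms
  by (intro density_wsum density_apply_channel) (auto intro: density_kron)

section \<open>Error estimates\<close>

text \<open>The Maclaurin remainder of order two. The sharper cubic bound would gain nothing, as
  only second-order errors are counted.\<close>

lemma abs_sin_minus_self_le: "\<bar>sin x - x\<bar> \<le> x\<^sup>2 / 2" for x :: real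
  using Maclaurin_sin_bound[of x 2] by (simp add: numeral_2_eq_2 sin_coeff_def)

lemma one_minus_cos_le: "1 - cos x \<le> x\<^sup>2 / 2" for x :: real
proof -
  have "1 - cos x = 2 * (sin (x / 2))\<^sup>2" using cos_double_sin[of "x / 2"] by simp
  also have "(sin (x / 2))\<^sup>2 \<le> (x / 2)\<^sup>2"
    using abs_sin_x_le_abs_x[of "x / 2"] by (simp only: abs_le_square_iff)
  finally show ?thesis by (simp add: power_divide)
qed

lemma norm_exp_minus_linear_le: "cmod (exp (- (\<i> * of_real a)) - 1 + \<i> * of_real a) \<le> a\<^sup>2"
proof -
  have "exp (- (\<i> * of_real a)) = cis (- a)" by (simp add: cis_conv_exp)
  then have "exp (- (\<i> * of_real a)) - 1 + \<i> * of_real a = of_real (- (1 - cos a)) + \<i> * of_real (- (sin a - a))"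
    by (simp add: complex_eq_iff)
  also have "cmod \<dots> \<le> cmod (of_real (- (1 - cos a))) + cmod (\<i> * of_real (- (sin a - a)))"
    by (rule norm_triangle_ineq)
  also have "\<dots> = \<bar>1 - cos a\<bar> + \<bar>sin a - a\<bar>"
    by (simp only: norm_mult norm_ii norm_of_real abs_minus_cancel mult_1)
  also have "\<dots> \<le> a\<^sup>2"
    using abs_sin_minus_self_le[of a] one_minus_cos_le[of a] cos_le_one[of a] by linarith
  finally show ?thesis .
qed

text \<open>The sine estimate at 2 x with the double-angle formula, divided by 2 x. The quotient is
  the ratio between the commutator produced by a round and the one required.\<close>

lemma abs_one_minus_sin_cos_le:
  assumes "x > (0::real)"
  shows "\<bar>1 - sin x * cos x / x\<bar> \<le> x"
proof -
  have "\<bar>2 * x - sin (2 * x)\<bar> \<le> 2 * x\<^sup>2" using abs_sin_minus_self_le[of "2 * x"] by (simp add: power2_eq_square)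
  then have "\<bar>x - sin x * cos x\<bar> \<le> x\<^sup>2" by (simp add: sin_double)
  moreover have "1 - sin x * cos x / x = (x - sin x * cos x) / x" using assms by (simp add: field_simps)
  ultimately show ?thesis using assms by (simp add: divide_le_eq power2_eq_square)
qed

text \<open>Replacing X by r X and Y by Y / r leaves the cross terms unchanged. Polarization alone
  yields p^2 + q^2; the optimal r = sqrt (q / p) improves this to 2 p q, which is small as soon as
  one of the two factors is.\<close>

lemma trace_bound_cross_scaled:
  assumes S: "psd S" "S \<in> carrier_mat n n" and X: "X \<in> carrier_mat n n" and Y: "Y \<in> carrier_mat n n"
    and p: "p > 0" "Re (mtrace (X * S * adj X)) \<le> p\<^sup>2" and q: "q > 0" "Re (mtrace (Y * S * adj Y)) \<le> q\<^sup>2"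
  shows "trace_bound n (X * S * adj Y + Y * S * adj X) (2 * p * q)"
proof -
  define r where "r = sqrt (q / p)"
  have r: "r > 0" "r\<^sup>2 = q / p" using p q by (auto simp: r_def)
  let ?X = "of_real r \<cdot>\<^sub>m X" and ?Y = "of_real (1 / r) \<cdot>\<^sub>m Y"
  have c: "?X \<in> carrier_mat n n" "?Y \<in> carrier_mat n n" using X Y by auto
  have sc: "mtrace (of_real s \<cdot>\<^sub>m Z * S * adj (of_real s \<cdot>\<^sub>m Z)) = of_real (s\<^sup>2) * mtrace (Z * S * adj Z)"
    if Z: "Z \<in> carrier_mat n n" for s Z
  proof -
    have "of_real s \<cdot>\<^sub>m Z * S * adj (of_real s \<cdot>\<^sub>m Z) = of_real (s\<^sup>2) \<cdot>\<^sub>m (Z * S * adj Z)"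
      by (rule eq_matI) (use Z S in \<open>auto simp: sandwich_linear[of _ n] power2_eq_square\<close>)
    then show ?thesis using Z S by (simp add: mtrace_smult[of _ n])
  qed
  have "?X * S * adj ?Y + ?Y * S * adj ?X = X * S * adj Y + Y * S * adj X"
    by (rule eq_matI) (use X Y S r in \<open>auto simp: sandwich_linear[of _ n]\<close>)
  moreover have "Re (mtrace (?X * S * adj ?X)) \<le> p * q"
    unfolding sc[OF X] using p q r mult_left_mono[OF p(2), of "q / p"] by (simp add: power2_eq_square mult_ac)
  moreover have "Re (mtrace (?Y * S * adj ?Y)) \<le> p * q"
    unfolding sc[OF Y] using p q r mult_left_mono[OF q(2), of "p / q"] by (simp add: power_divide) (simp add: power2_eq_square mult_ac)
  ultimately show ?thesis
    using trace_bound_mono[OF trace_bound_cross[OF S c], of "2 * p * q"] by simp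
qed

section \<open>Error of one round and its accumulation\<close>

lemma adj_unitary_conj_mdiag:
  "V \<in> carrier_mat n n \<Longrightarrow> adj (V * mdiag n f * adj V) = V * mdiag n (\<lambda>i. cnj (f i)) * adj V"
  by (simp add: adj_mult[of _ n n _ n] adj_mdiag assoc_mult_mat[of _ n n _ n _ n])

lemma unitary_exp:
  assumes "unitary n V"
  shows "unitary n (V * mdiag n (\<lambda>i. exp (- (\<i> * of_real (a i)))) * adj V)"
proof (rule unitaryI)
  have Vc: "V \<in> carrier_mat n n" using assms by (rule unitary_carrier)
  then show "V * mdiag n (\<lambda>i. exp (- (\<i> * of_real (a i)))) * adj V \<in> carrier_mat n n" by simp
  show "adj (V * mdiag n (\<lambda>i. exp (- (\<i> * of_real (a i)))) * adj V) *
    (V * mdiag n (\<lambda>i. exp (- (\<i> * of_real (a i)))) * adj V) = 1\<^sub>m n"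
    unfolding adj_unitary_conj_mdiag[OF Vc] unitary_conj_mdiag_mult[OF assms]
  proof (rule unitary_conj_mdiag_one[OF assms])
    fix i
    have "exp (- (\<i> * of_real (a i))) = cis (- a i)" by (simp add: cis_conv_exp)
    then show "cnj (exp (- (\<i> * of_real (a i)))) * exp (- (\<i> * of_real (a i))) = 1"
      by (simp add: cis_cnj cis_mult)
  qed
qed

text \<open>Write U = 1 + A' + R with A' = - \<i> A of norm at most x and a remainder R of norm at
  most x^2. Expanding U \<sigma> adj U, the zeroth-order terms leave x^2 + x^2 (\<open>D1\<close>,
  \<open>D2\<close>), the commutators 2 x^2 (\<open>D3\<close>), the quadratic term A \<sigma> A
  gives x^2 (\<open>D4\<close>), and the terms with R give 2 x^2 + x^2 (\<open>D5\<close>,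
  \<open>D6\<close>).\<close>

lemma one_step_trace_bound:
  assumes W: "unitary N W" and a: "\<And>i. i < N \<Longrightarrow> \<bar>a i\<bar> \<le> x" and x: "0 < x" "x \<le> 1"
    and \<sigma>: "density N \<sigma>" and T: "density N T" and E: "E \<in> carrier_mat N N"
  defines "A \<equiv> W * mdiag N (\<lambda>i. of_real (a i)) * adj W"
  defines "U \<equiv> W * mdiag N (\<lambda>i. exp (- (\<i> * of_real (a i)))) * adj W"
  assumes Ei: "\<And>i j. i < N \<Longrightarrow> j < N \<Longrightarrow> E $$ (i, j) = of_real ((cos x)\<^sup>2) * \<sigma> $$ (i, j) + of_real ((sin x)\<^sup>2) * T $$ (i, j)
    - \<i> * of_real (sin x * cos x / x) * ((A * \<sigma>) $$ (i, j) - (\<sigma> * A) $$ (i, j))"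
  shows "trace_bound N (U * \<sigma> * adj U - E) (8 * x\<^sup>2)"
proof -
  have Wc: "W \<in> carrier_mat N N" using W by (rule unitary_carrier)
  have s: "psd \<sigma>" "\<sigma> \<in> carrier_mat N N" "mtrace \<sigma> = 1" using \<sigma> by (auto simp: density_def)
  have t: "psd T" "T \<in> carrier_mat N N" "mtrace T = 1" using T by (auto simp: density_def)
  define R where "R = W * mdiag N (\<lambda>i. exp (- (\<i> * of_real (a i))) - 1 + \<i> * of_real (a i)) * adj W"
  define A' where "A' = W * mdiag N (\<lambda>i. - (\<i> * of_real (a i))) * adj W"
  define \<zeta> where "\<zeta> = sin x * cos x / x"
  let ?I = "1\<^sub>m N :: complex mat"
  have Ac: "A \<in> carrier_mat N N" and Uc: "U \<in> carrier_mat N N" and Rc: "R \<in> carrier_mat N N"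
    and A'c: "A' \<in> carrier_mat N N" and Ic: "?I \<in> carrier_mat N N"
    using Wc by (auto simp: A_def U_def R_def A'_def)
  have Uu: "unitary N U" unfolding U_def using W by (rule unitary_exp)
  have A'A: "A' = (- \<i>) \<cdot>\<^sub>m A"
    by (rule eq_matI) (use Wc in \<open>auto simp: A'_def A_def unitary_conj_index[of _ N N] sum_distrib_left mult_ac\<close>)
  have Ah: "adj A = A" unfolding A_def using Wc by (simp add: adj_unitary_conj_mdiag)
  have Ue: "U = ?I + A' + R"
  proof (rule eq_matI)
    fix i j assume "i < dim_row (?I + A' + R)" "j < dim_col (?I + A' + R)"
    then have ij: "i < N" "j < N" using Rc by auto
    have "?I = W * mdiag N (\<lambda>i. 1) * adj W" using unitary_conj_mdiag_one[OF W] by simp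
    then have "(?I + A' + R) $$ (i, j) = (W * mdiag N (\<lambda>i. 1) * adj W) $$ (i, j) + A' $$ (i, j) + R $$ (i, j)"
      using ij A'c Rc Wc by simp
    also have "\<dots> = U $$ (i, j)"
      unfolding A'_def R_def U_def unitary_conj_index[OF Wc ij] sum.distrib[symmetric]
      by (intro sum.cong refl) (simp add: algebra_simps)
    finally show "U $$ (i, j) = (?I + A' + R) $$ (i, j)" ..
  qed (use Uc Rc in auto)
  have tr: "Re (mtrace (A' * \<sigma> * adj A')) \<le> x\<^sup>2" "Re (mtrace (A * \<sigma> * adj A)) \<le> x\<^sup>2"
    "Re (mtrace (R * \<sigma> * adj R)) \<le> (x\<^sup>2)\<^sup>2"
  proof -
    show "Re (mtrace (A' * \<sigma> * adj A')) \<le> x\<^sup>2"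
      using mtrace_conj_mdiag_le[OF W s(1,2), of "\<lambda>i. - (\<i> * of_real (a i))" x] a s by (simp add: A'_def norm_mult)
    show "Re (mtrace (A * \<sigma> * adj A)) \<le> x\<^sup>2"
      using mtrace_conj_mdiag_le[OF W s(1,2), of "\<lambda>i. of_real (a i)" x] a s by (simp add: A_def)
    have "cmod (exp (- (\<i> * of_real (a i))) - 1 + \<i> * of_real (a i)) \<le> x\<^sup>2" if "i < N" for i
    proof -
      have "(a i)\<^sup>2 \<le> x\<^sup>2" using a[OF that] by (simp add: abs_le_square_iff[symmetric])
      then show ?thesis using norm_exp_minus_linear_le[of "a i"] by linarith
    qed
    then show "Re (mtrace (R * \<sigma> * adj R)) \<le> (x\<^sup>2)\<^sup>2"
      using mtrace_conj_mdiag_le[OF W s(1,2), of "\<lambda>i. exp (- (\<i> * of_real (a i))) - 1 + \<i> * of_real (a i)" "x\<^sup>2"] s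
      by (simp add: R_def)
  qed
  have tI: "Re (mtrace (?I * \<sigma> * adj ?I)) \<le> 1\<^sup>2" using s by simp
  have tU: "Re (mtrace (U * \<sigma> * adj U)) \<le> 1\<^sup>2" using s Uu by (simp add: mtrace_unitary_conj)
  define D1 where "D1 = of_real ((sin x)\<^sup>2) \<cdot>\<^sub>m \<sigma>"
  define D2 where "D2 = - (of_real ((sin x)\<^sup>2) \<cdot>\<^sub>m T)"
  define D3 where "D3 = of_real (1 - \<zeta>) \<cdot>\<^sub>m (A' * \<sigma> * adj ?I + ?I * \<sigma> * adj A')"
  define D4 where "D4 = A * \<sigma> * adj A"
  \<comment> \<open>Pairing R with all of U counts the R-R term twice, which \<open>D6\<close>
    corrects; in return U is unitary, so its trace in the cross bound is exactly 1.\<close>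
  define D5 where "D5 = R * \<sigma> * adj U + U * \<sigma> * adj R"
  define D6 where "D6 = - (R * \<sigma> * adj R)"
  have sin2: "(sin x)\<^sup>2 \<le> x\<^sup>2" using abs_sin_x_le_abs_x[of x] by (simp only: abs_le_square_iff)
  have b1: "trace_bound N D1 (x\<^sup>2)"
    unfolding D1_def using trace_bound_smult[OF trace_bound_psd[OF s(1,2)], of "(sin x)\<^sup>2"] s sin2
    by (auto elim: trace_bound_mono)
  have b2: "trace_bound N D2 (x\<^sup>2)"
    unfolding D2_def using trace_bound_uminus[OF trace_bound_smult[OF trace_bound_psd[OF t(1,2)], of "(sin x)\<^sup>2"]] t sin2
    by (auto elim: trace_bound_mono)
  \<comment> \<open>Two factors of order x: the mismatch of the coefficients, at most x, and the
    commutator, at most 2 x.\<close>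
  have b3: "trace_bound N D3 (2 * x\<^sup>2)"
  proof -
    have "trace_bound N D3 (\<bar>1 - \<zeta>\<bar> * (2 * x * 1))"
      unfolding D3_def using trace_bound_cross_scaled[OF s(1,2) A'c Ic x(1) tr(1) _ tI] by (intro trace_bound_smult) simp
    moreover have "\<bar>1 - \<zeta>\<bar> * (2 * x * 1) \<le> x * (2 * x * 1)"
      using abs_one_minus_sin_cos_le[OF x(1)] x by (intro mult_right_mono) (auto simp: \<zeta>_def)
    ultimately show ?thesis by (auto elim!: trace_bound_mono simp: power2_eq_square)
  qed
  have b4: "trace_bound N D4 (x\<^sup>2)"
    unfolding D4_def using trace_bound_psd[OF psd_conj[OF s(1,2) Ac] conj_carrier[OF Ac s(2)]] tr(2) by (rule trace_bound_mono)
  have b5: "trace_bound N D5 (2 * x\<^sup>2)"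
    unfolding D5_def using trace_bound_cross_scaled[OF s(1,2) Rc Uc _ tr(3) _ tU] x by simp
  have b6: "trace_bound N D6 (x\<^sup>2)"
  proof -
    \<comment> \<open>The fourth-order bound is coarsened to second order using x \<le> 1.\<close>
    have "(x\<^sup>2)\<^sup>2 \<le> x\<^sup>2" using x by (simp add: power2_eq_square mult_le_one mult_left_le)
    then have "Re (mtrace (R * \<sigma> * adj R)) \<le> x\<^sup>2" using tr(3) by linarith
    then show ?thesis
      unfolding D6_def using trace_bound_psd[OF psd_conj[OF s(1,2) Rc] conj_carrier[OF Rc s(2)]]
      by (intro trace_bound_uminus) (rule trace_bound_mono)
  qed
  have "U * \<sigma> * adj U - E = D1 + D2 + D3 + D4 + D5 + D6"
  proof (rule eq_matI)
    note dc = b1[THEN trace_bound_carrier] b2[THEN trace_bound_carrier] b3[THEN trace_bound_carrier]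
      b4[THEN trace_bound_carrier] b5[THEN trace_bound_carrier] b6[THEN trace_bound_carrier]
    show "dim_row (U * \<sigma> * adj U - E) = dim_row (D1 + D2 + D3 + D4 + D5 + D6)"
      "dim_col (U * \<sigma> * adj U - E) = dim_col (D1 + D2 + D3 + D4 + D5 + D6)" using dc E by auto
    fix i j assume "i < dim_row (D1 + D2 + D3 + D4 + D5 + D6)" "j < dim_col (D1 + D2 + D3 + D4 + D5 + D6)"
    then have ij: "i < N" "j < N" using dc by auto
    \<comment> \<open>With i and j fixed, this is a sesquilinear form in the two operators; the
      matrix identity becomes a ring identity in its values on 1, A, R and U.\<close>
    define S where "S P Q = (P * \<sigma> * adj Q) $$ (i, j)" for P Q
    have Sadd: "S (P + P') Q = S P Q + S P' Q" "S Q (P + P') = S Q P + S Q P'"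
      if "P \<in> carrier_mat N N" "P' \<in> carrier_mat N N" "Q \<in> carrier_mat N N" for P P' Q
      using that s ij by (auto simp: S_def sandwich_linear[of _ N])
    have Ssm: "S (c \<cdot>\<^sub>m P) Q = c * S P Q" "S Q (c \<cdot>\<^sub>m P) = cnj c * S Q P"
      if "P \<in> carrier_mat N N" "Q \<in> carrier_mat N N" for c P Q
      using that s ij by (auto simp: S_def sandwich_linear[of _ N])
    have e1: "\<sigma> $$ (i, j) = S ?I ?I" "(A * \<sigma>) $$ (i, j) = S A ?I" "(\<sigma> * A) $$ (i, j) = S ?I A"
      using s Ac by (simp_all add: S_def Ah right_mult_one_mat[of _ N N])
    have Dsum: "(D1 + D2 + D3 + D4 + D5 + D6) $$ (i, j) =
      D1 $$ (i, j) + D2 $$ (i, j) + D3 $$ (i, j) + D4 $$ (i, j) + D5 $$ (i, j) + D6 $$ (i, j)"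
      using dc ij by simp
    have Di: "D1 $$ (i, j) = of_real ((sin x)\<^sup>2) * S ?I ?I" "D2 $$ (i, j) = - (of_real ((sin x)\<^sup>2) * T $$ (i, j))"
      "D3 $$ (i, j) = of_real (1 - \<zeta>) * (S A' ?I + S ?I A')" "D4 $$ (i, j) = S A A"
      "D5 $$ (i, j) = S R U + S U R" "D6 $$ (i, j) = - S R R"
      using s t Ac A'c Uc Rc ij by (simp_all add: D1_def D2_def D3_def D4_def D5_def D6_def e1(1)[symmetric])
        (simp_all add: S_def)
    have Uij: "(U * \<sigma> * adj U - E) $$ (i, j) = S U U - E $$ (i, j)" using ij E Uc s by (simp add: S_def)
    have "(cos x)\<^sup>2 = 1 - (sin x)\<^sup>2" by (simp add: cos_squared_eq)
    then have Eij: "E $$ (i, j) = (1 - of_real ((sin x)\<^sup>2)) * S ?I ?I + of_real ((sin x)\<^sup>2) * T $$ (i, j)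
      - \<i> * of_real \<zeta> * (S A ?I - S ?I A)"
      unfolding Ei[OF ij] e1 \<zeta>_def by simp
    have IA: "?I + A' \<in> carrier_mat N N" using A'c by simp
    have f1: "S U U = S ?I ?I - \<i> * S A ?I + \<i> * S ?I A + S A A + (S ?I R - \<i> * S A R) + (S R ?I + \<i> * S R A) + S R R"
      using Ic A'c Ac Rc IA by (simp add: Ue Sadd) (simp add: A'A Ssm algebra_simps)
    have f2: "S R U = S R ?I + \<i> * S R A + S R R"
      using Ic A'c Ac Rc IA by (simp add: Ue Sadd) (simp add: A'A Ssm algebra_simps)
    have f3: "S U R = S ?I R - \<i> * S A R + S R R"
      using Ic A'c Ac Rc IA by (simp add: Ue Sadd) (simp add: A'A Ssm algebra_simps)
    have f4: "S A' ?I + S ?I A' = - \<i> * S A ?I + \<i> * S ?I A"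
      using Ic Ac by (simp add: A'A Ssm)
    show "(U * \<sigma> * adj U - E) $$ (i, j) = (D1 + D2 + D3 + D4 + D5 + D6) $$ (i, j)"
      unfolding Uij Eij Dsum Di f1 f2 f3 f4 by (simp add: algebra_simps)
  qed
  moreover have "trace_bound N (D1 + D2 + D3 + D4 + D5 + D6) (x\<^sup>2 + x\<^sup>2 + 2 * x\<^sup>2 + x\<^sup>2 + 2 * x\<^sup>2 + x\<^sup>2)"
    by (intro trace_bound_add b1 b2 b3 b4 b5 b6)
  ultimately show ?thesis by simp
qed

text \<open>Telescoping: the error after m + 1 rounds is the earlier error conjugated by the unitary
  \<open>U 1\<close>, which does not enlarge it, plus one fresh error at the current state. The
  hypothesis on one round therefore has to hold at every density matrix.\<close>

lemma iterated_trace_bound: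
  fixes a :: "nat \<Rightarrow> real"
  assumes W: "unitary N W" and \<sigma>: "density N \<sigma>"
    and d: "\<And>\<tau>. density N \<tau> \<Longrightarrow> density N (F \<tau>)"
  defines "U \<equiv> \<lambda>m. W * mdiag N (\<lambda>i. exp (- (\<i> * of_real (real m * a i)))) * adj W"
  assumes step: "\<And>\<tau>. density N \<tau> \<Longrightarrow> trace_bound N (U 1 * \<tau> * adj (U 1) - F \<tau>) e"
  shows "trace_bound N (U m * \<sigma> * adj (U m) - (F ^^ m) \<sigma>) (real m * e)"
proof (induction m)
  case 0
  have "U 0 = 1\<^sub>m N" unfolding U_def by (rule unitary_conj_mdiag_one[OF W]) simp
  then have "U 0 * \<sigma> * adj (U 0) - (F ^^ 0) \<sigma> = 0\<^sub>m N N - 0\<^sub>m N N" using \<sigma> by (auto simp: density_def)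
  then show ?case
    by (intro trace_boundI[of "0\<^sub>m N N" N "0\<^sub>m N N"]) (auto simp: psd_zero mtrace_def)
next
  case (Suc m)
  have Wc: "W \<in> carrier_mat N N" using W by (rule unitary_carrier)
  have Uc: "U k \<in> carrier_mat N N" for k using Wc by (simp add: U_def)
  have \<sigma>c: "\<sigma> \<in> carrier_mat N N" using \<sigma> by (simp add: density_def)
  define \<tau> where "\<tau> = (F ^^ m) \<sigma>"
  have \<tau>: "density N \<tau>" unfolding \<tau>_def by (induction m) (auto simp: \<sigma> d)
  then have \<tau>c: "\<tau> \<in> carrier_mat N N" "F \<tau> \<in> carrier_mat N N" using d[OF \<tau>] by (auto simp: density_def)
  have US: "U (Suc m) = U 1 * U m"
    unfolding U_def unitary_conj_mdiag_mult[OF W] by (simp add: algebra_simps flip: exp_add)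
  have U1: "unitary N (U 1)" unfolding U_def using W by (rule unitary_exp)
  \<comment> \<open>The intermediate term \<open>U 1 * \<tau> * adj (U 1)\<close>, with \<tau> the
    state actually reached after m rounds, is inserted.\<close>
  have "trace_bound N (U 1 * (U m * \<sigma> * adj (U m) - \<tau>) * adj (U 1) + (U 1 * \<tau> * adj (U 1) - F \<tau>)) (real m * e + e)"
    using Suc.IH[folded \<tau>_def] U1 step[OF \<tau>] by (intro trace_bound_add trace_bound_unitary)
  moreover have "U 1 * (U m * \<sigma> * adj (U m) - \<tau>) * adj (U 1) + (U 1 * \<tau> * adj (U 1) - F \<tau>) =
    U (Suc m) * \<sigma> * adj (U (Suc m)) - F \<tau>"
  proof -
    have "U 1 * (U m * \<sigma> * adj (U m) - \<tau>) * adj (U 1) =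
      U (Suc m) * \<sigma> * adj (U (Suc m)) - U 1 * \<tau> * adj (U 1)"
      using Uc \<sigma>c \<tau>c unfolding US
      by (simp add: mult_minus_distrib_mat[of _ N N _ N] minus_mult_distrib_mat[of _ N N _ _ N] adj_mult[of _ N N _ N] assoc_mult_mat[of _ N N _ N _ N])
    moreover have "U 1 * \<tau> * adj (U 1) \<in> carrier_mat N N" "U (Suc m) * \<sigma> * adj (U (Suc m)) \<in> carrier_mat N N"
      using Uc \<sigma>c \<tau>c by auto
    ultimately show ?thesis using \<tau>c by (intro eq_matI) auto
  qed
  ultimately show ?case by (simp add: \<tau>_def algebra_simps)
qed

section \<open>The Hamiltonian and its spectrum\<close>

lemma ham_carrier [simp]: "ham dA K c \<rho> \<in> carrier_mat dA dA"
  by (simp add: ham_def)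

lemma ham_hermitian:
  assumes "\<And>j. j < K \<Longrightarrow> density dA (\<rho> j)"
  shows "adj (ham dA K c \<rho>) = ham dA K c \<rho>"
proof (rule eq_matI)
  fix i k assume "i < dim_row (ham dA K c \<rho>)" "k < dim_col (ham dA K c \<rho>)"
  then have ik: "i < dA" "k < dA" by (auto simp: ham_def)
  have "cnj (\<rho> j $$ (k, i)) = \<rho> j $$ (i, k)" if "j < K" for j
    using psd_hermitian[of "\<rho> j" dA] adj_index[of "\<rho> j" dA dA i k] assms[OF that] ik by (simp add: density_def)
  then show "adj (ham dA K c \<rho>) $$ (i, k) = ham dA K c \<rho> $$ (i, k)"
    using ik by (subst adj_index[OF ham_carrier]) (auto simp: ham_def cnj_sum)
qed (auto simp: ham_def)

lemma kron_ham_mult_index: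
  assumes "\<And>j. j < K \<Longrightarrow> \<rho> j \<in> carrier_mat dA dA" "X \<in> carrier_mat (dA * dB) (dA * dB)" "i < dA * dB" "k < dA * dB"
  shows "(kron (ham dA K c \<rho>) (1\<^sub>m dB) * X) $$ (i, k) = (\<Sum>j<K. of_real (c j) * (kron (\<rho> j) (1\<^sub>m dB) * X) $$ (i, k))"
    "(X * kron (ham dA K c \<rho>) (1\<^sub>m dB)) $$ (i, k) = (\<Sum>j<K. of_real (c j) * (X * kron (\<rho> j) (1\<^sub>m dB)) $$ (i, k))"
proof -
  note d = div_mod_less[OF assms(3)] div_mod_less[OF assms(4)]
  have "(kron (ham dA K c \<rho>) (1\<^sub>m dB) * X) $$ (i, k) = (\<Sum>a<dA. \<Sum>j<K. of_real (c j) * (\<rho> j $$ (i div dB, a) * X $$ (a * dB + i mod dB, k)))"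
    using d by (subst kron_one_mult_index[OF assms(2) ham_carrier assms(3,4)])
      (auto simp: ham_def sum_distrib_right mult.assoc)
  also have "\<dots> = (\<Sum>j<K. \<Sum>a<dA. of_real (c j) * (\<rho> j $$ (i div dB, a) * X $$ (a * dB + i mod dB, k)))"
    by (rule sum.swap)
  also have "\<dots> = (\<Sum>j<K. of_real (c j) * (kron (\<rho> j) (1\<^sub>m dB) * X) $$ (i, k))"
    by (intro sum.cong refl) (simp add: kron_one_mult_index[OF assms(2) assms(1) assms(3,4)] sum_distrib_left)
  finally show "(kron (ham dA K c \<rho>) (1\<^sub>m dB) * X) $$ (i, k) = (\<Sum>j<K. of_real (c j) * (kron (\<rho> j) (1\<^sub>m dB) * X) $$ (i, k))" .
  have "(X * kron (ham dA K c \<rho>) (1\<^sub>m dB)) $$ (i, k) = (\<Sum>a<dA. \<Sum>j<K. of_real (c j) * (X $$ (i, a * dB + k mod dB) * \<rho> j $$ (a, k div dB)))"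
    using d by (subst mult_kron_one_index[OF assms(2) ham_carrier assms(3,4)])
      (auto simp: ham_def sum_distrib_left mult.left_commute)
  also have "\<dots> = (\<Sum>j<K. \<Sum>a<dA. of_real (c j) * (X $$ (i, a * dB + k mod dB) * \<rho> j $$ (a, k div dB)))"
    by (rule sum.swap)
  also have "\<dots> = (\<Sum>j<K. of_real (c j) * (X * kron (\<rho> j) (1\<^sub>m dB)) $$ (i, k))"
    by (intro sum.cong refl) (simp add: mult_kron_one_index[OF assms(2) assms(1) assms(3,4)] sum_distrib_left)
  finally show "(X * kron (ham dA K c \<rho>) (1\<^sub>m dB)) $$ (i, k) = (\<Sum>j<K. of_real (c j) * (X * kron (\<rho> j) (1\<^sub>m dB)) $$ (i, k))" .
qed

text \<open>An eigenvalue is a diagonal entry of H in its eigenbasis, hence the combination with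
  coefficients \<open>c j\<close> of diagonal entries of states. Those lie between 0 and 1, so its
  modulus is at most the sum of the \<open>|c j|\<close>.\<close>

lemma ham_spectral:
  assumes \<rho>: "\<And>j. j < K \<Longrightarrow> density dA (\<rho> j)"
  obtains V and l :: "nat \<Rightarrow> real" where "unitary dA V" "ham dA K c \<rho> = V * mdiag dA (\<lambda>i. of_real (l i)) * adj V"
    "\<And>i. i < dA \<Longrightarrow> \<bar>l i\<bar> \<le> (\<Sum>j<K. \<bar>c j\<bar>)"
proof -
  obtain V and l :: "nat \<Rightarrow> real" where V: "unitary dA V" and H: "ham dA K c \<rho> = V * mdiag dA (\<lambda>i. of_real (l i)) * adj V"
    using hermitian_spectral[OF ham_carrier ham_hermitian[of K dA \<rho> c, OF \<rho>]] by auto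
  have Vc: "V \<in> carrier_mat dA dA" using V by (rule unitary_carrier)
  have "\<bar>l i\<bar> \<le> (\<Sum>j<K. \<bar>c j\<bar>)" if i: "i < dA" for i
  proof -
    let ?q = "\<lambda>X. adj V * X * adj (adj V)"
    have "?q (ham dA K c \<rho>) = mdiag dA (\<lambda>i. of_real (l i))"
      using V Vc by (simp add: H assoc_mult_mat[of _ dA dA _ dA _ dA]) (simp add: unitary_def)
    then have "complex_of_real (l i) = ?q (ham dA K c \<rho>) $$ (i, i)" using i by (simp add: mdiag_def)
    also have "\<dots> = (\<Sum>k<dA. \<Sum>m<dA. \<Sum>j<K. of_real (c j) * (adj V $$ (i, k) * \<rho> j $$ (k, m) * cnj (adj V $$ (i, m))))"
      unfolding conj_index[OF adj_carrier[OF Vc] ham_carrier i i]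
      by (intro sum.cong refl) (auto simp: ham_def sum_distrib_left sum_distrib_right intro!: sum.cong)
    also have "\<dots> = (\<Sum>k<dA. \<Sum>j<K. \<Sum>m<dA. of_real (c j) * (adj V $$ (i, k) * \<rho> j $$ (k, m) * cnj (adj V $$ (i, m))))"
      by (intro sum.cong refl sum.swap)
    also have "\<dots> = (\<Sum>j<K. \<Sum>k<dA. \<Sum>m<dA. of_real (c j) * (adj V $$ (i, k) * \<rho> j $$ (k, m) * cnj (adj V $$ (i, m))))"
      by (rule sum.swap)
    also have "\<dots> = (\<Sum>j<K. of_real (c j) * ?q (\<rho> j) $$ (i, i))"
      using \<rho> i Vc by (intro sum.cong refl) (subst conj_index[of _ dA dA], auto simp: density_def sum_distrib_left)
    finally have "cmod (of_real (l i)) \<le> (\<Sum>j<K. cmod (of_real (c j) * ?q (\<rho> j) $$ (i, i)))"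
      by (simp only: norm_sum)
    also have "\<dots> \<le> (\<Sum>j<K. \<bar>c j\<bar>)"
    proof (rule sum_mono)
      fix j assume "j \<in> {..<K}"
      then have r: "psd (\<rho> j)" "\<rho> j \<in> carrier_mat dA dA" "mtrace (\<rho> j) = 1" using \<rho> by (auto simp: density_def)
      have nn: "\<exists>r\<ge>0. ?q (\<rho> j) $$ (k, k) = of_real r" if "k < dA" for k
        using psd_conj_diag[OF r(1,2), of "adj V" dA k] Vc that by auto
      \<comment> \<open>A diagonal entry of a state is at most the trace, since the other diagonal
        entries are nonnegative.\<close>
      have "Re (?q (\<rho> j) $$ (i, i)) \<le> (\<Sum>k<dA. Re (?q (\<rho> j) $$ (k, k)))"
      proof (rule member_le_sum)
        show "0 \<le> Re (?q (\<rho> j) $$ (k, k))" if "k \<in> {..<dA} - {i}" for k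
          using nn[of k] that by (metis DiffD1 Re_complex_of_real lessThan_iff)
      qed (use i in auto)
      also have "\<dots> = Re (mtrace (?q (\<rho> j)))"
        using r Vc by (simp add: mtrace_carrier[of _ dA])
      also have "\<dots> = 1" using V r by (simp add: mtrace_unitary_conj)
      finally have "cmod (?q (\<rho> j) $$ (i, i)) \<le> 1" using nn[OF i] by auto
      then show "cmod (of_real (c j) * ?q (\<rho> j) $$ (i, i)) \<le> \<bar>c j\<bar>"
        by (simp add: norm_mult mult_left_le)
    qed
    finally show ?thesis by simp
  qed
  with V H that show ?thesis by blast
qed

lemma smult_unitary_conj_mdiag:
  assumes "V \<in> carrier_mat n n"
  shows "c \<cdot>\<^sub>m (V * mdiag n f * adj V) = V * mdiag n (\<lambda>i. c * f i) * adj V"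
  by (rule eq_matI) (use assms in \<open>auto simp: unitary_conj_index[of _ n n] sum_distrib_left mult_ac\<close>)

section \<open>The simulation protocol\<close>

text \<open>Unlike \<open>sgn\<close> it is 1 at zero, so its square is always 1 and every index
  yields a unitary rotation.\<close>

definition swap_sign :: "(nat \<Rightarrow> real) \<Rightarrow> real \<Rightarrow> nat \<Rightarrow> real" where
  "swap_sign c t j = (if c j * t \<ge> 0 then 1 else - 1)"

lemma swap_sign_simps:
  "(swap_sign c t j)\<^sup>2 = 1" "\<bar>c j\<bar> * swap_sign c t j * \<bar>t\<bar> = c j * t"
  by (auto simp: swap_sign_def abs_if not_le zero_le_mult_iff)

lemma swap_rotation_is_channel:
  fixes x s :: real
  assumes "s\<^sup>2 = 1"
  shows "is_channel (dA * dB * dA) (dA * dB) (swap_channel dA dB (of_real (cos x)) (- \<i> * of_real (s * sin x)))"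
  by (rule swap_channel_is_channel) (use assms in \<open>auto simp: norm_mult power_mult_distrib power2_abs\<close>)

text \<open>Instance of the one-round estimate with A = (t / n) H tensor 1. The full-swap parts of
  the rounds average to the state T, and the signed weights make the average of the commutators with
  the \<open>\<rho> j\<close> equal to the commutator with A, divided by x.\<close>

lemma avg_step_trace_bound:
  fixes c :: "nat \<Rightarrow> real" and t :: real and n :: nat
  assumes \<rho>: "\<And>j. j < K \<Longrightarrow> density dA (\<rho> j)" and n: "n > 0"
  defines "ctot \<equiv> (\<Sum>j<K. \<bar>c j\<bar>)"
  defines "x \<equiv> ctot * \<bar>t\<bar> / real n"
  assumes x: "0 < x" "x \<le> 1"
    and V: "unitary dA V" and H: "ham dA K c \<rho> = V * mdiag dA (\<lambda>i. of_real (l i)) * adj V"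
    and l: "\<And>i. i < dA \<Longrightarrow> \<bar>l i\<bar> \<le> ctot" and \<tau>: "density (dA * dB) \<tau>"
  defines "W \<equiv> kron V (1\<^sub>m dB)"
  defines "U \<equiv> W * mdiag (dA * dB) (\<lambda>i. exp (- (\<i> * of_real (t / real n * l (i div dB))))) * adj W"
  shows "trace_bound (dA * dB) (U * \<tau> * adj U - avg_step dA dB K (\<lambda>j. \<bar>c j\<bar> / ctot) (of_real (cos x))
    (\<lambda>j. - \<i> * of_real (swap_sign c t j * sin x)) \<rho> \<tau>) (8 * x\<^sup>2)"
  unfolding U_def
proof (rule one_step_trace_bound)
  let ?N = "dA * dB"
  let ?w = "\<lambda>j. \<bar>c j\<bar> / ctot" and ?s = "swap_sign c t"
  let ?T = "\<lambda>j. apply_channel ?N (swap_channel dA dB 0 1) (kron \<tau> (\<rho> j))"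
  \<comment> \<open>A convex combination of full-swap outputs, hence again a state.\<close>
  define T where "T = wsum ?N {..<K} (\<lambda>j. of_real (?w j)) ?T"
  have ct: "ctot > 0" and t: "t \<noteq> 0"
  proof -
    have "ctot \<ge> 0" unfolding ctot_def by (rule sum_nonneg) simp
    then show "ctot > 0" "t \<noteq> 0" using x(1) by (auto simp: x_def zero_less_mult_iff zero_less_divide_iff)
  qed
  have w: "(\<Sum>j<K. ?w j) = 1" using ct by (simp add: ctot_def flip: sum_divide_distrib)
  have Vc: "V \<in> carrier_mat dA dA" using V by (rule unitary_carrier)
  have \<tau>c: "\<tau> \<in> carrier_mat ?N ?N" using \<tau> by (simp add: density_def)
  have \<rho>c: "\<rho> j \<in> carrier_mat dA dA" "mtrace (\<rho> j) = 1" if "j < K" for j using \<rho>[OF that] by (auto simp: density_def)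
  show "unitary ?N W" unfolding W_def using V unitary_one by (rule unitary_kron)
  show "0 < x" "x \<le> 1" by fact+
  show "density ?N \<tau>" by fact
  show "density ?N T"
    unfolding T_def
  proof (rule density_wsum)
    fix j assume "j \<in> {..<K}"
    then show "density ?N (?T j)"
      using \<rho> \<tau> by (intro density_apply_channel[of "?N * dA"] density_kron swap_channel_is_channel) auto
  qed (use ct w in auto)
  show "avg_step dA dB K ?w (of_real (cos x)) (\<lambda>j. - \<i> * of_real (?s j * sin x)) \<rho> \<tau> \<in> carrier_mat ?N ?N"
    by (simp add: avg_step_def)
  show "\<bar>t / real n * l (i div dB)\<bar> \<le> x" if "i < ?N" for i
  proof -
    have "\<bar>t / real n\<bar> * \<bar>l (i div dB)\<bar> \<le> \<bar>t / real n\<bar> * ctot"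
      using l[OF div_mod_less(1)[OF that]] by (intro mult_left_mono) auto
    then show ?thesis using n by (simp add: x_def abs_mult mult_ac)
  qed
  let ?A = "W * mdiag ?N (\<lambda>i. of_real (t / real n * l (i div dB))) * adj W"
  have A: "?A = of_real (t / real n) \<cdot>\<^sub>m kron (ham dA K c \<rho>) (1\<^sub>m dB)"
    unfolding H kron_unitary_conj_mdiag[OF Vc] W_def
    using Vc by (subst smult_unitary_conj_mdiag) auto
  fix i k assume ik: "i < ?N" "k < ?N"
  let ?P = "\<lambda>j. (kron (\<rho> j) (1\<^sub>m dB) * \<tau>) $$ (i, k)" and ?Q = "\<lambda>j. (\<tau> * kron (\<rho> j) (1\<^sub>m dB)) $$ (i, k)"
  have Hc: "kron (ham dA K c \<rho>) (1\<^sub>m dB) \<in> carrier_mat ?N ?N" by (intro kron_carrier) auto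
  have AP: "(?A * \<tau>) $$ (i, k) = of_real (t / real n) * (\<Sum>j<K. of_real (c j) * ?P j)"
    unfolding A using \<rho>c \<tau>c Hc ik
    by (subst mult_smult_assoc_mat[OF Hc \<tau>c], subst index_smult_mat(1)) (simp_all add: kron_ham_mult_index carrier_matD[OF \<tau>c] carrier_matD[OF ham_carrier])
  have AQ: "(\<tau> * ?A) $$ (i, k) = of_real (t / real n) * (\<Sum>j<K. of_real (c j) * ?Q j)"
    unfolding A using \<rho>c \<tau>c Hc ik
    by (subst mult_smult_distrib[OF \<tau>c Hc], subst index_smult_mat(1)) (simp_all add: kron_ham_mult_index carrier_matD[OF \<tau>c] carrier_matD[OF ham_carrier])
  \<comment> \<open>This identity dictates the probabilities, the signs and the angle: probability
    times sign is the coefficient of \<open>\<rho> j\<close> in (t / n) H, divided by x.\<close>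
  have coef: "?w j * ?s j = t / real n / x * c j" for j
  proof -
    have "?w j * ?s j = (\<bar>c j\<bar> * ?s j * \<bar>t\<bar>) / (ctot * \<bar>t\<bar>)" using t by simp
    also have "\<dots> = c j * t / (ctot * \<bar>t\<bar>)" by (simp only: swap_sign_simps)
    also have "\<dots> = t / real n / x * c j" using n by (simp add: x_def)
    finally show ?thesis .
  qed
  have "avg_step dA dB K ?w (of_real (cos x)) (\<lambda>j. - \<i> * of_real (?s j * sin x)) \<rho> \<tau> $$ (i, k) =
    (\<Sum>j<K. of_real (?w j) * (of_real ((cos x)\<^sup>2) * \<tau> $$ (i, k) - \<i> * of_real (?s j * sin x * cos x) * (?P j - ?Q j)
       + of_real ((sin x)\<^sup>2) * ?T j $$ (i, k)))"
    unfolding avg_step_def wsum_index[OF ik]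
  proof (intro sum.cong refl arg_cong2[of _ _ _ _ "(*)"])
    fix j assume "j \<in> {..<K}"
    then have j: "j < K" by simp
    have s2: "complex_of_real (?s j) * of_real (?s j) = 1"
      by (simp add: swap_sign_def)
    show "apply_channel ?N (swap_channel dA dB (of_real (cos x)) (- \<i> * of_real (?s j * sin x))) (kron \<tau> (\<rho> j)) $$ (i, k) =
      of_real ((cos x)\<^sup>2) * \<tau> $$ (i, k) - \<i> * of_real (?s j * sin x * cos x) * (?P j - ?Q j) + of_real ((sin x)\<^sup>2) * ?T j $$ (i, k)"
    proof -
      have b: "- \<i> * complex_of_real (?s j * sin x) * cnj (- \<i> * of_real (?s j * sin x)) = of_real ((sin x)\<^sup>2)"
      proof -
        have "- \<i> * complex_of_real (?s j * sin x) * cnj (- \<i> * of_real (?s j * sin x)) =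
          (complex_of_real (?s j) * of_real (?s j)) * of_real ((sin x)\<^sup>2)"
          by (simp add: power2_eq_square algebra_simps)
        then show ?thesis unfolding s2 by simp
      qed
      show ?thesis
        unfolding apply_swap_channel_commutator[OF \<tau>c \<rho>c[OF j] ik, where \<alpha> = "of_real (cos x)" and \<beta> = "- \<i> * of_real (?s j * sin x)"] b
        by (simp add: power2_eq_square algebra_simps)
    qed
  qed
  also have "\<dots> = (\<Sum>j<K. of_real (?w j)) * (of_real ((cos x)\<^sup>2) * \<tau> $$ (i, k))
    + of_real ((sin x)\<^sup>2) * (\<Sum>j<K. of_real (?w j) * ?T j $$ (i, k))
    - \<i> * of_real (sin x * cos x) * ((\<Sum>j<K. of_real (?w j * ?s j) * ?P j) - (\<Sum>j<K. of_real (?w j * ?s j) * ?Q j))"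
    unfolding sum_distrib_left sum_distrib_right sum_subtractf[symmetric] sum.distrib[symmetric]
    by (intro sum.cong refl) (simp add: algebra_simps)
  also have "(\<Sum>j<K. complex_of_real (?w j)) = 1" unfolding of_real_sum[symmetric] w by simp
  also have "(\<Sum>j<K. of_real (?w j) * ?T j $$ (i, k)) = T $$ (i, k)" using ik by (simp add: T_def wsum_index)
  also have "(\<Sum>j<K. of_real (?w j * ?s j) * ?P j) = (?A * \<tau>) $$ (i, k) / of_real x"
    unfolding coef AP by (simp add: sum_distrib_left sum_divide_distrib mult_ac)
  also have "(\<Sum>j<K. of_real (?w j * ?s j) * ?Q j) = (\<tau> * ?A) $$ (i, k) / of_real x"
    unfolding coef AQ by (simp add: sum_distrib_left sum_divide_distrib mult_ac)
  finally show "avg_step dA dB K ?w (of_real (cos x)) (\<lambda>j. - \<i> * of_real (?s j * sin x)) \<rho> \<tau> $$ (i, k) =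
    of_real ((cos x)\<^sup>2) * \<tau> $$ (i, k) + of_real ((sin x)\<^sup>2) * T $$ (i, k)
    - \<i> * of_real (sin x * cos x / x) * ((?A * \<tau>) $$ (i, k) - (\<tau> * ?A) $$ (i, k))"
    by (simp add: diff_divide_distrib right_diff_distrib)
qed

text \<open>The disjunct \<open>n = 0\<close> covers vanishing coefficients, where division by zero
  makes all weights 0: the only sequence is then the empty one, with the empty product 1 as its
  probability.\<close>

lemma valid_sim_protocol:
  assumes "\<And>j. j < K \<Longrightarrow> w j \<ge> 0" "n = 0 \<or> (\<Sum>j<K. w j) = 1"
    and "\<And>j. j < K \<Longrightarrow> is_channel (dA * dB * dA) (dA * dB) (swap_channel dA dB \<alpha> (\<beta> j))"
  shows "valid_protocol dA dB K (index_lists K n) (\<lambda>js. prod_list (map w js)) (sim_channel dA dB \<alpha> \<beta>)"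
  unfolding valid_protocol_def
proof (intro conjI ballI)
  show "(\<Sum>js\<in>index_lists K n. prod_list (map w js)) = 1"
    using assms(2) sum_index_lists_prod[of w K n] by auto
  fix js assume "js \<in> index_lists K n"
  then have js: "set js \<subseteq> {..<K}" by (simp add: index_lists_def)
  then show "set js \<subseteq> {..<K}" .
  show "is_channel (dA * dB * dA ^ length js) (dA * dB) (sim_channel dA dB \<alpha> \<beta> js)"
    using js assms(3) by (intro sim_channel_is_channel) auto
  show "0 \<le> prod_list (map w js)" using js assms(1) by (induction js) auto
qed simp

text \<open>For n = 0 nothing is done to the state, which is right in two situations: the evolution
  is trivial, or \<delta> \<ge> 1 tolerates any two states. Otherwise n rounds accumulate the error
  n times 8 x^2.\<close>

lemma sim_protocol_error:
  fixes c :: "nat \<Rightarrow> real" and t \<delta> :: real and n :: nat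
  assumes \<rho>: "\<And>j. j < K \<Longrightarrow> density dA (\<rho> j)" and \<sigma>: "density (dA * dB) \<sigma>"
  defines "ctot \<equiv> (\<Sum>j<K. \<bar>c j\<bar>)"
  defines "y \<equiv> ctot * \<bar>t\<bar>"
  defines "x \<equiv> y / real n"
  assumes n: "(n = 0 \<and> (y = 0 \<and> \<delta> \<ge> 0 \<or> \<delta> \<ge> 1)) \<or> (n > 0 \<and> y > 0 \<and> y \<le> real n \<and> 4 * y\<^sup>2 \<le> real n * \<delta>)"
  defines "U \<equiv> kron (mexp ((- \<i> * complex_of_real t) \<cdot>\<^sub>m ham dA K c \<rho>)) (1\<^sub>m dB)"
  shows "trace_norm (U * \<sigma> * adj U - protocol_output dA dB (index_lists K n) (\<lambda>js. prod_list (map (\<lambda>j. \<bar>c j\<bar> / ctot) js))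
    (sim_channel dA dB (of_real (cos x)) (\<lambda>j. - \<i> * of_real (swap_sign c t j * sin x))) \<rho> \<sigma>) \<le> 2 * \<delta>"
proof -
  let ?N = "dA * dB" and ?w = "\<lambda>j. \<bar>c j\<bar> / ctot"
  let ?\<alpha> = "complex_of_real (cos x)" and ?\<beta> = "\<lambda>j. - \<i> * complex_of_real (swap_sign c t j * sin x)"
  obtain V and l :: "nat \<Rightarrow> real" where V: "unitary dA V" and H: "ham dA K c \<rho> = V * mdiag dA (\<lambda>i. of_real (l i)) * adj V"
    and l: "\<And>i. i < dA \<Longrightarrow> \<bar>l i\<bar> \<le> ctot"
    using ham_spectral[where K = K and dA = dA and \<rho> = \<rho> and c = c, folded ctot_def, OF \<rho>] by blast
  have Vc: "V \<in> carrier_mat dA dA" using V by (rule unitary_carrier)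
  have \<sigma>c: "\<sigma> \<in> carrier_mat ?N ?N" "psd \<sigma>" "mtrace \<sigma> = 1" using \<sigma> by (auto simp: density_def)
  define W where "W = kron V (1\<^sub>m dB)"
  have W: "unitary ?N W" unfolding W_def using V unitary_one by (rule unitary_kron)
  have U: "U = W * mdiag ?N (\<lambda>i. exp (- (\<i> * of_real (t * l (i div dB))))) * adj W"
    unfolding U_def H smult_unitary_conj_mdiag[OF Vc] mexp_unitary_conj_mdiag[OF V] kron_unitary_conj_mdiag[OF Vc] W_def
    by (simp add: mult.assoc)
  have ch: "is_channel (?N * dA) ?N (swap_channel dA dB ?\<alpha> (?\<beta> j))" for j
    by (rule swap_rotation_is_channel) (rule swap_sign_simps)
  have out: "protocol_output dA dB (index_lists K n) (\<lambda>js. prod_list (map ?w js)) (sim_channel dA dB ?\<alpha> ?\<beta>) \<rho> \<sigma> =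
    (avg_step dA dB K ?w ?\<alpha> ?\<beta> \<rho> ^^ n) \<sigma>"
    using ch \<rho> \<sigma>c by (intro protocol_output_eq_avg_step) (auto simp: density_def)
  have "trace_bound ?N (U * \<sigma> * adj U - (avg_step dA dB K ?w ?\<alpha> ?\<beta> \<rho> ^^ n) \<sigma>) (2 * \<delta>)"
  proof (cases "n = 0")
    case True
    show ?thesis
    proof (cases "y = 0")
      case y: True
      \<comment> \<open>The spectral bound gives \<open>|t * l i| \<le> y = 0\<close>, so the
        evolution is the identity even when t itself is nonzero.\<close>
      have "t * l (i div dB) = 0" if "i < ?N" for i
      proof -
        have "\<bar>t\<bar> * \<bar>l (i div dB)\<bar> \<le> \<bar>t\<bar> * ctot"
          using l[OF div_mod_less(1)[OF that]] by (intro mult_left_mono) auto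
        then have "\<bar>t\<bar> * \<bar>l (i div dB)\<bar> \<le> 0" using y unfolding y_def mult.commute[of ctot] by linarith
        then show ?thesis by (simp flip: abs_mult)
      qed
      then have "U = 1\<^sub>m ?N" unfolding U by (intro unitary_conj_mdiag_one[OF W]) (simp only: of_real_0 mult_zero_right minus_zero exp_zero)
      then have "U * \<sigma> * adj U - (avg_step dA dB K ?w ?\<alpha> ?\<beta> \<rho> ^^ n) \<sigma> = 0\<^sub>m ?N ?N - 0\<^sub>m ?N ?N"
        using \<sigma>c True by auto
      moreover have "\<delta> \<ge> 0" using n True by auto
      ultimately show ?thesis
        by (intro trace_boundI[of "0\<^sub>m ?N ?N" ?N "0\<^sub>m ?N ?N"]) (auto simp: psd_zero mtrace_def)
    next
      case False
      \<comment> \<open>Here \<delta> \<ge> 1. Both matrices are states, so they certify the bound 1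
        + 1 for their own difference.\<close>
      have Uu: "unitary ?N U" unfolding U using W by (rule unitary_exp)
      show ?thesis
        by (rule trace_boundI[of "U * \<sigma> * adj U" _ \<sigma>])
          (use \<sigma>c Uu unitary_carrier[OF Uu] False True n in \<open>auto simp: mtrace_unitary_conj intro: psd_conj\<close>)
    qed
  next
    case False
    then have n: "n > 0" "y > 0" "y \<le> real n" "4 * y\<^sup>2 \<le> real n * \<delta>" using n by auto
    have x: "0 < x" "x \<le> 1" "x = ctot * \<bar>t\<bar> / real n" using n by (auto simp: x_def y_def)
    have ct: "ctot > 0"
      using n(2) abs_ge_zero[of t] by (auto simp: y_def zero_less_mult_iff)
    let ?U = "\<lambda>m. W * mdiag ?N (\<lambda>i. exp (- (\<i> * of_real (real m * (t / real n * l (i div dB)))))) * adj W"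
    have "trace_bound ?N (?U n * \<sigma> * adj (?U n) - (avg_step dA dB K ?w ?\<alpha> ?\<beta> \<rho> ^^ n) \<sigma>) (real n * (8 * x\<^sup>2))"
    proof (rule iterated_trace_bound[OF W \<sigma>])
      show "density ?N (avg_step dA dB K ?w ?\<alpha> ?\<beta> \<rho> \<tau>)" if "density ?N \<tau>" for \<tau>
        using ch \<rho> that ct by (intro density_avg_step) (auto simp: ctot_def simp flip: sum_divide_distrib)
      show "trace_bound ?N (?U 1 * \<tau> * adj (?U 1) - avg_step dA dB K ?w ?\<alpha> ?\<beta> \<rho> \<tau>) (8 * x\<^sup>2)" if "density ?N \<tau>" for \<tau>
      proof -
        have "?U 1 = W * mdiag ?N (\<lambda>i. exp (- (\<i> * of_real (t / real n * l (i div dB))))) * adj W" by simp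
        then show ?thesis
          using avg_step_trace_bound[where K = K and dA = dA and \<rho> = \<rho> and n = n and c = c and t = t and V = V
              and l = l and dB = dB and \<tau> = \<tau>, folded ctot_def, folded y_def, folded x_def, folded W_def,
              OF \<rho> n(1) x(1,2) V H l that]
          by (simp only:)
      qed
    qed
    moreover have "?U n = U" unfolding U using n by simp
    \<comment> \<open>With x = y / n the left side is 8 y^2 / n, and 4 y^2 \<le> n \<delta> is tuned
      to this.\<close>
    moreover have "real n * (8 * x\<^sup>2) \<le> 2 * \<delta>"
      using n by (simp add: x_def power_divide field_simps power2_eq_square)
    ultimately show ?thesis by (auto elim: trace_bound_mono)
  qed
  then show ?thesis unfolding out by (rule trace_norm_le)
qed

text \<open>One constant serves all three bounds; 4 is the factor in the number of samples, while
  the trace distance obtained is at most \<delta>. The summand \<open>|c j| / ctot\<close> is the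
  chance of drawing j in the single round that rounding up may add. If all \<open>c j\<close> with j
  < K vanish, this quotient is 0 by the convention for division, and n is 0.\<close>

theorem mainTheorem8:
  "\<exists>C > (0::real). \<forall>(dA::nat) (dB::nat) (K::nat) (c::nat \<Rightarrow> real) (t::real) (\<delta>::real).
     dA > 0 \<longrightarrow> dB > 0 \<longrightarrow> \<delta> > 0 \<longrightarrow>
     (let ctot = (\<Sum>j<K. \<bar>c j\<bar>) in
      \<exists>(n::nat) S p \<Phi>.
        valid_protocol dA dB K S p \<Phi> \<and>
        real n \<le> of_int \<lceil>C * ctot^2 * t^2 / \<delta>\<rceil> \<and>
        (\<forall>js \<in> S. length js \<le> n) \<and>
        (\<forall>j<K. (\<Sum>js\<in>S. p js * real (count_list js j))
                 \<le> C * (\<bar>c j\<bar> * ctot * t^2 / \<delta> + \<bar>c j\<bar> / ctot)) \<and>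
        (\<forall>\<rho> \<sigma>. (\<forall>j<K. density dA (\<rho> j)) \<longrightarrow> density (dA * dB) \<sigma> \<longrightarrow>
           (let U = kron (mexp ((- \<i> * complex_of_real t) \<cdot>\<^sub>m ham dA K c \<rho>)) (1\<^sub>m dB) in
            trace_norm (U * \<sigma> * adj U - protocol_output dA dB S p \<Phi> \<rho> \<sigma>) / 2 \<le> C * \<delta>)))"
  unfolding Let_def
proof (rule exI[of _ 4], intro conjI allI impI)
  fix dA dB K :: nat and c :: "nat \<Rightarrow> real" and t \<delta> :: real
  assume \<delta>: "\<delta> > 0"
  define ctot where "ctot = (\<Sum>j<K. \<bar>c j\<bar>)"
  define y where "y = ctot * \<bar>t\<bar>"
  define z where "z = 4 * ctot\<^sup>2 * t\<^sup>2 / \<delta>"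
  \<comment> \<open>For \<delta> \<ge> 1 the choice 0 avoids rounds whose angle x might exceed
    1.\<close>
  define n where "n = (if \<delta> \<ge> 1 then 0 else nat \<lceil>z\<rceil>)"
  define x where "x = y / real n"
  let ?w = "\<lambda>j. \<bar>c j\<bar> / ctot"
  let ?p = "\<lambda>js. prod_list (map ?w js)"
  let ?\<Phi> = "sim_channel dA dB (of_real (cos x)) (\<lambda>j. - \<i> * of_real (swap_sign c t j * sin x))"
  have ct: "ctot \<ge> 0" unfolding ctot_def by (rule sum_nonneg) simp
  have z: "z \<ge> 0" "z * \<delta> = 4 * y\<^sup>2" using \<delta> by (auto simp: z_def y_def power_mult_distrib)
  have n_le: "real n \<le> of_int \<lceil>z\<rceil>" using z by (auto simp: n_def)
  have n_pos: "ctot > 0 \<and> y > 0 \<and> y \<le> real n \<and> 4 * y\<^sup>2 \<le> real n * \<delta>" if "n > 0"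
  proof -
    have \<delta>1: "\<delta> < 1" and nz: "real n = of_int \<lceil>z\<rceil>" and "z > 0"
      using that z(1) by (auto simp: n_def split: if_splits)
    then have y: "y > 0" using z(2) \<delta> ct by (auto simp: y_def less_le)
    have zn: "z \<le> real n" unfolding nz by (rule le_of_int_ceiling)
    then have yn: "4 * y\<^sup>2 \<le> real n * \<delta>" using z(2) \<delta> by (metis mult_right_mono less_imp_le)
    \<comment> \<open>Since \<delta> < 1 \<le> n. This is how a small \<delta> keeps the angle y / n
      at most 1.\<close>
    also have "\<dots> \<le> real n * real n" using \<delta>1 that by (intro mult_left_mono) auto
    finally have "y\<^sup>2 \<le> (real n)\<^sup>2" using zero_le_power2[of y] unfolding power2_eq_square[of "real n"] by linarith
    then have "y \<le> real n" by (rule power2_le_imp_le) simp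
    then show ?thesis using y yn ct by (auto simp: y_def less_le)
  qed
  have w: "(\<Sum>j<K. ?w j) = 1" if "n > 0" using n_pos[OF that] by (simp add: ctot_def flip: sum_divide_distrib)
  have n_cases: "(n = 0 \<and> (y = 0 \<and> \<delta> \<ge> 0 \<or> \<delta> \<ge> 1)) \<or> (n > 0 \<and> y > 0 \<and> y \<le> real n \<and> 4 * y\<^sup>2 \<le> real n * \<delta>)"
  proof (cases "n = 0")
    case True
    then have "\<delta> \<ge> 1 \<or> z \<le> 0" by (auto simp: n_def split: if_splits)
    then have "\<delta> \<ge> 1 \<or> z = 0" using z(1) by linarith
    then show ?thesis using True z(2) \<delta> by auto
  qed (use n_pos in auto)
  show "\<exists>n S p \<Phi>. valid_protocol dA dB K S p \<Phi> \<and>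
      real n \<le> of_int \<lceil>4 * (\<Sum>j<K. \<bar>c j\<bar>)\<^sup>2 * t\<^sup>2 / \<delta>\<rceil> \<and> (\<forall>js\<in>S. length js \<le> n) \<and>
      (\<forall>j<K. (\<Sum>js\<in>S. p js * real (count_list js j)) \<le> 4 * (\<bar>c j\<bar> * (\<Sum>j<K. \<bar>c j\<bar>) * t\<^sup>2 / \<delta> + \<bar>c j\<bar> / (\<Sum>j<K. \<bar>c j\<bar>))) \<and>
      (\<forall>\<rho> \<sigma>. (\<forall>j<K. density dA (\<rho> j)) \<longrightarrow> density (dA * dB) \<sigma> \<longrightarrow>
        trace_norm (kron (mexp ((- \<i> * complex_of_real t) \<cdot>\<^sub>m ham dA K c \<rho>)) (1\<^sub>m dB) * \<sigma> *
          adj (kron (mexp ((- \<i> * complex_of_real t) \<cdot>\<^sub>m ham dA K c \<rho>)) (1\<^sub>m dB)) - protocol_output dA dB S p \<Phi> \<rho> \<sigma>) / 2 \<le> 4 * \<delta>)"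
    unfolding ctot_def[symmetric]
  proof (rule exI[of _ n], rule exI[of _ "index_lists K n"], rule exI[of _ ?p], rule exI[of _ ?\<Phi>], intro conjI allI impI ballI)
    show "valid_protocol dA dB K (index_lists K n) ?p ?\<Phi>"
      using w ct by (intro valid_sim_protocol swap_rotation_is_channel swap_sign_simps) auto
    show "real n \<le> of_int \<lceil>4 * ctot\<^sup>2 * t\<^sup>2 / \<delta>\<rceil>" using n_le by (simp add: z_def)
    show "length js \<le> n" if "js \<in> index_lists K n" for js using that by (simp add: index_lists_def)
    show "(\<Sum>js\<in>index_lists K n. ?p js * real (count_list js j)) \<le> 4 * (\<bar>c j\<bar> * ctot * t\<^sup>2 / \<delta> + \<bar>c j\<bar> / ctot)"
      if j: "j < K" for j
    proof (cases "n = 0")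
      case True
      then show ?thesis using ct \<delta> by simp
    next
      case False
      then have ctp: "ctot > 0" using n_pos by auto
      have "(\<Sum>js\<in>index_lists K n. ?p js * real (count_list js j)) = real n * ?w j"
        using False w j by (intro sum_index_lists_count) auto
      \<comment> \<open>Rounding up adds less than one round to z; the 1 becomes the summand
        \<open>|c j| / ctot\<close>.\<close>
      also have "\<dots> \<le> (z + 1) * ?w j"
        using n_le ceiling_correct[of z] ctp by (intro mult_right_mono) auto
      also have "\<dots> = 4 * (\<bar>c j\<bar> * ctot * t\<^sup>2 / \<delta>) + \<bar>c j\<bar> / ctot"
        using ctp by (simp add: z_def field_simps power2_eq_square)
      also have "\<dots> \<le> 4 * (\<bar>c j\<bar> * ctot * t\<^sup>2 / \<delta> + \<bar>c j\<bar> / ctot)"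
        using divide_nonneg_pos[OF abs_ge_zero[of "c j"] ctp] unfolding distrib_left
        by (intro add_left_mono) (simp add: mult_le_cancel_right1)
      finally show ?thesis .
    qed
    fix \<rho> \<sigma> assume \<rho>: "\<forall>j<K. density dA (\<rho> j)" and \<sigma>: "density (dA * dB) \<sigma>"
    have "trace_norm (kron (mexp ((- \<i> * complex_of_real t) \<cdot>\<^sub>m ham dA K c \<rho>)) (1\<^sub>m dB) * \<sigma> *
          adj (kron (mexp ((- \<i> * complex_of_real t) \<cdot>\<^sub>m ham dA K c \<rho>)) (1\<^sub>m dB)) - protocol_output dA dB (index_lists K n) ?p ?\<Phi> \<rho> \<sigma>) \<le> 2 * \<delta>"
    proof (rule sim_protocol_error[where K = K and dA = dA and \<rho> = \<rho> and n = n and c = c and t = t and \<delta> = \<delta>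
          and dB = dB and \<sigma> = \<sigma>, folded ctot_def, folded y_def, folded x_def])
      show "density dA (\<rho> j)" if "j < K" for j using \<rho> that by blast
    qed (fact \<sigma> n_cases)+
    then show "trace_norm (kron (mexp ((- \<i> * complex_of_real t) \<cdot>\<^sub>m ham dA K c \<rho>)) (1\<^sub>m dB) * \<sigma> *
          adj (kron (mexp ((- \<i> * complex_of_real t) \<cdot>\<^sub>m ham dA K c \<rho>)) (1\<^sub>m dB)) - protocol_output dA dB (index_lists K n) ?p ?\<Phi> \<rho> \<sigma>) / 2 \<le> 4 * \<delta>"
      using \<delta> by simp
  qed
qed simp

end
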